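(* Let $\Omega$ be a (one-dimensional, FLC, minimal) uniquely ergodic tiling space. If $F\in\mathcal F(\Omega)$ and if the rotation class $[\mu]$ of $F$ exists and is irrational, then $F$ is semi-conjugate to the time-one sampling of a strongly pattern-equivariant uni-directional flow on $\Omega$.
   Context: Tilings: A tile is a pair $(I,\ell)$, with $I\subset\mathbb R$ a closed bounded interval of positive length and $\ell$ a label from a finite alphabet; tiles with the same label have the same length. $(I,\ell)-s=(I-s,\ell)$. A tiling $T$ is a collection of tiles meeting only at boundaries with union $\mathbb R$; $T-s$ is obtained by translating all tiles, and $\Gamma_s(T)=T-s$. (Such tilings have finite local complexity, FLC.) $d(T,T')$ is the infimum of the $\epsilon\in(0,1)$ for which there are $|s_1|,|s_2|\le\epsilon/2$ with $T-s_1$ and $T'-s_2$ agreeing exactly on $[-\epsilon^{-1},\epsilon^{-1}]$ ($1$ if there is none). $T$ is repetitive if for each finite pattern $P$ of $T$ there is $L_P$ such that every interval of length $L_P$ in $T$ contains a copy of $P$. A tiling space $\Omega$ is the closure of the translation orbit $\{T-s\}$ of a repetitive non-periodic tiling; it is compact, minimal under $\Gamma$, and its path components are the translation orbits. Uniquely ergodic means that $(\Omega,\Gamma)$ has a unique invariant probability measure. The orbit of a reference tiling $T\in\Omega$ is identified with $\mathbb R$ by $T-x\leftrightarrow x$. Pattern equivariance: A continuous $\phi:\mathbb R\to\mathbb R$ is pattern equivariant with radius $R$ with respect to $T$ if $\phi(x_1)=\phi(x_2)$ whenever $T-x_1$ and $T-x_2$ agree exactly on $[-R,R]$; it is strongly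 pattern equivariant (sPE) if this holds for some $R>0$. A continuous $G:\Omega\to\mathbb R$ is sPE if $x\mapsto G(T-x)$ is sPE with respect to $T$ (for one, equivalently every, $T\in\Omega$). An sPE 1-form with respect to $T$ is $g(x)\,dx$ with $g$ sPE. Two sPE 1-forms are cohomologous if they differ by $dg$ with $g$ sPE; $[\mu]$ denotes the class of $\mu$ in $\{\text{sPE 1-forms}\}/d\{\text{sPE functions}\}\cong\check H^1(\Omega,\mathbb R)$. Maps: $\mathcal F(\Omega)$ is the set of homeomorphisms $F:\Omega\to\Omega$, homotopic to the identity, such that the displacement $\Phi:\Omega\to\mathbb R$, defined by $F(T)=T-\Phi(T)$, is sPE. For a reference tiling $T$, $f_T:\mathbb R\to\mathbb R$ is given by $F(T-x)=T-f_T(x)$. Rotation forms: An sPE 1-form $\mu$ (with respect to a reference tiling $T$) is a rotation form for $F$ if there is $R$ such that, for all $x_1,x_2\in\mathbb R$ for which $T-x_1$ and $T-x_2$ agree on the ball of radius $R$ about the origin, and all integers $n_\pm$ with $n_-<\int_{x_1}^{x_2}\mu<n_+$, the point $x_2$ is strictly between $f_T^{n_-}(x_1)$ and $f_T^{n_+}(x_1)$. Any form cohomologous to a rotation form is a rotation form, and $[\mu]$ is then called a rotation class. Shape change and irrationality: Let $\mu$ be a positive sPE 1-form of radius $R$ with respect to $T$. Relabel (collar) the tiles of $T$ so that the label of each tile records the pattern of $T$ around it out to distance $R$; this does not change the space up to translation-commuting homeomorphism. Let $T'$ be obtained by keeping labels and moving each vertex $x$ of $T$ to $\int_0^x\mu$.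 The orbit closure $\Omega_\mu$ of $T'$ is the shape change of $\Omega$ by $\mu$, and $T-x\mapsto T'-\int_0^x\mu$ extends to a homeomorphism $S:\Omega\to\Omega_\mu$. Shape changes by negative forms are defined similarly (and reverse orientation). A class is irrational if it is represented by a positive (or negative) sPE 1-form $\mu$ such that $\Omega_\mu$ is minimal under the action of $\Gamma_1$ (translation by $1$); this does not depend on the choice of representative. Flows: A strongly pattern-equivariant flow (flow with sPE velocity) is a continuous $\bar F:\Omega\times\mathbb R\to\Omega$ for which there is an sPE $V:\Omega\to\mathbb R$ with $\bar F(T,t)=T-x_T(t)$, $x_T(0)=0$, $\frac{dx_T}{dt}=V(T-x_T(t))$. It is uni-directional if $V$ has no zeros. Its time-one sampling is $T\mapsto\bar F(T,1)$. Semi-conjugacy: $F$ on $\Omega$ is semi-conjugate to $F'$ on $\Omega'$ if there is a continuous map $H:\Omega\to\Omega'$ with $F'\circ H=H\circ F$. *)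

theory Defs
  imports "HOL-Probability.Probability"
begin

section \<open>Tilings of the line\<close>

type_synonym 'a tile = "real set \<times> 'a"
type_synonym 'a tiling = "'a tile set"

text \<open>The type \<open>'a\<close> of labels may be infinite; the alphabet of a tiling is the finite set of
  labels that occur in it.\<close>

definition tiling :: "'a tiling \<Rightarrow> bool" where
  "tiling T \<longleftrightarrow>
     (\<forall>t\<in>T. \<exists>a b. a < b \<and> fst t = {a..b}) \<and>
     finite (snd ` T) \<and>
     (\<forall>t\<in>T. \<forall>t'\<in>T. snd t = snd t' \<longrightarrow> measure lborel (fst t) = measure lborel (fst t')) \<and>
     (\<forall>t\<in>T. \<forall>t'\<in>T. t \<noteq> t' \<longrightarrow> interior (fst t) \<inter> interior (fst t') = {}) \<and>
     (\<Union>t\<in>T. fst t) = UNIV"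

text \<open>\<open>translate s T\<close> is $T - s$, that is, $\Gamma_s(T)$.\<close>

definition translate :: "real \<Rightarrow> 'a tiling \<Rightarrow> 'a tiling" where
  "translate s T = (\<lambda>(I, l). ((\<lambda>x. x - s) ` I, l)) ` T"

text \<open>Exact agreement on $[-R,R]$: the same (whole) tiles meet $[-R,R]$.\<close>

definition agree :: "real \<Rightarrow> 'a tiling \<Rightarrow> 'a tiling \<Rightarrow> bool" where
  "agree R T T' \<longleftrightarrow>
     {t \<in> T. fst t \<inter> {-R..R} \<noteq> {}} = {t \<in> T'. fst t \<inter> {-R..R} \<noteq> {}}"

definition close_scales :: "'a tiling \<Rightarrow> 'a tiling \<Rightarrow> real set" where
  "close_scales T T' =
     {\<epsilon>. 0 < \<epsilon> \<and> \<epsilon> < 1 \<and>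
        (\<exists>s1 s2. \<bar>s1\<bar> \<le> \<epsilon> / 2 \<and> \<bar>s2\<bar> \<le> \<epsilon> / 2 \<and>
           agree (1 / \<epsilon>) (translate s1 T) (translate s2 T'))}"

definition tiling_dist :: "'a tiling \<Rightarrow> 'a tiling \<Rightarrow> real" where
  "tiling_dist T T' = (if close_scales T T' = {} then 1 else Inf (close_scales T T'))"

lemma translate_iff:
  "(I, l) \<in> translate s T \<longleftrightarrow> ((\<lambda>x. x + s) ` I, l) \<in> T"
proof
  assume "(I, l) \<in> translate s T"
  then obtain J where "(J, l) \<in> T" "I = (\<lambda>x. x - s) ` J"
    by (auto simp: translate_def)
  then show "((\<lambda>x. x + s) ` I, l) \<in> T"
    by (simp add: image_image)
next
  assume "((\<lambda>x. x + s) ` I, l) \<in> T"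
  then have "((\<lambda>x. x - s) ` (\<lambda>x. x + s) ` I, l) \<in> translate s T"
    unfolding translate_def by force
  then show "(I, l) \<in> translate s T"
    by (simp add: image_image)
qed

lemma translate_translate: "translate s (translate t T) = translate (s + t) T"
  by (auto simp: translate_iff image_image algebra_simps)

lemma translate_0 [simp]: "translate 0 T = T"
  by (auto simp: translate_iff)

lemma agree_translate:
  fixes T T' :: "'a tiling"
  assumes "agree R T T'" "R' + \<bar>u\<bar> \<le> R"
  shows "agree R' (translate u T) (translate u T')"
proof -
  have *: "(I, l) \<in> translate u T2"
    if "agree R T1 T2" "(I, l) \<in> translate u T1" and I: "I \<inter> {-R'..R'} \<noteq> {}"
    for T1 T2 :: "'a tiling" and I l
  proof -
    obtain x where x: "x \<in> I" "-R' \<le> x" "x \<le> R'"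
      using I by auto
    have "x + u \<in> (\<lambda>x. x + u) ` I \<inter> {-R..R}"
      using x assms(2) by auto
    moreover have "((\<lambda>x. x + u) ` I, l) \<in> T1"
      using that by (simp add: translate_iff)
    ultimately have "((\<lambda>x. x + u) ` I, l) \<in> {t \<in> T1. fst t \<inter> {-R..R} \<noteq> {}}"
      by auto
    then have "((\<lambda>x. x + u) ` I, l) \<in> T2"
      using that unfolding agree_def by blast
    then show ?thesis
      by (simp add: translate_iff)
  qed
  have "agree R T' T"
    using assms(1) by (simp add: agree_def)
  moreover have "{t \<in> translate u T1. fst t \<inter> {-R'..R'} \<noteq> {}}
      \<subseteq> {t \<in> translate u T2. fst t \<inter> {-R'..R'} \<noteq> {}}"
    if "agree R T1 T2" for T1 T2 :: "'a tiling"
  proof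
    fix t assume t: "t \<in> {t \<in> translate u T1. fst t \<inter> {-R'..R'} \<noteq> {}}"
    obtain I l where "t = (I, l)"
      by (cases t)
    then show "t \<in> {t \<in> translate u T2. fst t \<inter> {-R'..R'} \<noteq> {}}"
      using *[OF that, of I l] t by simp
  qed
  ultimately show ?thesis
    using assms(1) by (simp add: agree_def[of R'] subset_antisym)
qed

lemma close_scales_commute: "close_scales T T' = close_scales T' T"
  for T T' :: "'a tiling"
proof -
  have "agree R T1 T2 \<longleftrightarrow> agree R T2 T1" for R and T1 T2 :: "'a tiling"
    by (auto simp: agree_def)
  then show ?thesis
    unfolding close_scales_def by blast
qed

lemma tiling_dist_nonneg: "0 \<le> tiling_dist T T'"
  by (auto simp: tiling_dist_def close_scales_def intro!: cInf_greatest)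

lemma tiling_dist_le: "\<epsilon> \<in> close_scales T T' \<Longrightarrow> tiling_dist T T' \<le> \<epsilon>"
  by (auto simp: tiling_dist_def close_scales_def intro!: cInf_lower bdd_belowI[of _ 0])

lemma tiling_dist_le_1: "tiling_dist T T' \<le> 1"
proof (cases "close_scales T T' = {}")
  case False
  then obtain e where "e \<in> close_scales T T'" by blast
  then show ?thesis
    using tiling_dist_le[of e T T'] by (auto simp: close_scales_def)
qed (simp add: tiling_dist_def)

lemma tiling_dist_lessD:
  assumes "tiling_dist T T' < r" "r \<le> 1"
  obtains \<epsilon> where "\<epsilon> \<in> close_scales T T'" "\<epsilon> < r"
proof -
  have "close_scales T T' \<noteq> {}"
    using assms by (auto simp: tiling_dist_def)
  then show ?thesis
    using assms(1) that cInf_lessD[of "close_scales T T'" r] by (auto simp: tiling_dist_def)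
qed

lemma close_scales_add:
  assumes "e1 \<in> close_scales A B" "e2 \<in> close_scales B C" "e1 + e2 < 1"
  shows "e1 + e2 \<in> close_scales A C"
proof -
  obtain s1 s2 where s: "\<bar>s1\<bar> \<le> e1 / 2" "\<bar>s2\<bar> \<le> e1 / 2"
      "agree (1 / e1) (translate s1 A) (translate s2 B)" "0 < e1"
    using assms(1) by (auto simp: close_scales_def)
  obtain s3 s4 where s': "\<bar>s3\<bar> \<le> e2 / 2" "\<bar>s4\<bar> \<le> e2 / 2"
      "agree (1 / e2) (translate s3 B) (translate s4 C)" "0 < e2"
    using assms(2) by (auto simp: close_scales_def)
  have key: "1 / (a + b) + b / 2 \<le> 1 / a" if "0 < a" "0 < b" "a + b < 1" for a b :: real
  proof -
    have "a * (a + b) \<le> 1 * 1"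
      using that by (intro mult_mono) auto
    then have "b / 2 \<le> b / (a * (a + b))"
      using that by (intro divide_left_mono) auto
    also have "\<dots> = 1 / a - 1 / (a + b)"
      using that by (simp add: field_simps)
    finally show ?thesis by simp
  qed
  have "1 / (e1 + e2) + \<bar>s3\<bar> \<le> 1 / e1"
    using key[of e1 e2] s s' assms(3) by linarith
  then have 1: "agree (1 / (e1 + e2)) (translate (s3 + s1) A) (translate (s3 + s2) B)"
    using agree_translate[OF s(3)] by (simp add: translate_translate)
  have "1 / (e1 + e2) + \<bar>s2\<bar> \<le> 1 / e2"
    using key[of e2 e1] s s' assms(3) by (simp add: add.commute)
  then have 2: "agree (1 / (e1 + e2)) (translate (s3 + s2) B) (translate (s2 + s4) C)"
    using agree_translate[OF s'(3), of "1 / (e1 + e2)" s2]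
    by (simp add: translate_translate add.commute)
  have "agree (1 / (e1 + e2)) (translate (s3 + s1) A) (translate (s2 + s4) C)"
    using 1 2 by (simp add: agree_def)
  moreover have "\<bar>s3 + s1\<bar> \<le> (e1 + e2) / 2"
    using s(1) s'(1) abs_triangle_ineq[of s3 s1] by (simp add: field_simps)
  moreover have "\<bar>s2 + s4\<bar> \<le> (e1 + e2) / 2"
    using s(2) s'(2) abs_triangle_ineq[of s2 s4] by (simp add: field_simps)
  ultimately show ?thesis
    using s(4) s'(4) assms(3) unfolding close_scales_def
    by (intro CollectI conjI exI[of _ "s3 + s1"] exI[of _ "s2 + s4"]) simp_all
qed

lemma tiling_dist_zeroD:
  assumes T: "tiling T" and T': "tiling T'" and d: "tiling_dist T T' = 0"
  shows "T \<subseteq> T'"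
proof
  fix t assume "t \<in> T"
  then obtain a b l where t: "t = ({a..b}, l)" "a < b" "({a..b}, l) \<in> T"
    using T unfolding tiling_def by (metis prod.collapse)
  have ex: "\<exists>\<delta>. \<bar>\<delta>\<bar> < r \<and> ({a + \<delta>..b + \<delta>}, l) \<in> T'" if "0 < r" for r
  proof -
    define r' where "r' = min r (1 / (\<bar>a\<bar> + 2))"
    have r': "0 < r'" "r' \<le> r" "r' \<le> 1 / (\<bar>a\<bar> + 2)"
      using that by (auto simp: r'_def)
    have "r' \<le> 1"
      by (rule order_trans[OF r'(3)]) simp
    then obtain e where e: "e \<in> close_scales T T'" "e < r'"
      using tiling_dist_lessD[of T T' r'] d r' by auto
    then obtain s1 s2 where s: "\<bar>s1\<bar> \<le> e / 2" "\<bar>s2\<bar> \<le> e / 2" "0 < e" "e < 1"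
        "agree (1 / e) (translate s1 T) (translate s2 T')"
      by (auto simp: close_scales_def)
    have "e \<le> 1 / (\<bar>a\<bar> + 2)"
      using e r' by linarith
    then have ae: "\<bar>a\<bar> + 2 \<le> 1 / e"
      using s(3) by (simp add: field_simps)
    have "({a - s1..b - s1}, l) \<in> translate s1 T"
      using t by (simp add: translate_iff)
    moreover have "a - s1 \<in> {a - s1..b - s1} \<inter> {-(1 / e)..1 / e}"
      using ae s t(2) by auto
    ultimately have "({a - s1..b - s1}, l) \<in> {t \<in> translate s1 T. fst t \<inter> {-(1 / e)..1 / e} \<noteq> {}}"
      by auto
    then have "({a - s1..b - s1}, l) \<in> translate s2 T'"
      using s(5) unfolding agree_def by blast
    then have "({a + (s2 - s1)..b + (s2 - s1)}, l) \<in> T'"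
      by (simp add: translate_iff algebra_simps)
    moreover have "\<bar>s2 - s1\<bar> < r"
      using s e r' by linarith
    ultimately show ?thesis by blast
  qed
  obtain \<delta> where \<delta>: "\<bar>\<delta>\<bar> < (b - a) / 2" "({a + \<delta>..b + \<delta>}, l) \<in> T'"
    using ex[of "(b - a) / 2"] t(2) by auto
  have "\<delta> = 0"
  proof (rule ccontr)
    assume "\<delta> \<noteq> 0"
    then obtain \<eta> where \<eta>: "\<bar>\<eta>\<bar> < \<bar>\<delta>\<bar>" "({a + \<eta>..b + \<eta>}, l) \<in> T'"
      using ex[of "\<bar>\<delta>\<bar>"] by auto
    have "({a + \<delta>..b + \<delta>}, l) \<noteq> ({a + \<eta>..b + \<eta>}, l)"
      using \<eta>(1) t(2) by auto
    then have disj: "interior {a + \<delta>..b + \<delta>} \<inter> interior {a + \<eta>..b + \<eta>} = {}"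
      using T' \<delta>(2) \<eta>(2) unfolding tiling_def by (metis fst_conv)
    have mid: "a + \<xi> < (a + b) / 2 \<and> (a + b) / 2 < b + \<xi>" if "\<bar>\<xi>\<bar> < (b - a) / 2" for \<xi>
      using that by (auto simp: abs_less_iff field_simps)
    have "(a + b) / 2 \<in> interior {a + \<delta>..b + \<delta>} \<inter> interior {a + \<eta>..b + \<eta>}"
      unfolding interior_atLeastAtMost_real Int_iff greaterThanLessThan_iff
      using mid[OF \<delta>(1)] mid[OF less_trans[OF \<eta>(1) \<delta>(1)]] by blast
    with disj show False by blast
  qed
  then show "t \<in> T'"
    using \<delta> t by simp
qed

lemma Metric_space_tilings: "Metric_space {T. tiling T} tiling_dist"
proof
  show "0 \<le> tiling_dist T T'" for T T' :: "'a tiling"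
    by (rule tiling_dist_nonneg)
  show comm: "tiling_dist T T' = tiling_dist T' T" for T T' :: "'a tiling"
    by (simp add: tiling_dist_def close_scales_commute)
  show "tiling_dist T T' = 0 \<longleftrightarrow> T = T'"
    if "T \<in> {T. tiling T}" "T' \<in> {T. tiling T}" for T T' :: "'a tiling"
  proof
    assume "tiling_dist T T' = 0"
    then show "T = T'"
      using tiling_dist_zeroD[of T T'] tiling_dist_zeroD[of T' T] comm that by auto
  next
    assume "T = T'"
    have "tiling_dist T T' \<le> 0 + e" if "0 < e" for e
    proof -
      have "min e (1 / 2) \<in> close_scales T T'"
        using that \<open>T = T'\<close> by (auto simp: close_scales_def agree_def intro!: exI[of _ 0])
      then show ?thesis
        using tiling_dist_le by fastforce
    qed
    then have "tiling_dist T T' \<le> 0"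
      by (rule field_le_epsilon)
    then show "tiling_dist T T' = 0"
      using tiling_dist_nonneg[of T T'] by simp
  qed
  show "tiling_dist A C \<le> tiling_dist A B + tiling_dist B C" for A B C :: "'a tiling"
  proof (rule field_le_epsilon)
    fix e :: real assume e: "0 < e"
    show "tiling_dist A C \<le> tiling_dist A B + tiling_dist B C + e"
    proof (cases "tiling_dist A B + tiling_dist B C + e < 1")
      case False
      then show ?thesis using tiling_dist_le_1[of A C] by simp
    next
      case True
      obtain e1 where e1: "e1 \<in> close_scales A B" "e1 < tiling_dist A B + e / 2"
        using tiling_dist_lessD[of A B "tiling_dist A B + e / 2"] True e tiling_dist_nonneg[of B C]
        by auto
      obtain e2 where e2: "e2 \<in> close_scales B C" "e2 < tiling_dist B C + e / 2"
        using tiling_dist_lessD[of B C "tiling_dist B C + e / 2"] True e tiling_dist_nonneg[of A B]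
        by auto
      have "e1 + e2 \<in> close_scales A C"
        using close_scales_add[OF e1(1) e2(1)] e1 e2 True by simp
      then show ?thesis
        using tiling_dist_le[of "e1 + e2" A C] e1 e2 by simp
    qed
  qed
qed

definition tiling_topology :: "'a tiling topology" where
  "tiling_topology = Metric_space.mtopology {T. tiling T} tiling_dist"

definition repetitive :: "'a tiling \<Rightarrow> bool" where
  "repetitive T \<longleftrightarrow>
     (\<forall>P. finite P \<and> P \<subseteq> T \<longrightarrow>
        (\<exists>L>0. \<forall>a. \<exists>s. translate s P \<subseteq> T \<and> (\<Union>t\<in>translate s P. fst t) \<subseteq> {a..a + L}))"

definition nonperiodic :: "'a tiling \<Rightarrow> bool" where
  "nonperiodic T \<longleftrightarrow> (\<forall>s. s \<noteq> 0 \<longrightarrow> translate s T \<noteq> T)"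

definition orbit_closure :: "'a tiling \<Rightarrow> 'a tiling set" where
  "orbit_closure T = tiling_topology closure_of (range (\<lambda>s. translate s T))"

definition tiling_space :: "'a tiling set \<Rightarrow> bool" where
  "tiling_space \<Omega> \<longleftrightarrow>
     (\<exists>T. tiling T \<and> repetitive T \<and> nonperiodic T \<and> \<Omega> = orbit_closure T)"

abbreviation space_topology :: "'a tiling set \<Rightarrow> 'a tiling topology" where
  "space_topology \<Omega> \<equiv> subtopology tiling_topology \<Omega>"

definition uniquely_ergodic :: "'a tiling set \<Rightarrow> bool" where
  "uniquely_ergodic \<Omega> \<longleftrightarrow>
     (\<exists>!M. prob_space M \<and> space M = \<Omega> \<and>
        sets M = sigma_sets \<Omega> {U. openin (space_topology \<Omega>) U} \<and>
        (\<forall>s. translate s \<in> measurable M M \<and> distr M M (translate s) = M))"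


section \<open>Pattern equivariance\<close>

definition pe_radius :: "'a tiling \<Rightarrow> real \<Rightarrow> (real \<Rightarrow> 'b) \<Rightarrow> bool" where
  "pe_radius T R \<phi> \<longleftrightarrow>
     (\<forall>x1 x2. agree R (translate x1 T) (translate x2 T) \<longrightarrow> \<phi> x1 = \<phi> x2)"

text \<open>An sPE 1-form $g(x)\,dx$ is represented by its coefficient $g$, which is an sPE function.\<close>

definition spe :: "'a tiling \<Rightarrow> (real \<Rightarrow> real) \<Rightarrow> bool" where
  "spe T \<phi> \<longleftrightarrow> continuous_on UNIV \<phi> \<and> (\<exists>R>0. pe_radius T R \<phi>)"

definition spe_on :: "'a tiling set \<Rightarrow> ('a tiling \<Rightarrow> real) \<Rightarrow> bool" where
  "spe_on \<Omega> G \<longleftrightarrow>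
     continuous_map (space_topology \<Omega>) euclideanreal G \<and>
     (\<forall>T\<in>\<Omega>. spe T (\<lambda>x. G (translate x T)))"

definition cohomologous :: "'a tiling \<Rightarrow> (real \<Rightarrow> real) \<Rightarrow> (real \<Rightarrow> real) \<Rightarrow> bool" where
  "cohomologous T \<mu> \<nu> \<longleftrightarrow>
     (\<exists>g. spe T g \<and> (\<forall>x. (g has_real_derivative (\<nu> x - \<mu> x)) (at x)))"

definition cohomology_class :: "'a tiling \<Rightarrow> (real \<Rightarrow> real) \<Rightarrow> (real \<Rightarrow> real) set" where
  "cohomology_class T \<mu> = {\<nu>. spe T \<nu> \<and> cohomologous T \<mu> \<nu>}"


section \<open>Maps and rotation forms\<close>

definition tiling_maps :: "'a tiling set \<Rightarrow> ('a tiling \<Rightarrow> 'a tiling) set" where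
  "tiling_maps \<Omega> =
     {F. homeomorphic_map (space_topology \<Omega>) (space_topology \<Omega>) F \<and>
         homotopic_with (\<lambda>_. True) (space_topology \<Omega>) (space_topology \<Omega>) F id \<and>
         (\<exists>\<Phi>. spe_on \<Omega> \<Phi> \<and> (\<forall>T\<in>\<Omega>. F T = translate (\<Phi> T) T))}"

text \<open>The map $f_T$; the value is unique because $F$ preserves translation orbits and
  no tiling in a tiling space has a period.\<close>

definition line_map :: "('a tiling \<Rightarrow> 'a tiling) \<Rightarrow> 'a tiling \<Rightarrow> real \<Rightarrow> real" where
  "line_map F T x = (THE y. F (translate x T) = translate y T)"

text \<open>Integer iterates of a bijection.\<close>

definition int_iterate :: "('b \<Rightarrow> 'b) \<Rightarrow> int \<Rightarrow> 'b \<Rightarrow> 'b" where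
  "int_iterate f n = (if 0 \<le> n then f ^^ nat n else inv f ^^ nat (- n))"

definition strictly_between :: "real \<Rightarrow> real \<Rightarrow> real \<Rightarrow> bool" where
  "strictly_between x a b \<longleftrightarrow> (a < x \<and> x < b) \<or> (b < x \<and> x < a)"

definition form_integral :: "(real \<Rightarrow> real) \<Rightarrow> real \<Rightarrow> real \<Rightarrow> real" where
  "form_integral \<mu> x1 x2 = (LBINT x=x1..x2. \<mu> x)"

definition rotation_form ::
    "('a tiling \<Rightarrow> 'a tiling) \<Rightarrow> 'a tiling \<Rightarrow> (real \<Rightarrow> real) \<Rightarrow> bool" where
  "rotation_form F T \<mu> \<longleftrightarrow>
     spe T \<mu> \<and>
     (\<exists>R>0. \<forall>x1 x2. agree R (translate x1 T) (translate x2 T) \<longrightarrow>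
        (\<forall>m n :: int.
           of_int m < form_integral \<mu> x1 x2 \<and> form_integral \<mu> x1 x2 < of_int n \<longrightarrow>
           strictly_between x2
             (int_iterate (line_map F T) m x1) (int_iterate (line_map F T) n x1)))"


section \<open>Shape changes and irrational classes\<close>

text \<open>The pattern of $T$ around the tile with support $I$, out to distance $R$, moved so that
  the left endpoint of $I$ is at the origin.\<close>

definition collar :: "real \<Rightarrow> 'a tiling \<Rightarrow> real set \<Rightarrow> 'a tiling" where
  "collar R T I = translate (Inf I) {t \<in> T. \<exists>x\<in>fst t. \<exists>y\<in>I. \<bar>x - y\<bar> \<le> R}"

text \<open>The tiling $T'$. The image of a tile $[a,b]$ under the monotone map
  $x \mapsto \int_0^x \mu$ is $[\int_0^a\mu, \int_0^b\mu]$ for positive and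
  $[\int_0^b\mu, \int_0^a\mu]$ for negative $\mu$.\<close>

definition reshape ::
    "real \<Rightarrow> (real \<Rightarrow> real) \<Rightarrow> 'a tiling \<Rightarrow> ('a \<times> 'a tiling) tiling" where
  "reshape R \<mu> T = (\<lambda>(I, l). (form_integral \<mu> 0 ` I, (l, collar R T I))) ` T"

definition shape_change ::
    "real \<Rightarrow> (real \<Rightarrow> real) \<Rightarrow> 'a tiling \<Rightarrow> ('a \<times> 'a tiling) tiling set" where
  "shape_change R \<mu> T = orbit_closure (reshape R \<mu> T)"

definition minimal_map :: "'b topology \<Rightarrow> ('b \<Rightarrow> 'b) \<Rightarrow> bool" where
  "minimal_map X f \<longleftrightarrow>
     (\<forall>C. closedin X C \<and> f ` C = C \<longrightarrow> C = {} \<or> C = topspace X)"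

definition irrational_class :: "'a tiling \<Rightarrow> (real \<Rightarrow> real) set \<Rightarrow> bool" where
  "irrational_class T c \<longleftrightarrow>
     (\<exists>\<mu>\<in>c. \<exists>R>0. pe_radius T R \<mu> \<and> ((\<forall>x. 0 < \<mu> x) \<or> (\<forall>x. \<mu> x < 0)) \<and>
        minimal_map (space_topology (shape_change R \<mu> T)) (translate 1))"


section \<open>Flows and semi-conjugacy\<close>

definition spe_flow ::
    "'a tiling set \<Rightarrow> ('a tiling \<Rightarrow> real) \<Rightarrow> ('a tiling \<times> real \<Rightarrow> 'a tiling) \<Rightarrow> bool" where
  "spe_flow \<Omega> V \<Psi> \<longleftrightarrow>
     spe_on \<Omega> V \<and>
     continuous_map (prod_topology (space_topology \<Omega>) euclideanreal) (space_topology \<Omega>) \<Psi> \<and>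
     (\<forall>T\<in>\<Omega>. \<exists>x :: real \<Rightarrow> real. x 0 = 0 \<and>
        (\<forall>t. (x has_real_derivative V (translate (x t) T)) (at t)) \<and>
        (\<forall>t. \<Psi> (T, t) = translate (x t) T))"

definition unidirectional_spe_flow ::
    "'a tiling set \<Rightarrow> ('a tiling \<times> real \<Rightarrow> 'a tiling) \<Rightarrow> bool" where
  "unidirectional_spe_flow \<Omega> \<Psi> \<longleftrightarrow> (\<exists>V. spe_flow \<Omega> V \<Psi> \<and> (\<forall>T\<in>\<Omega>. V T \<noteq> 0))"

definition semiconjugate ::
    "'b topology \<Rightarrow> ('b \<Rightarrow> 'b) \<Rightarrow> 'c topology \<Rightarrow> ('c \<Rightarrow> 'c) \<Rightarrow> bool" where
  "semiconjugate X F Y F' \<longleftrightarrow>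
     (\<exists>H. continuous_map X Y H \<and> (\<forall>x\<in>topspace X. F' (H x) = H (F x)))"

end

theory Submission
  imports Defs "HOL-Library.Diagonal_Subsequence"
begin

text \<open>
  Write $S(x) = \int_0^x \nu$ for a nonvanishing representative $\nu$ of the rotation class, and
  $f = f_T$. The flow with velocity $1/\nu$ moves $T - x$ to $T - S^{-1}(S(x) + t)$, so it suffices
  to find a continuous $h$ on the line with $h(f(x)) = h(x) + 1$ such that $h - S$ extends
  continuously to $\Omega$; the semi-conjugacy is then $T - x \mapsto T - S^{-1}(h(x))$.

  As for circle maps, fix the set $C$ of return points of a large patch and put
  $h(x) = \sup\,\{S(y) + m : y \in C,\ f^m(y) \le x\}$. The rotation property says that the points
  $f^m(y)$ are ordered on the line like the numbers $S(y) + m$. Minimality of $\Gamma_1$ on the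
  shape change, together with compactness, makes these numbers dense already for bounded $m$, with
  a bound that depends only on the scale. Hence $h$ is continuous, and $h - S$ is determined near a
  point, up to any given error, by a large patch around that point.
\<close>

section \<open>Patches of tilings of the line\<close>

text \<open>The rotation property compares only points with matching patches, which is why
  \<open>C\<close> consists of return points. It gives betweenness without orientation; the
  orientation comes from the displacement of \<open>f\<close>, which cannot vanish because x must
  lie strictly between f^(-1)(x) and f(x). If \<open>f\<close> moves points to the left, the
  construction is run with the inverse iterates and -S. The obstacle is locality. Whether f^m(y)
  \<le> x holds is read off from a patch whose radius grows with |m|, so density of the numbers S(y)
  + m with unrestricted m would say nothing about how h - S depends on patches. A bound on |m| at
  each scale, together with boundedness of h - S, confines the pairs (y, m) that matter near x to a
  window around x. That window may grow as the scale shrinks, so h - S is only shown to be pattern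
  equivariant up to arbitrarily small errors, and its extension to \<Omega> is made by a limit. On
  an interval free of points f^m(y) the function h is constant; this is why the method yields a
  semi-conjugacy and not a conjugacy.\<close>

lemma tile_cases:
  assumes "tiling T" "t \<in> T"
  obtains a b l where "t = ({a..b}, l)" "a < b"
  using assms unfolding tiling_def by (metis prod.collapse)

lemma tile_less:
  assumes "tiling T" "({a..b}, l) \<in> T"
  shows "a < b"
proof -
  obtain c d where "c < d" "{a..b} = {c..d}"
    using assms unfolding tiling_def by fastforce
  then show ?thesis unfolding Icc_eq_Icc by linarith
qed

lemma tiling_overlap:
  assumes T: "tiling T" "({a..b}, l) \<in> T" "({c..d}, l') \<in> T" and "a < d" "c < b"
  shows "a = c" "b = d" "l = l'"
proof -
  have ab: "a < b" "c < d"
    using tile_less[OF T(1,2)] tile_less[OF T(1,3)] by auto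
  have "({a..b}, l) = ({c..d}, l')"
  proof (rule ccontr)
    assume "({a..b}, l) \<noteq> ({c..d}, l')"
    then have "interior {a..b} \<inter> interior {c..d} = {}"
      using T unfolding tiling_def by (metis fst_conv)
    then have "{max a c<..<min b d} = {}"
      by simp
    then show False
      using ab assms(4,5) by auto
  qed
  then show "l = l'" "a = c" "b = d"
    using ab unfolding prod.inject Icc_eq_Icc by (simp, linarith+)
qed

lemma tiles_ordered:
  assumes T: "tiling T" "({a..b}, l) \<in> T" "({c..d}, l') \<in> T" and "a < c \<or> b < d"
  shows "b \<le> c"
proof (rule ccontr)
  assume "\<not> b \<le> c"
  moreover have "a < b" "c < d"
    using tile_less[OF T(1,2)] tile_less[OF T(1,3)] by auto
  ultimately have "a < d" "c < b"
    using assms(4) by auto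
  then have "a = c" "b = d"
    by (rule tiling_overlap[OF T])+
  with assms(4) show False by simp
qed

lemma tiling_cover:
  assumes "tiling T"
  obtains a b l where "({a..b}, l) \<in> T" "a \<le> x" "x \<le> b"
proof -
  have "x \<in> (\<Union>t\<in>T. fst t)"
    using assms by (simp add: tiling_def)
  then obtain t where t: "t \<in> T" "x \<in> fst t" by blast
  obtain a b l where "t = ({a..b}, l)"
    using tile_cases[OF assms t(1)] by blast
  with t that show ?thesis by auto
qed

text \<open>The definition of a tiling compares two tiles at a time. Choosing one tile for each
  label turns this into a length function with finitely many values, from which the uniform length
  bounds and finite local complexity follow.\<close>

lemma tile_lengths:
  assumes "tiling T"
  shows "\<exists>len. (\<forall>a b l. ({a..b}, l) \<in> T \<longrightarrow> b - a = len l) \<and> finite (len ` snd ` T)"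
proof (intro exI conjI allI impI)
  let ?len = "\<lambda>l. measure lborel (fst (SOME t. t \<in> T \<and> snd t = l))"
  show "b - a = ?len l" if "({a..b}, l) \<in> T" for a b l
  proof -
    define t where "t = (SOME t. t \<in> T \<and> snd t = l)"
    have "t \<in> T \<and> snd t = l"
      unfolding t_def by (rule someI[of _ "({a..b}, l)"]) (use that in simp)
    then have "measure lborel (fst t) = measure lborel (fst ({a..b}, l))"
      using assms that unfolding tiling_def by (metis snd_conv)
    then show ?thesis
      using tile_less[OF assms that] by (simp add: t_def)
  qed
  show "finite (?len ` snd ` T)"
    using assms by (simp add: tiling_def)
qed

lemma tile_length_bounds:
  assumes "tiling T"
  shows "\<exists>d D. 0 < d \<and> (\<forall>a b l. ({a..b}, l) \<in> T \<longrightarrow> d \<le> b - a \<and> b - a \<le> D)"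
proof -
  obtain len where len: "\<And>a b l. ({a..b}, l) \<in> T \<Longrightarrow> b - a = len l" and fin: "finite (len ` snd ` T)"
    using tile_lengths[OF assms] by blast
  have ne: "len ` snd ` T \<noteq> {}"
    using tiling_cover[OF assms, of 0] by fastforce
  have "0 < x" if "x \<in> len ` snd ` T" for x
  proof -
    have "x \<in> (\<lambda>t. len (snd t)) ` T"
      using that by (simp only: image_image)
    then obtain t where t: "x = len (snd t)" "t \<in> T" by (rule imageE)
    obtain a b l where "t = ({a..b}, l)" "a < b" using tile_cases[OF assms t(2)] by blast
    then show ?thesis using len[of a b l] t by simp
  qed
  then have "0 < Min (len ` snd ` T)"
    using fin ne by simp
  moreover have "Min (len ` snd ` T) \<le> b - a \<and> b - a \<le> Max (len ` snd ` T)" if "({a..b}, l) \<in> T" for a b l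
  proof -
    have "b - a \<in> len ` snd ` T"
      using len[OF that] that by force
    then show ?thesis using fin by simp
  qed
  ultimately show ?thesis by blast
qed

lemma translate_tile_iff:
  "({a..b}, l) \<in> translate s T \<longleftrightarrow> ({a + s..b + s}, l) \<in> T" for a b s :: real
  by (simp add: translate_iff)

lemma tiling_translate:
  assumes "tiling T"
  shows "tiling (translate s T)"
proof -
  have ex: "\<exists>a b l. t = ({a..b}, l) \<and> a < b \<and> ({a + s..b + s}, l) \<in> T" if "t \<in> translate s T" for t
  proof -
    obtain I l where t: "t = (I, l)" by (cases t)
    then have "((\<lambda>x. x + s) ` I, l) \<in> T"
      using that by (simp add: translate_iff)
    then obtain a b where ab: "a < b" "(\<lambda>x. x + s) ` I = {a..b}"
      using tile_cases[OF assms] by (metis Pair_inject)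
    have "I = (\<lambda>x. x - s) ` (\<lambda>x. x + s) ` I"
      by (simp add: image_image)
    also have "\<dots> = {a - s..b - s}"
      unfolding ab(2) by simp
    finally have "t = ({a - s..b - s}, l)" "({(a - s) + s..(b - s) + s}, l) \<in> T"
      using t ab \<open>((\<lambda>x. x + s) ` I, l) \<in> T\<close> by simp_all
    then show ?thesis
      using ab(1) by fastforce
  qed
  show ?thesis
    unfolding tiling_def
  proof (intro conjI ballI impI)
    show "\<exists>a b. a < b \<and> fst t = {a..b}" if "t \<in> translate s T" for t
      using ex[OF that] by auto
    have "snd ` translate s T \<subseteq> snd ` T"
      by (force simp: translate_def image_image)
    then show "finite (snd ` translate s T)"
      by (rule finite_subset) (use assms in \<open>simp add: tiling_def\<close>)
    show "measure lborel (fst t) = measure lborel (fst t')"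
      if t: "t \<in> translate s T" "t' \<in> translate s T" "snd t = snd t'" for t t'
    proof -
      obtain len where len: "\<And>a b l. ({a..b}, l) \<in> T \<Longrightarrow> b - a = len l" "finite (len ` snd ` T)"
        using tile_lengths[OF assms] by blast
      obtain a b l where 1: "t = ({a..b}, l)" "a < b" "({a + s..b + s}, l) \<in> T"
        using ex[OF t(1)] by blast
      obtain a' b' l' where 2: "t' = ({a'..b'}, l')" "a' < b'" "({a' + s..b' + s}, l') \<in> T"
        using ex[OF t(2)] by blast
      show ?thesis
        using len(1)[OF 1(3)] len(1)[OF 2(3)] 1 2 t(3) by simp
    qed
    show "interior (fst t) \<inter> interior (fst t') = {}"
      if t: "t \<in> translate s T" "t' \<in> translate s T" "t \<noteq> t'" for t t'
    proof -
      obtain a b l where 1: "t = ({a..b}, l)" "a < b" "({a + s..b + s}, l) \<in> T"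
        using ex[OF t(1)] by blast
      obtain a' b' l' where 2: "t' = ({a'..b'}, l')" "a' < b'" "({a' + s..b' + s}, l') \<in> T"
        using ex[OF t(2)] by blast
      have "\<not> (a < b' \<and> a' < b)"
      proof
        assume *: "a < b' \<and> a' < b"
        then have "a + s < b' + s" "a' + s < b + s" by simp_all
        then have "a + s = a' + s" "b + s = b' + s" "l = l'"
          by (rule tiling_overlap[OF assms 1(3) 2(3)])+
        then show False
          using 1 2 t(3) by simp
      qed
      then show ?thesis
        using 1 2 by auto
    qed
    show "(\<Union>t\<in>translate s T. fst t) = UNIV"
    proof (intro equalityI subsetI)
      fix x :: real
      obtain a b l where "({a..b}, l) \<in> T" "a \<le> x + s" "x + s \<le> b"
        using tiling_cover[OF assms, of "x + s"] by blast
      then have "({a - s..b - s}, l) \<in> translate s T" "x \<in> {a - s..b - s}"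
        by (auto simp: translate_tile_iff)
      then show "x \<in> (\<Union>t\<in>translate s T. fst t)" by force
    qed simp
  qed
qed

text \<open>The tile covering \<open>a - d / 2\<close>, with \<open>d\<close> a lower bound for tile
  lengths, must reach \<open>a\<close>. Otherwise a tile covering the midpoint of the remaining gap
  would be confined to that gap, whose length is at most \<open>d / 2\<close>.\<close>

lemma tile_left_neighbour:
  assumes T: "tiling T" and t: "({a..b}, l) \<in> T"
  obtains c k where "({c..a}, k) \<in> T"
proof -
  obtain d D where d: "0 < d" "\<And>a b l. ({a..b}, l) \<in> T \<Longrightarrow> d \<le> b - a \<and> b - a \<le> D"
    using tile_length_bounds[OF T] by blast
  obtain c e k where c: "({c..e}, k) \<in> T" "c \<le> a - d / 2" "a - d / 2 \<le> e"
    using tiling_cover[OF T] by blast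
  have "e \<le> a"
    using tiles_ordered[OF T c(1) t] c d(1) by simp
  moreover have "\<not> e < a"
  proof
    assume "e < a"
    obtain c' e' k' where c': "({c'..e'}, k') \<in> T" "c' \<le> (e + a) / 2" "(e + a) / 2 \<le> e'"
      using tiling_cover[OF T] by blast
    have "e' \<le> a"
      using tiles_ordered[OF T c'(1) t] c' \<open>e < a\<close> by simp
    moreover have "e \<le> c'"
      using tiles_ordered[OF T c(1) c'(1)] c' \<open>e < a\<close> by simp
    ultimately show False
      using d(2)[OF c'(1)] c d(1) \<open>e < a\<close> by linarith
  qed
  ultimately have "e = a" by simp
  then show ?thesis using that[of c k] c(1) by simp
qed

lemma tile_right_neighbour:
  assumes T: "tiling T" and t: "({a..b}, l) \<in> T"
  obtains c k where "({b..c}, k) \<in> T"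
proof -
  obtain d D where d: "0 < d" "\<And>a b l. ({a..b}, l) \<in> T \<Longrightarrow> d \<le> b - a \<and> b - a \<le> D"
    using tile_length_bounds[OF T] by blast
  obtain c e k where c: "({c..e}, k) \<in> T" "c \<le> b + d / 2" "b + d / 2 \<le> e"
    using tiling_cover[OF T] by blast
  have "b \<le> c"
    using tiles_ordered[OF T t c(1)] c d(1) by simp
  moreover have "\<not> b < c"
  proof
    assume "b < c"
    obtain c' e' k' where c': "({c'..e'}, k') \<in> T" "c' \<le> (c + b) / 2" "(c + b) / 2 \<le> e'"
      using tiling_cover[OF T] by blast
    have "b \<le> c'"
      using tiles_ordered[OF T t c'(1)] c' \<open>b < c\<close> by simp
    moreover have "e' \<le> c"
      using tiles_ordered[OF T c'(1) c(1)] c' \<open>b < c\<close> by simp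
    ultimately show False
      using d(2)[OF c'(1)] c d(1) \<open>b < c\<close> by linarith
  qed
  ultimately have "c = b" by simp
  then show ?thesis using that[of e k] c(1) by simp
qed

section \<open>Patches and exact agreement\<close>

definition patch :: "real \<Rightarrow> 'a tiling \<Rightarrow> 'a tiling" where
  "patch R T = {t \<in> T. fst t \<inter> {-R..R} \<noteq> {}}"

lemma agree_patch: "agree R T T' \<longleftrightarrow> patch R T = patch R T'"
  by (simp add: agree_def patch_def)

lemma agree_refl [simp]: "agree R T T"
  by (simp add: agree_def)

lemma agree_sym: "agree R T T' \<Longrightarrow> agree R T' T"
  by (simp add: agree_def)

lemma agree_trans: "agree R T T' \<Longrightarrow> agree R T' T'' \<Longrightarrow> agree R T T''"
  by (simp add: agree_def)

lemma agree_mono: "agree R T T' \<Longrightarrow> R' \<le> R \<Longrightarrow> agree R' T T'"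
  using agree_translate[of R T T' R' 0] by simp

lemma mem_patch_iff:
  "({a..b}, l) \<in> patch R T \<longleftrightarrow> ({a..b}, l) \<in> T \<and> (\<exists>x. a \<le> x \<and> x \<le> b \<and> \<bar>x\<bar> \<le> R)"
proof -
  have "{a..b} \<inter> {-R..R} = {x. a \<le> x \<and> x \<le> b \<and> \<bar>x\<bar> \<le> R}"
    by auto
  then show ?thesis
    by (simp add: patch_def) auto
qed

lemma agree_tileD:
  assumes "agree R T T'" "({a..b}, l) \<in> T" "a \<le> x" "x \<le> b" "\<bar>x\<bar> \<le> R"
  shows "({a..b}, l) \<in> T'"
proof -
  have "({a..b}, l) \<in> patch R T"
    unfolding mem_patch_iff using assms(2-5) by blast
  then have "({a..b}, l) \<in> patch R T'"
    using assms(1) by (simp only: agree_patch)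
  then show ?thesis
    by (simp only: mem_patch_iff)
qed

text \<open>One inclusion is enough because the tiles of \<open>A\<close> that meet [-R,R] already
  cover it, so a tile of \<open>B\<close> meeting [-R,R] has to overlap one of them. If the two
  tiles only touch at the point \<open>x\<close>, the neighbouring tile of \<open>A\<close> on the
  other side of \<open>x\<close> also contains \<open>x\<close> and does overlap.\<close>

lemma agree_if_patch_subset:
  assumes A: "tiling A" and B: "tiling B" and sub: "patch R A \<subseteq> B"
  shows "agree R A B"
proof -
  have *: "({a..b}, l) \<in> A" if t: "({a..b}, l) \<in> B" and x: "a \<le> x" "x \<le> b" "\<bar>x\<bar> \<le> R" for a b l x
  proof -
    have mem: "({c..e}, k) \<in> B" if "({c..e}, k) \<in> A" "c \<le> x" "x \<le> e" for c e k
    proof -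
      have "({c..e}, k) \<in> patch R A"
        unfolding mem_patch_iff using that x(3) by blast
      with sub show ?thesis by blast
    qed
    have done_if: ?thesis if "({c..e}, k) \<in> A" "c \<le> x" "x \<le> e" "a < e" "c < b" for c e k
    proof -
      have "a = c" "b = e" "l = k"
        by (rule tiling_overlap[OF B t mem[OF that(1-3)] that(4,5)])+
      with that(1) show ?thesis by simp
    qed
    obtain c e k where c: "({c..e}, k) \<in> A" "c \<le> x" "x \<le> e"
      using tiling_cover[OF A] by blast
    have "a < b" "c < e"
      using tile_less[OF B t] tile_less[OF A c(1)] by auto
    consider "a < e" "c < b" | "a = e" | "c = b"
      using x c by linarith
    then show ?thesis
    proof cases
      case 1
      with done_if c show ?thesis by blast
    next
      case 2
      obtain e' k' where e': "({e..e'}, k') \<in> A"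
        using tile_right_neighbour[OF A c(1)] by blast
      then have "e < e'"
        by (rule tile_less[OF A])
      then show ?thesis
        using done_if[OF e'] 2 x c \<open>a < b\<close> by simp
    next
      case 3
      obtain c' k' where c': "({c'..c}, k') \<in> A"
        using tile_left_neighbour[OF A c(1)] by blast
      then have "c' < c"
        by (rule tile_less[OF A])
      then show ?thesis
        using done_if[OF c'] 3 x c \<open>a < b\<close> by simp
    qed
  qed
  have "patch R B \<subseteq> A"
  proof
    fix t assume t: "t \<in> patch R B"
    then have "t \<in> B" by (simp add: patch_def)
    then obtain a b l where tt: "t = ({a..b}, l)"
      using tile_cases[OF B] by metis
    with t obtain x where "({a..b}, l) \<in> B" "a \<le> x" "x \<le> b" "\<bar>x\<bar> \<le> R"
      by (auto simp only: mem_patch_iff)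
    then show "t \<in> A"
      unfolding tt by (rule *)
  qed
  with sub show ?thesis
    unfolding agree_patch by (auto simp: patch_def)
qed

lemma tiling_eqI:
  assumes "tiling A" "tiling B" "\<And>R. R > 0 \<Longrightarrow> agree R A B"
  shows "A = B"
proof -
  have "t \<in> Y" if X: "tiling X" and XY: "\<And>R. R > 0 \<Longrightarrow> agree R X Y" and t: "t \<in> X" for X Y :: "'a tiling" and t
  proof -
    obtain a b l where "t = ({a..b}, l)" "a < b"
      using tile_cases[OF X t] by blast
    then show ?thesis
      using agree_tileD[OF XY[of "\<bar>a\<bar> + 1"], of a b l a] t by simp
  qed
  from this[OF assms(1,3)] this[OF assms(2) agree_sym[OF assms(3)]] show ?thesis
    by blast
qed

section \<open>Finite local complexity and compactness\<close>

text \<open>With a vertex at the origin, every other vertex is reached by adding or subtracting tile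
  lengths, which come from a finite set. Each step covers at least the minimal length
  \<open>d\<close>, so an induction on the number of steps exhausts any bounded range.\<close>

lemma finite_vertices:
  assumes T: "tiling T"
  shows "\<exists>E. finite E \<and> (\<forall>v b0 l0 a b l. ({0..b0}, l0) \<in> translate v T \<longrightarrow> ({a..b}, l) \<in> translate v T
    \<longrightarrow> \<bar>a\<bar> \<le> K \<longrightarrow> a \<in> E)"
proof -
  obtain len where len: "\<And>a b l. ({a..b}, l) \<in> T \<Longrightarrow> b - a = len l" and fin: "finite (len ` snd ` T)"
    using tile_lengths[OF T] by blast
  obtain d D where d: "0 < d" "\<And>a b l. ({a..b}, l) \<in> T \<Longrightarrow> d \<le> b - a \<and> b - a \<le> D"
    using tile_length_bounds[OF T] by blast
  let ?L = "len ` snd ` T"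
  have len': "b - a \<in> ?L" "d \<le> b - a" if "({a..b}, l) \<in> translate v T" for a b l v
  proof -
    have t: "({a + v..b + v}, l) \<in> T"
      using that by (simp add: translate_tile_iff)
    have "b - a = len l" using len[OF t] by simp
    moreover have "l \<in> snd ` T" using t by force
    ultimately show "b - a \<in> ?L" by simp
    show "d \<le> b - a" using d(2)[OF t] by simp
  qed
  have "\<exists>E. finite E \<and> (\<forall>v b0 l0 a b l. ({0..b0}, l0) \<in> translate v T \<longrightarrow> ({a..b}, l) \<in> translate v T
      \<longrightarrow> \<bar>a\<bar> < real n * d \<longrightarrow> a \<in> E)" for n
  proof (induction n)
    case 0
    then show ?case by (intro exI[of _ "{}"]) auto
  next
    case (Suc n)
    then obtain E where E: "finite E" "\<And>v b0 l0 a b l. ({0..b0}, l0) \<in> translate v T \<Longrightarrow>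
        ({a..b}, l) \<in> translate v T \<Longrightarrow> \<bar>a\<bar> < real n * d \<Longrightarrow> a \<in> E"
      by blast
    \<comment> \<open>One more tile length on either side of the vertices found so far.\<close>
    define E' where "E' = {0} \<union> (\<lambda>(e, x). e + x) ` ((E \<union> {0}) \<times> ?L) \<union> (\<lambda>(e, x). e - x) ` ((E \<union> {0}) \<times> ?L)"
    have "a \<in> E'" if t0: "({0..b0}, l0) \<in> translate v T" and t: "({a..b}, l) \<in> translate v T"
      and a: "\<bar>a\<bar> < real (Suc n) * d" for v b0 l0 a b l
    proof -
      have vT: "tiling (translate v T)" by (rule tiling_translate[OF T])
      have b0: "0 < b0" using tile_less[OF vT t0] .
      consider "a = 0" | "a > 0" | "a < 0" by linarith
      then show ?thesis
      proof cases
        case 1 then show ?thesis by (simp add: E'_def)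
      next
        case 2
        obtain c k where c: "({c..a}, k) \<in> translate v T"
          using tile_left_neighbour[OF vT t] by blast
        have "c \<ge> 0"
          by (rule ccontr) (use tiles_ordered[OF vT c t0] 2 in simp)
        have ca: "a - c \<in> ?L" "d \<le> a - c" using len'[OF c] by auto
        have "\<bar>c\<bar> < real n * d"
          using a \<open>c \<ge> 0\<close> 2 ca(2) by (simp add: algebra_simps)
        then have "c \<in> E" using E(2)[OF t0 c] by simp
        then have "(\<lambda>(e, x). e + x) (c, a - c) \<in> (\<lambda>(e, x). e + x) ` ((E \<union> {0}) \<times> ?L)"
          using ca by (intro imageI) simp
        then show ?thesis unfolding E'_def by simp
      next
        case 3
        \<comment> \<open>To the left of the origin the step leads over the tile itself to its right
          end \<open>b\<close>; the right neighbour shows that \<open>b\<close> is again a left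
          endpoint, so the induction hypothesis applies to it.\<close>
        obtain c k where c: "({b..c}, k) \<in> translate v T"
          using tile_right_neighbour[OF vT t] by blast
        have "b \<le> 0"
          using tiles_ordered[OF vT t t0] 3 by simp
        have ca: "b - a \<in> ?L" "d \<le> b - a" using len'[OF t] by auto
        have "\<bar>b\<bar> < real n * d"
          using a \<open>b \<le> 0\<close> 3 ca(2) by (simp add: algebra_simps)
        then have "b \<in> E" using E(2)[OF t0 c] by simp
        then have "(\<lambda>(e, x). e - x) (b, b - a) \<in> (\<lambda>(e, x). e - x) ` ((E \<union> {0}) \<times> ?L)"
          using ca by (intro imageI) simp
        then show ?thesis unfolding E'_def by simp
      qed
    qed
    moreover have "finite E'" unfolding E'_def using E(1) fin by simp
    ultimately show ?case by blast
  qed note ind = this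
  obtain n where n: "K < real n * d"
    using reals_Archimedean3[OF d(1)] by blast
  obtain E where "finite E" "\<And>v b0 l0 a b l. ({0..b0}, l0) \<in> translate v T \<Longrightarrow>
        ({a..b}, l) \<in> translate v T \<Longrightarrow> \<bar>a\<bar> < real n * d \<Longrightarrow> a \<in> E"
    using ind[of n] by blast
  note E = this
  show ?thesis
  proof (intro exI conjI allI impI)
    show "finite E" by fact
    fix v b0 l0 a b l
    assume "({0..b0}, l0) \<in> translate v T" "({a..b}, l) \<in> translate v T" "\<bar>a\<bar> \<le> K"
    then show "a \<in> E"
      using E(2)[of b0 l0 v a b l] n by linarith
  qed
qed

text \<open>Left endpoints are enough: every tile has neighbours on both sides, so right endpoints
  are left endpoints as well.\<close>

definition vertex :: "'a tiling \<Rightarrow> real \<Rightarrow> bool" where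
  "vertex T v \<longleftrightarrow> (\<exists>b l. ({v..b}, l) \<in> T)"

text \<open>A tile is determined by its left endpoint and its label. A tile meeting [-K,K] starts
  within \<open>\<bar>K\<bar> + D\<close> of the origin, where \<open>D\<close> bounds the tile
  lengths, so only finitely many left endpoints relative to the vertex occur.\<close>

lemma finite_local_complexity:
  assumes T: "tiling T"
  shows "finite (\<Union>v\<in>{v. vertex T v}. patch K (translate v T))"
    and "finite ((\<lambda>v. patch K (translate v T)) ` {v. vertex T v})"
proof -
  obtain len where len: "\<And>a b l. ({a..b}, l) \<in> T \<Longrightarrow> b - a = len l" "finite (len ` snd ` T)"
    using tile_lengths[OF T] by blast
  obtain d D where d: "0 < d" "\<And>a b l. ({a..b}, l) \<in> T \<Longrightarrow> d \<le> b - a \<and> b - a \<le> D"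
    using tile_length_bounds[OF T] by blast
  obtain E where E: "finite E"
    "\<And>v b0 l0 a b l. ({0..b0}, l0) \<in> translate v T \<Longrightarrow> ({a..b}, l) \<in> translate v T \<Longrightarrow> \<bar>a\<bar> \<le> \<bar>K\<bar> + D \<Longrightarrow> a \<in> E"
    using finite_vertices[OF T, of "\<bar>K\<bar> + D"] by blast
  have "patch K (translate v T) \<subseteq> (\<lambda>(a, l). ({a..a + len l}, l)) ` (E \<times> snd ` T)" if v: "vertex T v" for v
  proof
    fix t assume t: "t \<in> patch K (translate v T)"
    then have "t \<in> translate v T" by (simp add: patch_def)
    then obtain a b l where tt: "t = ({a..b}, l)" "a < b"
      using tile_cases[OF tiling_translate[OF T]] by metis
    with t obtain x where x: "a \<le> x" "x \<le> b" "\<bar>x\<bar> \<le> K" "({a..b}, l) \<in> translate v T"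
      by (auto simp only: mem_patch_iff)
    then have ab: "({a + v..b + v}, l) \<in> T"
      by (simp add: translate_tile_iff)
    have "\<bar>a\<bar> \<le> \<bar>K\<bar> + D"
      using x d(2)[OF ab] d(1) by linarith
    moreover obtain b0 l0 where "({0..b0}, l0) \<in> translate v T"
    proof -
      obtain b l where "({v..b}, l) \<in> T"
        using v unfolding vertex_def by blast
      then have "({0..b - v}, l) \<in> translate v T"
        by (simp add: translate_tile_iff)
      then show ?thesis by (rule that)
    qed
    ultimately have "a \<in> E" using E(2) x(4) by blast
    moreover have "l \<in> snd ` T" using ab by force
    moreover have "b = a + len l" using len(1)[OF ab] by simp
    ultimately show "t \<in> (\<lambda>(a, l). ({a..a + len l}, l)) ` (E \<times> snd ` T)"
      using tt by force
  qed
  then have *: "(\<Union>v\<in>{v. vertex T v}. patch K (translate v T)) \<subseteq> (\<lambda>(a, l). ({a..a + len l}, l)) ` (E \<times> snd ` T)"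
    by blast
  have labels: "finite (snd ` T)" using T by (simp add: tiling_def)
  show fin: "finite (\<Union>v\<in>{v. vertex T v}. patch K (translate v T))"
    by (rule finite_subset[OF * finite_imageI[OF finite_cartesian_product[OF E(1) labels]]])
  have "(\<lambda>v. patch K (translate v T)) ` {v. vertex T v} \<subseteq> Pow (\<Union>v\<in>{v. vertex T v}. patch K (translate v T))"
    by blast
  then show "finite ((\<lambda>v. patch K (translate v T)) ` {v. vertex T v})"
    by (rule finite_subset) (simp add: fin)
qed

lemma vertex_below:
  assumes T: "tiling T"
  shows "\<exists>D>0. \<forall>x. \<exists>v. vertex T v \<and> v \<le> x \<and> x \<le> v + D"
proof -
  obtain d D where d: "0 < d" "\<And>a b l. ({a..b}, l) \<in> T \<Longrightarrow> d \<le> b - a \<and> b - a \<le> D"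
    using tile_length_bounds[OF T] by blast
  have "\<exists>v. vertex T v \<and> v \<le> x \<and> x \<le> v + D" for x
  proof -
    obtain a b l where "({a..b}, l) \<in> T" "a \<le> x" "x \<le> b"
      using tiling_cover[OF T] by blast
    then show ?thesis using d(2)[of a b l] unfolding vertex_def by (intro exI[of _ a]) auto
  qed
  moreover have "0 < D"
  proof -
    obtain a b l where "({a..b}, l) \<in> T"
      using tiling_cover[OF T] by blast
    then show ?thesis using d(1) d(2)[of a b l] by linarith
  qed
  ultimately show ?thesis by (intro exI[of _ D]) simp
qed

text \<open>Each clause of \<open>tiling\<close> speaks of at most two tiles or of one point, except
  for finiteness of the alphabet, which is inherited from \<open>T\<close>. Two tiles with nonempty
  supports are both visible at some radius, hence lie together in one translate of
  \<open>T\<close>.\<close>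

lemma tiling_if_locally_translate:
  assumes T: "tiling T" and loc: "\<And>R. \<exists>v. agree R A (translate v T)" and ne: "\<And>t. t \<in> A \<Longrightarrow> fst t \<noteq> {}"
  shows "tiling A"
proof -
  have pair: "\<exists>X. tiling X \<and> t \<in> X \<and> t' \<in> X \<and> snd ` X \<subseteq> snd ` T" if t: "t \<in> A" "t' \<in> A" for t t'
  proof -
    obtain x x' where x: "x \<in> fst t" "x' \<in> fst t'"
      using ne[OF t(1)] ne[OF t(2)] by blast
    obtain v where v: "agree (max \<bar>x\<bar> \<bar>x'\<bar>) A (translate v T)"
      using loc by blast
    have "x \<in> {-max \<bar>x\<bar> \<bar>x'\<bar>..max \<bar>x\<bar> \<bar>x'\<bar>}" "x' \<in> {-max \<bar>x\<bar> \<bar>x'\<bar>..max \<bar>x\<bar> \<bar>x'\<bar>}"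
      by auto
    then have "t \<in> patch (max \<bar>x\<bar> \<bar>x'\<bar>) A" "t' \<in> patch (max \<bar>x\<bar> \<bar>x'\<bar>) A"
      using x t unfolding patch_def by blast+
    then have "t \<in> patch (max \<bar>x\<bar> \<bar>x'\<bar>) (translate v T)" "t' \<in> patch (max \<bar>x\<bar> \<bar>x'\<bar>) (translate v T)"
      using v unfolding agree_patch by simp_all
    then have "t \<in> translate v T" "t' \<in> translate v T"
      by (simp_all add: patch_def)
    moreover have "snd ` translate v T \<subseteq> snd ` T"
      by (force simp: translate_def image_image)
    ultimately show ?thesis
      using tiling_translate[OF T] by blast
  qed
  show ?thesis
    unfolding tiling_def
  proof (intro conjI ballI impI)
    fix t assume t: "t \<in> A"
    obtain X where "tiling X" "t \<in> X"
      using pair[OF t t] by blast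
    then show "\<exists>a b. a < b \<and> fst t = {a..b}"
      by (simp add: tiling_def)
  next
    have "snd ` A \<subseteq> snd ` T"
      using pair by blast
    then show "finite (snd ` A)"
      by (rule finite_subset) (use T in \<open>simp add: tiling_def\<close>)
  next
    fix t t' assume t: "t \<in> A" "t' \<in> A" "snd t = snd t'"
    obtain X where "tiling X" "t \<in> X" "t' \<in> X"
      using pair[OF t(1,2)] by blast
    with t(3) show "measure lborel (fst t) = measure lborel (fst t')"
      unfolding tiling_def by metis
  next
    fix t t' assume t: "t \<in> A" "t' \<in> A" "t \<noteq> t'"
    obtain X where "tiling X" "t \<in> X" "t' \<in> X"
      using pair[OF t(1,2)] by blast
    with t(3) show "interior (fst t) \<inter> interior (fst t') = {}"
      unfolding tiling_def by metis
  next
    show "(\<Union>t\<in>A. fst t) = UNIV"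
    proof (intro equalityI subsetI)
      fix x :: real
      obtain v where v: "agree \<bar>x\<bar> A (translate v T)"
        using loc by blast
      obtain a b l where t: "({a..b}, l) \<in> translate v T" "a \<le> x" "x \<le> b"
        using tiling_cover[OF tiling_translate[OF T]] by metis
      have "({a..b}, l) \<in> A"
        using agree_tileD[OF agree_sym[OF v] t] by simp
      then show "x \<in> (\<Union>t\<in>A. fst t)"
        using t by force
    qed simp
  qed
qed

text \<open>At vertices there are only finitely many patches of a given radius, so the pigeonhole
  principle makes a patch constant along a subsequence, and a diagonal argument does so for all
  radii. Agreement with the limit is exact, with no small shift.\<close>

lemma translates_at_vertices_convergent:
  fixes w :: "nat \<Rightarrow> real"
  assumes T: "tiling T" and w: "\<And>n. vertex T (w n)"
  shows "\<exists>r A. strict_mono r \<and> tiling A \<and> (\<forall>k n. k < n \<longrightarrow> agree (real k) A (translate (w (r n)) T))"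
proof -
  let ?P = "\<lambda>k s. \<forall>i j. patch (real k) (translate (w (s i)) T) = patch (real k) (translate (w (s j)) T)"
  interpret subseqs ?P
  proof
    fix k and s :: "nat \<Rightarrow> nat"
    let ?f = "\<lambda>i. patch (real k) (translate (w (s i)) T)"
    have "range ?f \<subseteq> (\<lambda>v. patch (real k) (translate v T)) ` {v. vertex T v}"
      using w by blast
    then have "finite (range ?f)"
      by (rule finite_subset) (rule finite_local_complexity(2)[OF T])
    then obtain i0 where "infinite {i \<in> UNIV. ?f i = ?f i0}"
      using pigeonhole_infinite[of "UNIV :: nat set" ?f] infinite_UNIV_nat by blast
    then obtain r :: "nat \<Rightarrow> nat" where r: "strict_mono r" "\<forall>n. r n \<in> {i \<in> UNIV. ?f i = ?f i0}"
      using infinite_enumerate by blast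
    have "?P k (s \<circ> r)"
      using r(2) by simp
    with r(1) show "\<exists>r' :: nat \<Rightarrow> nat. strict_mono r' \<and> ?P k (s \<circ> r')"
      by blast
  qed
  define w' where "w' n = w (diagseq n)" for n
  have diag: "?P k (diagseq \<circ> (+) (Suc k))" for k
    by (rule diagseq_holds) simp
  then have eq: "patch (real k) (translate (w' n) T) = patch (real k) (translate (w' m) T)"
    if "k < n" "k < m" for k n m
  proof -
    have "n = Suc k + (n - Suc k)" "m = Suc k + (m - Suc k)"
      using that by simp_all
    moreover have "patch (real k) (translate (w' (Suc k + i)) T) = patch (real k) (translate (w' (Suc k + j)) T)" for i j
      using diag[of k] by (simp add: w'_def)
    ultimately show ?thesis
      by metis
  qed
  \<comment> \<open>The patch of radius \<open>k\<close> is constant from index \<open>Suc k\<close>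
    on, so it is read off there.\<close>
  define A where "A = (\<Union>k. patch (real k) (translate (w' (Suc k)) T))"
  have agr: "agree (real k) A (translate (w' n) T)" if "k < n" for k n
    unfolding agree_patch
  proof (intro equalityI subsetI)
    fix t assume t: "t \<in> patch (real k) A"
    then obtain j where j: "t \<in> patch (real j) (translate (w' (Suc j)) T)" "fst t \<inter> {- real k..real k} \<noteq> {}"
      unfolding A_def patch_def by blast
    then have "t \<in> patch (real j) (translate (w' (Suc (max j k))) T)"
      using eq[of j "Suc j" "Suc (max j k)"] by simp
    then have "t \<in> patch (real k) (translate (w' (Suc (max j k))) T)"
      using j(2) unfolding patch_def by simp
    then show "t \<in> patch (real k) (translate (w' n) T)"
      using eq[of k n "Suc (max j k)"] that by simp
  next
    fix t assume t: "t \<in> patch (real k) (translate (w' n) T)"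
    then have "t \<in> patch (real k) (translate (w' (Suc k)) T)"
      using eq[of k n "Suc k"] that by simp
    then have "t \<in> A"
      unfolding A_def by blast
    then show "t \<in> patch (real k) A"
      using t by (simp add: patch_def)
  qed
  have "tiling A"
  proof (rule tiling_if_locally_translate[OF T])
    fix R :: real
    obtain k where "R \<le> real k"
      using real_arch_simple by blast
    then show "\<exists>v. agree R A (translate v T)"
      using agree_mono[OF agr[of k "Suc k"]] by blast
  next
    fix t assume "t \<in> A"
    then show "fst t \<noteq> {}"
      by (auto simp: A_def patch_def)
  qed
  then show ?thesis
    using subseq_diagseq agr unfolding w'_def by (intro exI[of _ diagseq] exI[of _ A]) blast
qed

text \<open>An arbitrary position is a vertex plus an offset in the compact interval [0,D]. The
  vertices are handled exactly and the offsets converge along a further subsequence; only the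
  offsets make a correction \<open>u n\<close> necessary.\<close>

lemma translates_convergent:
  fixes t :: "nat \<Rightarrow> real"
  assumes T: "tiling T"
  shows "\<exists>r u A. strict_mono r \<and> u \<longlonglongrightarrow> 0 \<and> tiling A \<and>
    (\<forall>K. \<forall>\<^sub>F n in sequentially. agree K A (translate (t (r n) + u n) T))"
proof -
  obtain D where D: "\<forall>x. \<exists>v. vertex T v \<and> v \<le> x \<and> x \<le> v + D"
    using vertex_below[OF T] by blast
  then have "\<forall>n. \<exists>v. vertex T v \<and> v \<le> t n \<and> t n \<le> v + D"
    by blast
  then obtain w where "\<forall>n. vertex T (w n) \<and> w n \<le> t n \<and> t n \<le> w n + D"
    using choice[of "\<lambda>n v. vertex T v \<and> v \<le> t n \<and> t n \<le> v + D"] by blast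
  then have w: "vertex T (w n)" "w n \<le> t n" "t n \<le> w n + D" for n
    by blast+
  obtain r A where r: "strict_mono r" "tiling A" "\<And>k n. k < n \<Longrightarrow> agree (real k) A (translate (w (r n)) T)"
    using translates_at_vertices_convergent[of T w, OF T w(1)] by blast
  have "t (r n) - w (r n) \<in> {0..D}" for n
    using w[of "r n"] by (simp add: algebra_simps)
  moreover have "seq_compact {0..D}"
    using compact_imp_seq_compact compact_Icc by blast
  ultimately obtain c q where q: "strict_mono q" "((\<lambda>n. t (r n) - w (r n)) \<circ> q) \<longlonglongrightarrow> c"
    by (metis (no_types, lifting) seq_compactE)
  \<comment> \<open>With this choice the corrected position is exactly the vertex plus the limit
    offset \<open>c\<close>.\<close>
  define u where "u n = c - (t (r (q n)) - w (r (q n)))" for n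
  have "u \<longlonglongrightarrow> c - c"
    unfolding u_def using q(2) by (intro tendsto_intros) (simp add: o_def)
  then have u: "u \<longlonglongrightarrow> 0" by simp
  have "\<forall>\<^sub>F n in sequentially. agree K (translate c A) (translate (t ((r \<circ> q) n) + u n) T)" for K
  proof -
    obtain k where k: "K + \<bar>c\<bar> \<le> real k"
      using real_arch_simple by blast
    have "agree K (translate c A) (translate (t ((r \<circ> q) n) + u n) T)" if "k < n" for n
    proof -
      have "k < q n"
        using seq_suble[OF q(1), of n] that by simp
      then have "agree K (translate c A) (translate c (translate (w (r (q n))) T))"
        using agree_translate[OF r(3) k] by blast
      then show ?thesis
        by (simp add: translate_translate u_def)
    qed
    then show ?thesis
      using eventually_gt_at_top[of k] by (rule eventually_mono[rotated])
  qed
  then show ?thesis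
    using strict_mono_o[OF r(1) q(1)] u tiling_translate[OF r(2)] by blast
qed

section \<open>The topology of tiling spaces\<close>

interpretation Til: Metric_space "{T. tiling T}" tiling_dist
  by (rule Metric_space_tilings)

text \<open>With \<open>dist_less_if_agree\<close> this replaces the metric by exact agreement after
  a small shift of one tiling. The metric shifts both tilings; moving the first one back merges the
  two shifts, and the 1 in \<open>K + 1\<close> pays for the loss of radius.\<close>

lemma agree_if_dist_less:
  assumes "0 < \<delta>" "0 \<le> K"
  obtains r where "0 < r" "\<And>A B. tiling_dist A B < r \<Longrightarrow> \<exists>s. \<bar>s\<bar> < \<delta> \<and> agree K A (translate s B)"
proof
  define r where "r = min \<delta> (1 / (K + 1))"
  show "0 < r"
    using assms by (simp add: r_def)
  fix A B :: "'a tiling" assume "tiling_dist A B < r"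
  moreover have "r \<le> 1"
    using assms by (simp add: r_def min_le_iff_disj)
  ultimately obtain e where e: "e \<in> close_scales A B" "e < r"
    by (rule tiling_dist_lessD)
  then obtain s1 s2 where s: "\<bar>s1\<bar> \<le> e / 2" "\<bar>s2\<bar> \<le> e / 2" "0 < e" "e < 1"
      "agree (1 / e) (translate s1 A) (translate s2 B)"
    by (auto simp: close_scales_def)
  have "e \<le> 1 / (K + 1)"
    using e(2) by (simp add: r_def)
  then have "K + 1 \<le> 1 / e"
    using s(3) assms(2) by (simp add: field_simps)
  then have "K + \<bar>- s1\<bar> \<le> 1 / e"
    using s by simp
  then have "agree K (translate (- s1) (translate s1 A)) (translate (- s1) (translate s2 B))"
    using agree_translate[OF s(5)] by blast
  then have "agree K A (translate (s2 - s1) B)"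
    by (simp add: translate_translate)
  moreover have "\<bar>s2 - s1\<bar> < \<delta>"
    using s e(2) unfolding r_def by linarith
  ultimately show "\<exists>s. \<bar>s\<bar> < \<delta> \<and> agree K A (translate s B)"
    by blast
qed

lemma dist_less_if_agree:
  assumes "0 < r"
  obtains K \<delta> where "0 < K" "0 < \<delta>"
    "\<And>A B s. \<bar>s\<bar> < \<delta> \<Longrightarrow> agree K A (translate s B) \<Longrightarrow> tiling_dist A B < r"
proof
  define e where "e = min (r / 2) (1 / 2)"
  have e: "0 < e" "e < 1" "e < r"
    using assms by (auto simp: e_def)
  show "0 < 1 / e" "0 < e / 2"
    using e by auto
  fix A B :: "'a tiling" and s assume s: "\<bar>s\<bar> < e / 2" "agree (1 / e) A (translate s B)"
  have "e \<in> close_scales A B"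
    unfolding close_scales_def using e s
    by (intro CollectI conjI exI[of _ 0] exI[of _ s]) auto
  then show "tiling_dist A B < r"
    using tiling_dist_le[of e A B] e by linarith
qed

lemma topspace_tiling_topology [simp]: "topspace tiling_topology = {T. tiling T}"
  by (simp add: tiling_topology_def)

lemma Hausdorff_tiling_topology: "Hausdorff_space tiling_topology"
  unfolding tiling_topology_def by (rule Til.Hausdorff_space_mtopology)

text \<open>No small shift appears on the right because \<open>s\<close> is arbitrary and absorbs
  it.\<close>

lemma orbit_closure_iff:
  assumes T: "tiling T"
  shows "A \<in> orbit_closure T \<longleftrightarrow> tiling A \<and> (\<forall>K. \<exists>s. agree K A (translate s T))"
proof
  assume "A \<in> orbit_closure T"
  then have A: "tiling A" "\<And>r. r > 0 \<Longrightarrow> \<exists>s. tiling_dist A (translate s T) < r"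
    unfolding orbit_closure_def tiling_topology_def Til.metric_closure_of by auto
  have "\<exists>s. agree K A (translate s T)" for K
  proof -
    obtain r where r: "0 < r" "\<And>A B :: 'a tiling. tiling_dist A B < r \<Longrightarrow> \<exists>s. \<bar>s\<bar> < 1 \<and> agree \<bar>K\<bar> A (translate s B)"
      using agree_if_dist_less[of 1 "\<bar>K\<bar>"] by auto
    obtain s where "tiling_dist A (translate s T) < r"
      using A(2)[OF r(1)] by blast
    then obtain s' where "agree \<bar>K\<bar> A (translate s' (translate s T))"
      using r(2) by blast
    then have "agree K A (translate (s' + s) T)"
      using agree_mono[of "\<bar>K\<bar>" A _ K] by (simp add: translate_translate)
    then show ?thesis by blast
  qed
  with A(1) show "tiling A \<and> (\<forall>K. \<exists>s. agree K A (translate s T))"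
    by blast
next
  assume A: "tiling A \<and> (\<forall>K. \<exists>s. agree K A (translate s T))"
  have "\<exists>s. tiling_dist A (translate s T) < r" if "0 < r" for r
  proof -
    obtain K \<delta> where K: "0 < \<delta>"
      "\<And>A B :: 'a tiling. \<And>s. \<bar>s\<bar> < \<delta> \<Longrightarrow> agree K A (translate s B) \<Longrightarrow> tiling_dist A B < r"
      using dist_less_if_agree[OF \<open>0 < r\<close>] by metis
    obtain s where "agree K A (translate s T)"
      using A by blast
    then have "tiling_dist A (translate s T) < r"
      using K(1) K(2)[of 0 A "translate s T"] by simp
    then show ?thesis by blast
  qed
  then show "A \<in> orbit_closure T"
    unfolding orbit_closure_def tiling_topology_def Til.metric_closure_of
    using A tiling_translate[OF T] by auto
qed

lemma translate_mem_orbit_closure: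
  assumes T: "tiling T" and A: "A \<in> orbit_closure T"
  shows "translate s A \<in> orbit_closure T"
  unfolding orbit_closure_iff[OF T]
proof (intro conjI allI)
  have A': "tiling A" "\<And>K. \<exists>s. agree K A (translate s T)"
    using A unfolding orbit_closure_iff[OF T] by blast+
  show "tiling (translate s A)"
    using A'(1) by (rule tiling_translate)
  fix K
  obtain v where "agree (K + \<bar>s\<bar>) A (translate v T)"
    using A'(2) by blast
  then have "agree K (translate s A) (translate s (translate v T))"
    by (rule agree_translate) simp
  then show "\<exists>v. agree K (translate s A) (translate v T)"
    by (auto simp: translate_translate)
qed

lemma self_mem_orbit_closure: "tiling T \<Longrightarrow> T \<in> orbit_closure T"
  unfolding orbit_closure_iff by (metis agree_refl translate_0)

lemma continuous_map_realI:
  fixes G :: "'b \<Rightarrow> real"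
  assumes "\<And>x e. x \<in> topspace X \<Longrightarrow> 0 < e \<Longrightarrow> \<exists>U. openin X U \<and> x \<in> U \<and> (\<forall>y\<in>U. \<bar>G y - G x\<bar> < e)"
  shows "continuous_map X euclideanreal G"
  unfolding Met_TC.continuous_map_to_metric[unfolded mtopology_is_euclidean]
  using assms by (simp add: dist_real_def abs_minus_commute)

lemma openin_dist_ball:
  assumes "tiling A"
  shows "openin (space_topology \<Omega>) {B \<in> \<Omega>. tiling B \<and> tiling_dist A B < r}"
proof -
  have "openin tiling_topology (Til.mball A r)"
    unfolding tiling_topology_def by (rule Til.openin_mball)
  then have "openin (space_topology \<Omega>) (\<Omega> \<inter> Til.mball A r)"
    by (rule openin_subtopology_Int2)
  moreover have "\<Omega> \<inter> Til.mball A r = {B \<in> \<Omega>. tiling B \<and> tiling_dist A B < r}"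
    using assms by auto
  ultimately show ?thesis by simp
qed

lemma tiling_dist_self: "tiling A \<Longrightarrow> tiling_dist A A = 0"
  using Til.mdist_zero by simp

lemma continuous_map_space_realI:
  fixes G :: "'a tiling \<Rightarrow> real"
  assumes \<Omega>: "\<Omega> \<subseteq> {T. tiling T}"
    and G: "\<And>A e. A \<in> \<Omega> \<Longrightarrow> 0 < e \<Longrightarrow> \<exists>K\<ge>0. \<exists>\<delta>>0. \<forall>B\<in>\<Omega>. \<forall>s. \<bar>s\<bar> < \<delta> \<longrightarrow> agree K A (translate s B) \<longrightarrow> \<bar>G B - G A\<bar> < e"
  shows "continuous_map (space_topology \<Omega>) euclideanreal G"
proof (rule continuous_map_realI)
  fix A and e :: real assume A: "A \<in> topspace (space_topology \<Omega>)" and e: "0 < e"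
  then have A': "A \<in> \<Omega>" "tiling A" by auto
  obtain K \<delta> where K: "0 \<le> K" "0 < \<delta>"
    "\<And>B s. B \<in> \<Omega> \<Longrightarrow> \<bar>s\<bar> < \<delta> \<Longrightarrow> agree K A (translate s B) \<Longrightarrow> \<bar>G B - G A\<bar> < e"
    using G[OF A'(1) e] by blast
  obtain r where r: "0 < r" "\<And>A B :: 'a tiling. tiling_dist A B < r \<Longrightarrow> \<exists>s. \<bar>s\<bar> < \<delta> \<and> agree K A (translate s B)"
    using agree_if_dist_less[OF K(2,1)] by auto
  have "\<bar>G B - G A\<bar> < e" if B: "B \<in> {B \<in> \<Omega>. tiling B \<and> tiling_dist A B < r}" for B
  proof -
    obtain s where "\<bar>s\<bar> < \<delta>" "agree K A (translate s B)"
      using r(2)[of A B] B by blast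
    then show ?thesis using K(3) B by blast
  qed
  then show "\<exists>U. openin (space_topology \<Omega>) U \<and> A \<in> U \<and> (\<forall>y\<in>U. \<bar>G y - G A\<bar> < e)"
    using openin_dist_ball[OF A'(2), of \<Omega> r] A' r(1) tiling_dist_self[OF A'(2)]
    by (intro exI[of _ "{B \<in> \<Omega>. tiling B \<and> tiling_dist A B < r}"]) simp
qed

text \<open>A discrepancy between two translation parameters is itself a small translation, so it
  adds to the shift that the metric allows. Each of the two contributes less than
  \<open>\<delta> / 2\<close>.\<close>

lemma continuous_map_translate:
  assumes \<Omega>: "\<Omega> \<subseteq> {T. tiling T}"
  shows "continuous_map (prod_topology (space_topology \<Omega>) euclideanreal) tiling_topology (\<lambda>(A, s). translate s A)"
  unfolding tiling_topology_def[where 'a='a] Til.continuous_map_to_metric[where 'a='a]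
proof (intro ballI allI impI)
  let ?X = "subtopology Til.mtopology \<Omega>"
  have X: "?X = space_topology \<Omega>" by (simp add: tiling_topology_def)
  fix p and e :: real assume p: "p \<in> topspace (prod_topology ?X euclideanreal)" and e: "0 < e"
  obtain A s where As: "p = (A, s)" "A \<in> \<Omega>" "tiling A"
    using p by (cases p) auto
  obtain K \<delta> where K: "0 < K" "0 < \<delta>"
    "\<And>A B :: 'a tiling. \<And>s. \<bar>s\<bar> < \<delta> \<Longrightarrow> agree K A (translate s B) \<Longrightarrow> tiling_dist A B < e"
    using dist_less_if_agree[OF e] by metis
  obtain r where r: "0 < r"
    "\<And>A B :: 'a tiling. tiling_dist A B < r \<Longrightarrow> \<exists>v. \<bar>v\<bar> < \<delta> / 2 \<and> agree (K + \<bar>s\<bar>) A (translate v B)"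
    using agree_if_dist_less[of "\<delta> / 2" "K + \<bar>s\<bar>"] K by auto
  let ?U = "{B \<in> \<Omega>. tiling B \<and> tiling_dist A B < r} \<times> ball s (\<delta> / 2)"
  have "openin (prod_topology ?X euclideanreal) ?U"
    unfolding openin_prod_Times_iff X using openin_dist_ball[OF As(3)] by auto
  moreover have "p \<in> ?U"
    using As r(1) K(2) tiling_dist_self by auto
  moreover have "(case q of (A, s) \<Rightarrow> translate s A) \<in> Til.mball (case p of (A, s) \<Rightarrow> translate s A) e"
    if "q \<in> ?U" for q
  proof -
    obtain B v where q: "q = (B, v)" "B \<in> \<Omega>" "tiling B" "tiling_dist A B < r" "\<bar>s - v\<bar> < \<delta> / 2"
      using \<open>q \<in> ?U\<close> by (cases q) (auto simp: dist_real_def)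
    obtain w where w: "\<bar>w\<bar> < \<delta> / 2" "agree (K + \<bar>s\<bar>) A (translate w B)"
      using r(2)[OF q(4)] by blast
    have "agree K (translate s A) (translate s (translate w B))"
      using agree_translate[OF w(2), of K s] by simp
    then have "agree K (translate s A) (translate (s - v + w) (translate v B))"
      by (simp add: translate_translate algebra_simps)
    moreover have "\<bar>s - v + w\<bar> < \<delta>"
      using q(5) w(1) by linarith
    ultimately have "tiling_dist (translate s A) (translate v B) < e"
      using K(3) by blast
    then show ?thesis
      using As q tiling_translate[OF As(3)] tiling_translate[OF q(3)] by simp
  qed
  ultimately show "\<exists>U. openin (prod_topology ?X euclideanreal) U \<and> p \<in> U \<and>
      (\<forall>q\<in>U. (case q of (A, s) \<Rightarrow> translate s A) \<in> Til.mball (case p of (A, s) \<Rightarrow> translate s A) e)"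
    by (intro exI[of _ ?U]) blast
qed

text \<open>This serves the displacement of the flow, which is continuous on the tiling space at
  each fixed time and uniformly Lipschitz in time.\<close>

lemma continuous_map_prod_Lipschitz:
  fixes X :: "'b \<Rightarrow> real \<Rightarrow> real"
  assumes cont: "\<And>t. continuous_map Y euclideanreal (\<lambda>y. X y t)"
    and lip: "\<And>y t t'. y \<in> topspace Y \<Longrightarrow> \<bar>X y t - X y t'\<bar> \<le> C * \<bar>t - t'\<bar>"
  shows "continuous_map (prod_topology Y euclideanreal) euclideanreal (\<lambda>(y, t). X y t)"
proof (rule continuous_map_realI)
  fix p and e :: real assume p: "p \<in> topspace (prod_topology Y euclideanreal)" and e: "0 < e"
  obtain y t where yt: "p = (y, t)" "y \<in> topspace Y"
    using p by (cases p) auto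
  \<comment> \<open>No sign is assumed for \<open>C\<close>; the denominator is made positive in
    every case.\<close>
  define \<delta> where "\<delta> = e / (2 * (\<bar>C\<bar> + 1))"
  have \<delta>: "0 < \<delta>" "(\<bar>C\<bar> + 1) * \<delta> = e / 2"
    using e by (auto simp: \<delta>_def field_simps)
  define V where "V = {z \<in> topspace Y. X z t \<in> ball (X y t) (e / 2)}"
  have V: "openin Y V"
    unfolding V_def by (rule openin_continuous_map_preimage[OF cont]) auto
  have "\<bar>X z u - X y t\<bar> < e" if z: "z \<in> V" "u \<in> ball t \<delta>" for z u
  proof -
    have "\<bar>X z u - X z t\<bar> \<le> C * \<bar>u - t\<bar>"
      using lip z by (simp add: V_def)
    also have "\<dots> \<le> (\<bar>C\<bar> + 1) * \<delta>"
      using z(2) by (intro mult_mono) (auto simp: dist_real_def)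
    finally have "\<bar>X z u - X z t\<bar> \<le> e / 2"
      using \<delta> by simp
    moreover have "\<bar>X z t - X y t\<bar> < e / 2"
      using z(1) by (auto simp: V_def dist_real_def abs_minus_commute)
    ultimately show ?thesis by linarith
  qed
  moreover have "openin (prod_topology Y euclideanreal) (V \<times> ball t \<delta>)"
    unfolding openin_prod_Times_iff using V by auto
  moreover have "p \<in> V \<times> ball t \<delta>"
    using yt \<delta>(1) e by (simp add: V_def)
  ultimately show "\<exists>U. openin (prod_topology Y euclideanreal) U \<and> p \<in> U \<and>
      (\<forall>q\<in>U. \<bar>(case q of (y, t) \<Rightarrow> X y t) - (case p of (y, t) \<Rightarrow> X y t)\<bar> < e)"
    unfolding yt(1) by (intro exI[of _ "V \<times> ball t \<delta>"]) auto
qed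

section \<open>Repetitivity and the choice of the reference tiling\<close>

lemma finite_patch:
  assumes T: "tiling T"
  shows "finite (patch K T)"
proof -
  obtain D where D: "\<forall>x. \<exists>v. vertex T v \<and> v \<le> x \<and> x \<le> v + D"
    using vertex_below[OF T] by blast
  then obtain v where v: "vertex T v" "v \<le> 0" "0 \<le> v + D"
    by blast
  have "finite (patch (K + D) (translate v T))"
    by (rule finite_subset[OF _ finite_local_complexity(1)[OF T]]) (use v(1) in blast)
  then have "finite (translate (- v) (patch (K + D) (translate v T)))"
    unfolding translate_def by simp
  moreover have "patch K T \<subseteq> translate (- v) (patch (K + D) (translate v T))"
  proof
    fix t assume t: "t \<in> patch K T"
    then have "t \<in> T" by (simp add: patch_def)
    then obtain a b l where tt: "t = ({a..b}, l)"
      using tile_cases[OF T] by metis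
    with t obtain x where x: "({a..b}, l) \<in> T" "a \<le> x" "x \<le> b" "\<bar>x\<bar> \<le> K"
      by (auto simp only: mem_patch_iff)
    have "\<bar>x - v\<bar> \<le> K + D"
      using x v by linarith
    then have "({a - v..b - v}, l) \<in> patch (K + D) (translate v T)"
      unfolding mem_patch_iff using x by (intro conjI exI[of _ "x - v"]) (simp_all add: translate_tile_iff)
    then show "t \<in> translate (- v) (patch (K + D) (translate v T))"
      by (simp add: tt translate_tile_iff)
  qed
  ultimately show ?thesis
    by (rule rev_finite_subset)
qed

lemma translate_mono: "A \<subseteq> B \<Longrightarrow> translate s A \<subseteq> translate s B"
  by (simp add: translate_def image_mono)

text \<open>A copy \<open>translate s P\<close> of the pattern seen at \<open>x\<close> produces the
  return point \<open>x - s\<close>: the copy contains the whole patch, and containment of a patch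
  already gives agreement. The tile of the pattern that covers \<open>x\<close> places this point
  inside the prescribed window.\<close>

lemma repetitive_return:
  assumes T: "tiling T" and rep: "repetitive T"
  shows "\<exists>L>0. \<forall>a. \<exists>y. a \<le> y \<and> y \<le> a + L \<and> agree K (translate y T) (translate x T)"
proof -
  \<comment> \<open>The absolute value guarantees that the patch contains a tile over the origin
    even if \<open>K\<close> is negative.\<close>
  define P where "P = translate (- x) (patch \<bar>K\<bar> (translate x T))"
  have xT: "tiling (translate x T)"
    by (rule tiling_translate[OF T])
  have "finite P"
    unfolding P_def translate_def[of "- x"] by (rule finite_imageI[OF finite_patch[OF xT]])
  moreover have "P \<subseteq> translate (- x) (translate x T)"
    unfolding P_def by (rule translate_mono) (simp add: patch_def)
  then have "P \<subseteq> T"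
    by (simp add: translate_translate)
  ultimately have "\<exists>L>0. \<forall>a. \<exists>s. translate s P \<subseteq> T \<and> (\<Union>t\<in>translate s P. fst t) \<subseteq> {a..a + L}"
    using rep[unfolded repetitive_def, rule_format, of P] by (simp only: simp_thms)
  then obtain L where L: "0 < L" "\<And>a. \<exists>s. translate s P \<subseteq> T \<and> (\<Union>t\<in>translate s P. fst t) \<subseteq> {a..a + L}"
    by metis
  have "\<exists>y. a \<le> y \<and> y \<le> a + L \<and> agree K (translate y T) (translate x T)" for a
  proof -
    obtain s where s: "translate s P \<subseteq> T" "(\<Union>t\<in>translate s P. fst t) \<subseteq> {a..a + L}"
      using L(2) by blast
    have P: "translate x P = patch \<bar>K\<bar> (translate x T)"
      by (simp add: P_def translate_translate)
    have "translate (x - s) (translate s P) \<subseteq> translate (x - s) T"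
      by (rule translate_mono[OF s(1)])
    then have "patch \<bar>K\<bar> (translate x T) \<subseteq> translate (x - s) T"
      by (simp add: translate_translate P)
    then have "agree \<bar>K\<bar> (translate x T) (translate (x - s) T)"
      by (rule agree_if_patch_subset[OF xT tiling_translate[OF T]])
    then have "agree \<bar>K\<bar> (translate (x - s) T) (translate x T)"
      by (rule agree_sym)
    then have "agree K (translate (x - s) T) (translate x T)"
      by (rule agree_mono) simp
    moreover have "a \<le> x - s \<and> x - s \<le> a + L"
    proof -
      obtain p q l where pq: "({p..q}, l) \<in> translate x T" "p \<le> 0" "0 \<le> q"
        using tiling_cover[OF xT] by metis
      have "({p..q}, l) \<in> translate x P"
        unfolding P mem_patch_iff using pq by (intro conjI exI[of _ 0]) simp_all
      then have "({p + (x - s)..q + (x - s)}, l) \<in> translate s P"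
        by (simp add: translate_tile_iff)
      then have "{p + (x - s)..q + (x - s)} \<subseteq> {a..a + L}"
        using s(2) by force
      moreover have "x - s \<in> {p + (x - s)..q + (x - s)}"
        using pq by simp
      ultimately show ?thesis by force
    qed
    ultimately show ?thesis by blast
  qed
  with L(1) show ?thesis by blast
qed

lemma orbit_closure_trans:
  assumes A: "A \<in> orbit_closure B" and B: "B \<in> orbit_closure C" and C: "tiling C"
  shows "A \<in> orbit_closure C"
proof -
  have B': "tiling B" "\<And>K. \<exists>s. agree K B (translate s C)"
    using B unfolding orbit_closure_iff[OF C] by blast+
  have A': "tiling A" "\<And>K. \<exists>s. agree K A (translate s B)"
    using A unfolding orbit_closure_iff[OF B'(1)] by blast+
  have "\<exists>s. agree K A (translate s C)" for K
  proof -
    obtain s where s: "agree K A (translate s B)"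
      using A'(2) by blast
    obtain v where "agree (K + \<bar>s\<bar>) B (translate v C)"
      using B'(2) by blast
    then have "agree K (translate s B) (translate s (translate v C))"
      by (rule agree_translate) simp
    then have "agree K A (translate (s + v) C)"
      using agree_trans[OF s] by (simp add: translate_translate)
    then show ?thesis by blast
  qed
  with A'(1) show ?thesis
    unfolding orbit_closure_iff[OF C] by blast
qed

text \<open>A tiling space is the orbit closure of some unnamed \<open>T0\<close>; this transfers
  what is known about \<open>T0\<close> to the given \<open>T\<close>. Large patches of
  \<open>T\<close> are patches of \<open>T0\<close>, so patterns of \<open>T0\<close> recur in
  \<open>T\<close> with bounded gaps, which puts \<open>T0\<close> into the orbit closure of
  \<open>T\<close>. A period of \<open>T\<close> would then pass to \<open>T0\<close> by comparing
  arbitrarily large patches.\<close>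

lemma tiling_space_reference:
  assumes \<Omega>: "tiling_space \<Omega>" and TO: "T \<in> \<Omega>"
  shows "tiling T" "\<Omega> = orbit_closure T" "nonperiodic T"
    "\<exists>L>0. \<forall>x. \<exists>y. \<bar>y - x\<bar> \<le> L \<and> agree K (translate y T) (translate x0 T)"
proof -
  obtain T0 where T0: "tiling T0" "repetitive T0" "nonperiodic T0" "\<Omega> = orbit_closure T0"
    using \<Omega> unfolding tiling_space_def by blast
  have T: "tiling T" "\<And>K. \<exists>s. agree K T (translate s T0)"
    using TO unfolding T0(4) orbit_closure_iff[OF T0(1)] by blast+
  show "tiling T" by fact
  have ret: "\<exists>L>0. \<forall>x. \<exists>y. \<bar>y - x\<bar> \<le> L \<and> agree K (translate y T) (translate z T0)" for K z
  proof -
    obtain L where L: "0 < L" "\<And>a. \<exists>y. a \<le> y \<and> y \<le> a + L \<and> agree K (translate y T0) (translate z T0)"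
      using repetitive_return[OF T0(1,2), of K z] by blast
    have "\<exists>y. \<bar>y - x\<bar> \<le> L \<and> agree K (translate y T) (translate z T0)" for x
    proof -
      \<comment> \<open>The radius is chosen so that the stretch of \<open>T\<close> within
        \<open>L + K\<close> of \<open>x\<close> is copied from \<open>T0\<close>; a return found
        near \<open>x + w\<close> in \<open>T0\<close> can then be moved back by
        \<open>w\<close>.\<close>
      obtain w where w: "agree (\<bar>x\<bar> + L + K) T (translate w T0)"
        using T(2) by blast
      obtain y where y: "x + w \<le> y" "y \<le> x + w + L" "agree K (translate y T0) (translate z T0)"
        using L(2) by blast
      have "agree K (translate (y - w) T) (translate (y - w) (translate w T0))"
        by (rule agree_translate[OF w]) (use y in linarith)
      then have "agree K (translate (y - w) T) (translate z T0)"
        using agree_trans[OF _ y(3)] by (simp add: translate_translate)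
      moreover have "\<bar>y - w - x\<bar> \<le> L"
        using y by linarith
      ultimately show ?thesis by blast
    qed
    with L(1) show ?thesis by blast
  qed
  obtain z where "agree (K + \<bar>x0\<bar>) T (translate z T0)"
    using T(2) by blast
  then have "agree K (translate x0 T) (translate x0 (translate z T0))"
    by (rule agree_translate) simp
  then have z: "agree K (translate (x0 + z) T0) (translate x0 T)"
    by (simp add: translate_translate agree_sym)
  obtain L where L: "0 < L" "\<And>x. \<exists>y. \<bar>y - x\<bar> \<le> L \<and> agree K (translate y T) (translate (x0 + z) T0)"
    using ret by blast
  have "\<exists>y. \<bar>y - x\<bar> \<le> L \<and> agree K (translate y T) (translate x0 T)" for x
    using L(2)[of x] agree_trans[OF _ z] by blast
  with L(1) show "\<exists>L>0. \<forall>x. \<exists>y. \<bar>y - x\<bar> \<le> L \<and> agree K (translate y T) (translate x0 T)"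
    by blast
  have "\<exists>s. agree K T0 (translate s T)" for K
    using ret[of K 0] agree_sym by fastforce
  then have T0T: "T0 \<in> orbit_closure T"
    unfolding orbit_closure_iff[OF T(1)] using T0(1) by blast
  show "\<Omega> = orbit_closure T"
    using orbit_closure_trans[OF _ T0T T(1)] orbit_closure_trans[OF _ TO[unfolded T0(4)] T0(1)]
    unfolding T0(4) by blast
  show "nonperiodic T"
    unfolding nonperiodic_def
  proof (intro allI impI notI)
    fix s :: real assume "s \<noteq> 0" and per: "translate s T = T"
    have "translate s T0 = T0"
    proof (rule tiling_eqI[OF tiling_translate[OF T0(1)] T0(1)])
      fix R :: real assume "R > 0"
      obtain v where v: "agree (R + \<bar>s\<bar>) T0 (translate v T)"
        using T0T unfolding orbit_closure_iff[OF T(1)] by blast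
      have "translate s (translate v T) = translate v (translate s T)"
        by (simp add: translate_translate add.commute)
      then have "agree R (translate s T0) (translate v T)"
        using agree_translate[OF v, of R s] per by simp
      moreover have "agree R T0 (translate v T)"
        using agree_mono[OF v] by simp
      ultimately show "agree R (translate s T0) T0"
        using agree_trans agree_sym by blast
    qed
    then show False
      using T0(3) \<open>s \<noteq> 0\<close> unfolding nonperiodic_def by blast
  qed
qed

section \<open>Pattern equivariant functions\<close>

text \<open>Finite local complexity reduces the whole line to finitely many intervals of length
  \<open>D\<close>, one for each patch type at a vertex, and a continuous function is bounded on
  their compact union.\<close>

lemma spe_bounded:
  assumes T: "tiling T" and \<phi>: "spe T \<phi>"
  shows "\<exists>B>0. \<forall>x. \<bar>\<phi> x\<bar> \<le> B"
proof -
  obtain R where R: "pe_radius T R \<phi>" and cont: "continuous_on UNIV \<phi>"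
    using \<phi> unfolding spe_def by blast
  obtain D where D: "0 < D" "\<forall>x. \<exists>v. vertex T v \<and> v \<le> x \<and> x \<le> v + D"
    using vertex_below[OF T] by blast
  let ?p = "\<lambda>v. patch (R + D) (translate v T)"
  obtain V where V: "V \<subseteq> {v. vertex T v}" "finite V" "?p ` {v. vertex T v} = ?p ` V"
    using finite_subset_image[OF finite_local_complexity(2)[OF T, of "R + D"] order_refl] by metis
  have "compact (\<Union>v\<in>V. {v..v + D})"
    using V(2) by (intro compact_UN) auto
  then have "compact (\<phi> ` (\<Union>v\<in>V. {v..v + D}))"
    by (rule compact_continuous_image[OF continuous_on_subset[OF cont subset_UNIV]])
  then obtain B where B: "0 < B" "\<And>y. y \<in> \<phi> ` (\<Union>v\<in>V. {v..v + D}) \<Longrightarrow> norm y \<le> B"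
    using compact_imp_bounded bounded_pos by metis
  have "\<bar>\<phi> x\<bar> \<le> B" for x
  proof -
    obtain v where v: "vertex T v" "v \<le> x" "x \<le> v + D"
      using D(2) by blast
    then have "?p v \<in> ?p ` V"
      using V(3) by blast
    then obtain w where w: "w \<in> V" "?p v = ?p w"
      by (rule imageE) simp
    have "agree (R + D) (translate v T) (translate w T)"
      unfolding agree_patch by (rule w(2))
    then have "agree R (translate (x - v) (translate v T)) (translate (x - v) (translate w T))"
      by (rule agree_translate) (use v in simp)
    then have "\<phi> x = \<phi> (x - v + w)"
      using R unfolding pe_radius_def by (simp add: translate_translate)
    moreover have "x - v + w \<in> (\<Union>v\<in>V. {v..v + D})"
      using w(1) v by (intro UN_I[of w]) auto
    ultimately show ?thesis
      using B(2)[of "\<phi> x"] by simp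
  qed
  with B(1) show ?thesis by blast
qed

lemma spe_inverse:
  assumes "spe T \<phi>" "\<And>x. \<phi> x \<noteq> 0"
  shows "spe T (\<lambda>x. 1 / \<phi> x)"
proof -
  have "continuous_on UNIV (\<lambda>x. 1 / \<phi> x)"
    using assms by (intro continuous_intros) (auto simp: spe_def)
  moreover obtain R where R: "R > 0" "pe_radius T R \<phi>"
    using assms(1) unfolding spe_def by blast
  have "pe_radius T R (\<lambda>x. 1 / \<phi> x)"
    unfolding pe_radius_def
  proof (intro allI impI)
    fix x y assume "agree R (translate x T) (translate y T)"
    then have "\<phi> x = \<phi> y" using R(2) unfolding pe_radius_def by blast
    then show "1 / \<phi> x = 1 / \<phi> y" by simp
  qed
  ultimately show ?thesis
    unfolding spe_def using R(1) by blast
qed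

text \<open>The reciprocal is again strongly pattern equivariant, so boundedness applies to
  it.\<close>

lemma spe_bounded_below:
  assumes T: "tiling T" and \<phi>: "spe T \<phi>" "\<And>x. \<phi> x \<noteq> 0"
  shows "\<exists>c>0. \<forall>x. c \<le> \<bar>\<phi> x\<bar>"
proof -
  obtain B where B: "B > 0" "\<And>x. \<bar>1 / \<phi> x\<bar> \<le> B"
    using spe_bounded[OF T spe_inverse[OF \<phi>]] by blast
  have "1 / B \<le> \<bar>\<phi> x\<bar>" for x
    using B(2)[of x] B(1) \<phi>(2)[of x] by (simp add: field_simps)
  then show ?thesis
    using B(1) by (intro exI[of _ "1 / B"]) simp
qed

text \<open>In contrast to \<open>pe_radius\<close>, the radius may depend on the permitted error.
  Combined with continuity on the line, this suffices for a continuous extension to the orbit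
  closure. It is the regularity obtained for h - S, whose radius depends on the bound on the
  iterates at scale \<open>e\<close>.\<close>

definition weakly_pe :: "'a tiling \<Rightarrow> (real \<Rightarrow> real) \<Rightarrow> bool" where
  "weakly_pe T \<psi> \<longleftrightarrow>
     (\<forall>e>0. \<exists>K. \<forall>x y. agree K (translate x T) (translate y T) \<longrightarrow> \<bar>\<psi> x - \<psi> y\<bar> \<le> e)"

lemma weakly_pe_if_pe_radius: "pe_radius T R \<psi> \<Longrightarrow> weakly_pe T \<psi>"
  unfolding weakly_pe_def pe_radius_def by (intro allI impI exI[of _ R]) simp

text \<open>The continuous extension of \<open>\<psi>\<close> to the orbit closure. Quantifying over all pairs
  \<open>(e, K)\<close>, including \<open>e = 0\<close>, makes it exact when \<open>\<psi>\<close> is pattern equivariant.\<close>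

definition extension :: "'a tiling \<Rightarrow> (real \<Rightarrow> real) \<Rightarrow> 'a tiling \<Rightarrow> real" where
  "extension T \<psi> A = (SOME c. \<forall>e K.
     (\<forall>x y. agree K (translate x T) (translate y T) \<longrightarrow> \<bar>\<psi> x - \<psi> y\<bar> \<le> e) \<longrightarrow>
     (\<forall>x. agree K A (translate x T) \<longrightarrow> \<bar>c - \<psi> x\<bar> \<le> e))"

text \<open>Along points of the line whose patches exhaust \<open>A\<close> the values of
  \<open>\<psi>\<close> form a Cauchy sequence. Weak inequalities survive the limit, so this one
  number satisfies the bounds for all pairs \<open>(e, K)\<close> simultaneously and is a witness
  for the choice.\<close>

lemma extension_close:
  assumes T: "tiling T" and \<psi>: "weakly_pe T \<psi>" and A: "A \<in> orbit_closure T"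
    and K: "\<And>x y. agree K (translate x T) (translate y T) \<Longrightarrow> \<bar>\<psi> x - \<psi> y\<bar> \<le> e"
    and x: "agree K A (translate x T)"
  shows "\<bar>extension T \<psi> A - \<psi> x\<bar> \<le> e"
proof -
  have "\<forall>n. \<exists>s. agree (real n) A (translate s T)"
    using A unfolding orbit_closure_iff[OF T] by blast
  then obtain w where w: "\<And>n. agree (real n) A (translate (w n) T)"
    by metis
  have ag: "agree K (translate (w n) T) (translate z T)"
    if "K \<le> real n" "agree K A (translate z T)" for K n z
    using agree_trans[OF agree_sym[OF agree_mono[OF w that(1)]] that(2)] .
  have "Cauchy (\<lambda>n. \<psi> (w n))"
  proof (rule metric_CauchyI)
    fix e :: real assume "0 < e"
    then obtain K where K: "\<And>x y. agree K (translate x T) (translate y T) \<Longrightarrow> \<bar>\<psi> x - \<psi> y\<bar> \<le> e / 2"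
      using \<psi> unfolding weakly_pe_def by (metis half_gt_zero)
    obtain N where N: "K \<le> real N"
      using real_arch_simple by blast
    have "dist (\<psi> (w m)) (\<psi> (w n)) < e" if "m \<ge> N" "n \<ge> N" for m n
    proof -
      have "agree K (translate (w m) T) (translate (w n) T)"
        using that N by (intro ag agree_mono[OF w]) auto
      then show ?thesis
        using K[of "w m" "w n"] \<open>0 < e\<close> by (simp add: dist_real_def)
    qed
    then show "\<exists>M. \<forall>m\<ge>M. \<forall>n\<ge>M. dist (\<psi> (w m)) (\<psi> (w n)) < e"
      by blast
  qed
  then obtain c where c: "(\<lambda>n. \<psi> (w n)) \<longlonglongrightarrow> c"
    by (meson Cauchy_convergent_iff convergent_def)
  have c': "\<bar>c - \<psi> x\<bar> \<le> e"
    if K: "\<forall>x y. agree K (translate x T) (translate y T) \<longrightarrow> \<bar>\<psi> x - \<psi> y\<bar> \<le> e"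
      and x: "agree K A (translate x T)" for e K x
  proof -
    obtain N where N: "K \<le> real N"
      using real_arch_simple by blast
    have "(\<lambda>n. \<bar>\<psi> (w n) - \<psi> x\<bar>) \<longlonglongrightarrow> \<bar>c - \<psi> x\<bar>"
      by (intro tendsto_intros c)
    moreover have "\<bar>\<psi> (w n) - \<psi> x\<bar> \<le> e" if "n \<ge> N" for n
      using K ag[OF _ x, of n] that N by force
    ultimately show ?thesis
      using LIMSEQ_le_const2 by blast
  qed
  have "\<forall>e K. (\<forall>x y. agree K (translate x T) (translate y T) \<longrightarrow> \<bar>\<psi> x - \<psi> y\<bar> \<le> e) \<longrightarrow>
     (\<forall>x. agree K A (translate x T) \<longrightarrow> \<bar>extension T \<psi> A - \<psi> x\<bar> \<le> e)"
    unfolding extension_def by (rule someI[of _ c]) (use c' in blast)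
  then show ?thesis
    using K x by blast
qed

lemma extension_orbit:
  assumes T: "tiling T" and \<psi>: "weakly_pe T \<psi>"
  shows "extension T \<psi> (translate x T) = \<psi> x"
proof -
  have "\<bar>extension T \<psi> (translate x T) - \<psi> x\<bar> \<le> 0 + e" if "0 < e" for e
  proof -
    obtain K where "\<And>x y. agree K (translate x T) (translate y T) \<Longrightarrow> \<bar>\<psi> x - \<psi> y\<bar> \<le> e"
      using \<psi> \<open>0 < e\<close> unfolding weakly_pe_def by metis
    then show ?thesis
      using extension_close[OF T \<psi> translate_mem_orbit_closure[OF T self_mem_orbit_closure[OF T]], of K e x x]
      by simp
  qed
  then have "\<bar>extension T \<psi> (translate x T) - \<psi> x\<bar> \<le> 0"
    by (rule field_le_epsilon)
  then show ?thesis by simp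
qed

text \<open>This is the case of error 0, with \<open>R\<close> as the radius.\<close>

lemma extension_pe:
  assumes T: "tiling T" and \<psi>: "pe_radius T R \<psi>" and A: "A \<in> orbit_closure T"
    and x: "agree R A (translate x T)"
  shows "extension T \<psi> A = \<psi> x"
proof -
  have "\<bar>extension T \<psi> A - \<psi> x\<bar> \<le> 0"
  proof (rule extension_close[OF T weakly_pe_if_pe_radius[OF \<psi>] A _ x])
    fix x y assume "agree R (translate x T) (translate y T)"
    then have "\<psi> x = \<psi> y" using \<psi> unfolding pe_radius_def by blast
    then show "\<bar>\<psi> x - \<psi> y\<bar> \<le> 0" by simp
  qed
  then show ?thesis by simp
qed

lemma extension_pe_translate:
  assumes T: "tiling T" and \<psi>: "pe_radius T R \<psi>" and A: "A \<in> orbit_closure T"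
    and z: "agree (R + \<bar>x\<bar>) A (translate z T)"
  shows "extension T \<psi> (translate x A) = \<psi> (z + x)"
proof (rule extension_pe[OF T \<psi> translate_mem_orbit_closure[OF T A]])
  have "agree R (translate x A) (translate x (translate z T))"
    by (rule agree_translate[OF z]) simp
  then show "agree R (translate x A) (translate (z + x) T)"
    by (simp add: translate_translate add.commute)
qed

lemma orbit_closure_subset: "tiling T \<Longrightarrow> orbit_closure T \<subseteq> {T. tiling T}"
  using orbit_closure_iff by blast

text \<open>A nearby \<open>B\<close> agrees with \<open>A\<close> after a small shift
  \<open>s\<close>, so \<open>A\<close> and \<open>B\<close> are approximated at the points
  \<open>x\<close> and \<open>x - s\<close> of the line, and continuity of \<open>\<psi>\<close> at
  \<open>x\<close> compares the two. The extra 1 in the radius pays for the shift.\<close>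

lemma extension_continuous:
  assumes T: "tiling T" and \<psi>: "weakly_pe T \<psi>" and cont: "continuous_on UNIV \<psi>"
  shows "continuous_map (space_topology (orbit_closure T)) euclideanreal (extension T \<psi>)"
proof (rule continuous_map_space_realI[OF orbit_closure_subset[OF T]])
  fix A and e :: real assume A: "A \<in> orbit_closure T" and e: "0 < e"
  have "0 < e / 4" using e by simp
  then obtain K0 where K0: "\<And>x y. agree K0 (translate x T) (translate y T) \<Longrightarrow> \<bar>\<psi> x - \<psi> y\<bar> \<le> e / 4"
    using \<psi> unfolding weakly_pe_def by metis
  define K where "K = \<bar>K0\<bar>"
  have K: "\<bar>\<psi> x - \<psi> y\<bar> \<le> e / 4" if "agree K (translate x T) (translate y T)" for x y
    using K0[OF agree_mono[OF that]] by (simp add: K_def)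
  obtain x where x: "agree (K + 1) A (translate x T)"
    using A unfolding orbit_closure_iff[OF T] by blast
  have "isCont \<psi> x"
    using cont by (simp add: continuous_on_eq_continuous_at)
  then obtain d where d: "0 < d" "\<And>y. dist y x < d \<Longrightarrow> dist (\<psi> y) (\<psi> x) < e / 4"
    using \<open>0 < e / 4\<close> unfolding continuous_at_eps_delta by metis
  have "\<bar>extension T \<psi> B - extension T \<psi> A\<bar> < e"
    if B: "B \<in> orbit_closure T" and s: "\<bar>s\<bar> < min d 1" and ag: "agree (K + 1) A (translate s B)" for B s
  proof -
    have "agree (K + 1) (translate s B) (translate x T)"
      using agree_trans[OF agree_sym[OF ag] x] .
    then have "agree K (translate (- s) (translate s B)) (translate (- s) (translate x T))"
      by (rule agree_translate) (use s in simp)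
    then have agB: "agree K B (translate (x - s) T)"
      by (simp add: translate_translate)
    have agA: "agree K A (translate x T)"
      by (rule agree_mono[OF x]) simp
    have "\<bar>extension T \<psi> B - \<psi> (x - s)\<bar> \<le> e / 4"
      by (intro extension_close[OF T \<psi> B _ agB] K)
    moreover have "\<bar>extension T \<psi> A - \<psi> x\<bar> \<le> e / 4"
      by (intro extension_close[OF T \<psi> A _ agA] K)
    moreover have "\<bar>\<psi> (x - s) - \<psi> x\<bar> < e / 4"
      using d(2)[of "x - s"] s by (simp add: dist_real_def)
    ultimately show ?thesis using e by linarith
  qed
  then show "\<exists>K\<ge>0. \<exists>\<delta>>0. \<forall>B\<in>orbit_closure T. \<forall>s. \<bar>s\<bar> < \<delta> \<longrightarrow> agree K A (translate s B) \<longrightarrow>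
      \<bar>extension T \<psi> B - extension T \<psi> A\<bar> < e"
    using d(1) by (intro exI[of _ "K + 1"] exI[of _ "min d 1"] conjI) (auto simp: K_def)
qed

text \<open>Near any position on the orbit of \<open>A\<close>, the extension is a translated copy
  of \<open>\<psi>\<close>, because a large patch of \<open>A\<close> occurs in \<open>T\<close>.
  This gives continuity along that orbit; comparing two matching patches of \<open>A\<close> with
  one patch of \<open>T\<close> gives the same radius.\<close>

lemma spe_on_extension:
  assumes T: "tiling T" and \<psi>: "spe T \<psi>"
  shows "spe_on (orbit_closure T) (extension T \<psi>)"
proof -
  obtain R where R: "R > 0" "pe_radius T R \<psi>" and cont: "continuous_on UNIV \<psi>"
    using \<psi> unfolding spe_def by blast
  have "spe A (\<lambda>x. extension T \<psi> (translate x A))" if A: "A \<in> orbit_closure T" for A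
  proof -
    have "isCont (\<lambda>x. extension T \<psi> (translate x A)) x" for x
    proof -
      obtain z where z: "agree (R + \<bar>x\<bar> + 1) A (translate z T)"
        using A unfolding orbit_closure_iff[OF T] by blast
      have "\<forall>\<^sub>F y in nhds x. y \<in> ball x 1"
        by (intro eventually_nhds_in_open) auto
      then have "\<forall>\<^sub>F y in nhds x. extension T \<psi> (translate y A) = \<psi> (z + y)"
      proof eventually_elim
        case (elim y)
        then have "R + \<bar>y\<bar> \<le> R + \<bar>x\<bar> + 1" by (auto simp: dist_real_def)
        then show ?case
          using extension_pe_translate[OF T R(2) A agree_mono[OF z]] by blast
      qed
      moreover have "isCont (\<lambda>y. \<psi> (z + y)) x"
        using cont by (intro continuous_intros isCont_o2[of _ "\<lambda>y. z + y"]) (simp add: continuous_on_eq_continuous_at)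
      ultimately show ?thesis
        by (subst isCont_cong) auto
    qed
    then have "continuous_on UNIV (\<lambda>x. extension T \<psi> (translate x A))"
      by (simp add: continuous_on_eq_continuous_at)
    moreover have "pe_radius A R (\<lambda>x. extension T \<psi> (translate x A))"
      unfolding pe_radius_def
    proof (intro allI impI)
      fix x y assume ag: "agree R (translate x A) (translate y A)"
      have xA: "translate x A \<in> orbit_closure T" "translate y A \<in> orbit_closure T"
        by (rule translate_mem_orbit_closure[OF T A])+
      obtain w where w: "agree R (translate x A) (translate w T)"
        using xA(1) unfolding orbit_closure_iff[OF T] by blast
      have "agree R (translate y A) (translate w T)"
        by (rule agree_trans[OF agree_sym[OF ag] w])
      then show "extension T \<psi> (translate x A) = extension T \<psi> (translate y A)"
        using extension_pe[OF T R(2) xA(1) w] extension_pe[OF T R(2) xA(2)] by simp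
    qed
    ultimately show ?thesis
      unfolding spe_def using R(1) by blast
  qed
  then show ?thesis
    unfolding spe_on_def
    by (intro conjI ballI extension_continuous[OF T weakly_pe_if_pe_radius[OF R(2)] cont])
qed

section \<open>Lifting the dynamics to a translation\<close>

text \<open>The iterates and the primitive are kept abstract so that the lemma also applies to
  inverse iterates with -S. The hypothesis \<open>dense\<close> puts \<open>M\<close> before
  \<open>t\<close>: the bound on the number of iterates is uniform along the line, and this
  uniformity is what makes h - S weakly pattern equivariant.\<close>

lemma rotation_lift:
  fixes it :: "int \<Rightarrow> real \<Rightarrow> real" and S :: "real \<Rightarrow> real" and Rc x0 :: real and T :: "'a tiling"
  defines "C \<equiv> {y. agree Rc (translate y T) (translate x0 T)}"
  assumes it_0: "\<And>x. it 0 x = x"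
    and it_add: "\<And>m n x. it (m + n) x = it m (it n x)"
    and it_mono: "\<And>m x y. x < y \<Longrightarrow> it m x < it m y"
    and it_up: "\<And>L. \<exists>J. \<forall>x. x + L \<le> it J x"
    and it_disp: "\<And>m x. \<bar>it m x - x\<bar> \<le> \<bar>real_of_int m\<bar> * D"
    and it_loc: "\<And>W m x1 x2 y. agree (W + \<bar>real_of_int m\<bar> * D + Rf) (translate x1 T) (translate x2 T) \<Longrightarrow>
        \<bar>y - x1\<bar> \<le> W \<Longrightarrow> it m (y + (x2 - x1)) = it m y + (x2 - x1)"
    and rot: "\<And>y1 y2 n. y1 \<in> C \<Longrightarrow> y2 \<in> C \<Longrightarrow> S y2 - S y1 < real_of_int n \<Longrightarrow> y2 < it n y1"
    and dense: "\<And>e. 0 < e \<Longrightarrow>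
        \<exists>M. \<forall>t. \<exists>m y. \<bar>real_of_int m\<bar> \<le> M \<and> y \<in> C \<and> t - e < S y + real_of_int m \<and> S y + real_of_int m < t"
    and C_dense: "\<And>x. \<exists>y. \<bar>y - x\<bar> \<le> L \<and> y \<in> C"
    and c: "0 < c" "\<And>x y. c * \<bar>x - y\<bar> \<le> \<bar>S x - S y\<bar>"
    and A: "\<And>x y. \<bar>S x - S y\<bar> \<le> A * \<bar>x - y\<bar>"
    and S_loc: "\<And>u x y. agree (R + \<bar>u\<bar>) (translate x T) (translate y T) \<Longrightarrow> S (y + u) - S y = S (x + u) - S x"
  shows "\<exists>h. continuous_on UNIV h \<and> (\<forall>x. h (it 1 x) = h x + 1) \<and> weakly_pe T (\<lambda>x. h x - S x)"
proof -
  have D: "0 \<le> D"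
    using it_disp[where m=1 and x=0] by simp
  have it_inv: "it (- m) (it m x) = x" "it m (it (- m) x) = x" for m x
    using it_add[of "- m" m x] it_add[of m "- m" x] it_0 by simp_all
  have it_less_iff: "it m x < it m y \<longleftrightarrow> x < y" for m x y
    using it_mono[of x y m] it_mono[of y x m] by (cases x y rule: linorder_cases) auto
  have it_down: "it (- J) y \<le> y - l" if "\<forall>x. x + l \<le> it J x" for J y l
    using that[rule_format, of "it (- J) y"] it_inv(2)[of J y] by simp
  \<comment> \<open>Only the difference \<open>m2 - m1\<close> matters for \<open>rot\<close>; the
    monotone map \<open>it m1\<close> then carries the comparison to the iterates.\<close>
  have order: "it m1 y1 < it m2 y2" if "y1 \<in> C" "y2 \<in> C" "S y1 + real_of_int m1 < S y2 + real_of_int m2" for y1 y2 m1 m2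
  proof -
    have "S y1 - S y2 < real_of_int (m2 - m1)"
      using that(3) by simp
    then have "y1 < it (m2 - m1) y2"
      by (rule rot[OF that(2,1)])
    then have "it m1 y1 < it m1 (it (m2 - m1) y2)"
      by (rule it_mono)
    then show ?thesis
      using it_add[of m1 "m2 - m1" y2] by simp
  qed
  define V where "V x = {S y + real_of_int m | m y. y \<in> C \<and> it m y \<le> x}" for x
  define h where "h x = Sup (V x)" for x
  \<comment> \<open>Numbers attached to points at or left of \<open>x\<close> never exceed those
    attached to points at or right of \<open>x\<close>, so a supremum over the left side is a
    sensible value at \<open>x\<close>.\<close>
  have bound: "S y + real_of_int m \<le> S y' + real_of_int m'"
    if "y \<in> C" "y' \<in> C" "it m y \<le> x" "x \<le> it m' y'" for m m' y y' x
  proof (rule ccontr)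
    assume "\<not> S y + real_of_int m \<le> S y' + real_of_int m'"
    then have "it m' y' < it m y"
      using order[OF that(2,1), of m' m] by simp
    then show False
      using that(3,4) by simp
  qed
  have x0: "x0 \<in> C" by (simp add: C_def)
  have V_ne: "V x \<noteq> {}" for x
  proof -
    obtain J where "\<forall>z. z + \<bar>x0 - x\<bar> \<le> it J z"
      using it_up by blast
    then have "it (- J) x0 \<le> x0 - \<bar>x0 - x\<bar>"
      by (rule it_down)
    then have "it (- J) x0 \<le> x" by linarith
    then show ?thesis
      unfolding V_def using x0 by blast
  qed
  have V_bdd: "bdd_above (V x)" for x
  proof -
    obtain J where J: "\<forall>z. z + \<bar>x0 - x\<bar> \<le> it J z"
      using it_up by blast
    have "x \<le> it J x0" using J[rule_format, of x0] by linarith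
    then have "v \<le> S x0 + real_of_int J" if "v \<in> V x" for v
      using bound[OF _ x0] that unfolding V_def by blast
    then show ?thesis by (rule bdd_aboveI)
  qed
  have h_upper: "h x \<le> S y + real_of_int m" if "y \<in> C" "x \<le> it m y" for x y m
    unfolding h_def
  proof (rule cSup_least[OF V_ne])
    fix v assume "v \<in> V x"
    then show "v \<le> S y + real_of_int m"
      using bound[OF _ that(1) _ that(2)] unfolding V_def by blast
  qed
  have h_lower: "S y + real_of_int m \<le> h x" if "y \<in> C" "it m y \<le> x" for x y m
    unfolding h_def by (rule cSup_upper[OF _ V_bdd]) (use that in \<open>auto simp: V_def\<close>)
  \<comment> \<open>A strict inequality between numbers forces a strict one between points; this
    leaves an open neighbourhood of \<open>x\<close> for the continuity proof.\<close>
  have less_h: "it m y < x" if y: "y \<in> C" and l: "S y + real_of_int m < h x" for x y m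
    using h_upper[OF y, of x m] l by fastforce
  have h_less: "x < it m y" if y: "y \<in> C" and l: "h x < S y + real_of_int m" for x y m
    using h_lower[OF y, of m x] l by fastforce
  have V_it: "V (it 1 x) = (\<lambda>v. v + 1) ` V x" for x
  proof (intro equalityI subsetI)
    fix v assume "v \<in> V (it 1 x)"
    then obtain m y where y: "v = S y + real_of_int m" "y \<in> C" "it m y \<le> it 1 x"
      unfolding V_def by blast
    have "it m y = it 1 (it (m - 1) y)"
      using it_add[of 1 "m - 1" y] by simp
    then have "it (m - 1) y \<le> x"
      using y(3) it_less_iff[of 1 x "it (m - 1) y"] by simp
    then have "S y + real_of_int (m - 1) \<in> V x"
      unfolding V_def using y(2) by blast
    then have "(S y + real_of_int (m - 1)) + 1 \<in> (\<lambda>v. v + 1) ` V x"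
      by (rule imageI)
    then show "v \<in> (\<lambda>v. v + 1) ` V x"
      by (simp add: y(1))
  next
    fix v assume "v \<in> (\<lambda>v. v + 1) ` V x"
    then obtain m y where y: "v = S y + real_of_int m + 1" "y \<in> C" "it m y \<le> x"
      unfolding V_def by blast
    have "it (m + 1) y = it 1 (it m y)"
      using it_add[of 1 m y] by (simp add: add.commute)
    then have "it (m + 1) y \<le> it 1 x"
      using y(3) it_less_iff[of 1 x "it m y"] by simp
    then have "S y + real_of_int (m + 1) \<in> V (it 1 x)"
      unfolding V_def using y(2) by blast
    then show "v \<in> V (it 1 x)"
      by (simp add: y(1) add.assoc)
  qed
  have h_it: "h (it 1 x) = h x + 1" for x
  proof -
    have "Sup ((\<lambda>v. 1 + v) ` V x) = 1 + Sup (V x)"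
      using Sup_add_eq[of "\<lambda>v. v" "V x" 1] V_bdd V_ne by simp
    then show ?thesis
      unfolding h_def V_it by (simp add: add.commute)
  qed
  have h_cont: "isCont h x" for x
    unfolding continuous_at_eps_delta
  proof (intro allI impI)
    fix e :: real assume e: "0 < e"
    obtain M where M: "\<forall>t. \<exists>m y. \<bar>real_of_int m\<bar> \<le> M \<and> y \<in> C \<and> t - e < S y + real_of_int m \<and> S y + real_of_int m < t"
      using dense[OF e] by blast
    obtain m y where y: "y \<in> C" "h x - e < S y + real_of_int m" "S y + real_of_int m < h x"
      using M by blast
    \<comment> \<open>Density is used at \<open>h x + e\<close>, which gives a number strictly above
      \<open>h x\<close> by less than \<open>e\<close>. With the number strictly below, the two
      attached points bracket \<open>x\<close>, and \<open>h\<close> stays between the two numbers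
      on the bracket.\<close>
    obtain m' y' where y': "y' \<in> C" "h x + e - e < S y' + real_of_int m'" "S y' + real_of_int m' < h x + e"
      using M by blast
    have 1: "it m y < x" using less_h y(1,3) .
    have 2: "x < it m' y'" using h_less[OF y'(1)] y'(2) by simp
    have "\<bar>h z - h x\<bar> < e" if "\<bar>z - x\<bar> < min (x - it m y) (it m' y' - x)" for z
    proof -
      have "it m y \<le> z" "z \<le> it m' y'"
        using that by linarith+
      then show ?thesis
        using h_lower[OF y(1), of m z] h_upper[OF y'(1), of z m'] y y' by linarith
    qed
    then show "\<exists>d>0. \<forall>z. dist z x < d \<longrightarrow> dist (h z) (h x) < e"
      using 1 2 by (intro exI[of _ "min (x - it m y) (it m' y' - x)"]) (simp add: dist_real_def)
  qed
  obtain J where J: "\<forall>z. z + L \<le> it J z"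
    using it_up by blast
  \<comment> \<open>Some return point lies within \<open>L\<close> of \<open>x\<close>;
    \<open>J\<close> iterates carry it past \<open>x\<close>, and replacing it by \<open>x\<close>
    changes \<open>S\<close> by at most \<open>A * L\<close>.\<close>
  define B where "B = \<bar>real_of_int J\<bar> + A * L"
  have A0: "0 \<le> A"
    using A[of 0 1] by simp
  have h_S: "\<bar>h x - S x\<bar> \<le> B" for x
  proof -
    obtain y where y: "\<bar>y - x\<bar> \<le> L" "y \<in> C"
      using C_dense by blast
    have "x \<le> it J y"
      using J[rule_format, of y] y(1) by linarith
    then have "h x \<le> S y + real_of_int J"
      by (rule h_upper[OF y(2)])
    moreover have "it (- J) y \<le> x"
      using it_down[OF J, of y] y(1) by linarith
    then have "S y + real_of_int (- J) \<le> h x"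
      by (rule h_lower[OF y(2)])
    moreover have "\<bar>S y - S x\<bar> \<le> A * L"
      using A[of y x] mult_left_mono[OF y(1) A0] by linarith
    ultimately show ?thesis
      unfolding B_def of_int_minus by linarith
  qed
  have "weakly_pe T (\<lambda>x. h x - S x)"
    unfolding weakly_pe_def
  proof (intro allI impI)
    fix e :: real assume e: "0 < e"
    obtain M where M: "\<forall>t. \<exists>m y. \<bar>real_of_int m\<bar> \<le> M \<and> y \<in> C \<and> t - e < S y + real_of_int m \<and> S y + real_of_int m < t"
      using dense[OF e] by blast
    \<comment> \<open>If \<open>S y + m\<close> is within \<open>e\<close> of \<open>h x\<close> and
      |m| \<le> M, then \<open>S y\<close> and \<open>S x\<close> differ by at most
      \<open>B + M + e\<close>. The lower slope \<open>c\<close> of \<open>S\<close> turns this into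
      a bound on the distance from \<open>y\<close> to \<open>x\<close>.\<close>
    define W where "W = (B + M + e) / c"
    \<comment> \<open>The patch must show the return points within \<open>W\<close> and their
      iterates, which drift by at most \<open>M * D\<close>; the remaining terms are the radii that
      govern the displacement, the return set and the form.\<close>
    define K where "K = W + M * D + \<bar>Rf\<bar> + \<bar>Rc\<bar> + \<bar>R\<bar>"
    have M0: "0 \<le> M"
      using M by (meson abs_ge_zero order_trans)
    have W: "0 \<le> W"
      unfolding W_def using h_S[of 0] M0 e c(1) by (intro divide_nonneg_pos) linarith+
    have MD: "0 \<le> M * D"
      using M0 D by simp
    have near: "\<bar>y - x\<bar> \<le> W" if "\<bar>real_of_int m\<bar> \<le> M" "\<bar>S y + real_of_int m - h x\<bar> < e" for m y x
    proof -
      have "c * \<bar>y - x\<bar> \<le> \<bar>S y - S x\<bar>" by (rule c(2))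
      also have "\<dots> \<le> B + M + e"
        using h_S[of x] that by linarith
      finally show ?thesis
        using c(1) by (simp add: W_def field_simps)
    qed
    \<comment> \<open>Everything that enters the bracket of \<open>h x1\<close> is visible in the
      patch and moves rigidly by \<open>x2 - x1\<close>. The two numbers within \<open>e\<close> of
      \<open>h x1\<close> on either side, shifted by \<open>S x2 - S x1\<close>, therefore enclose
      \<open>h x2\<close>.\<close>
    have transfer: "y + (x2 - x1) \<in> C \<and> it m (y + (x2 - x1)) = it m y + (x2 - x1) \<and>
        S (y + (x2 - x1)) - S x2 = S y - S x1"
      if ag: "agree K (translate x1 T) (translate x2 T)" and m: "\<bar>real_of_int m\<bar> \<le> M" and y: "y \<in> C"
        and d: "\<bar>y - x1\<bar> \<le> W" for x1 x2 m y
    proof (intro conjI)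
      have "agree Rc (translate (y - x1) (translate x1 T)) (translate (y - x1) (translate x2 T))"
        by (rule agree_translate[OF ag]) (use d MD in \<open>simp add: K_def\<close>)
      then have "agree Rc (translate y T) (translate (y + (x2 - x1)) T)"
        by (simp add: translate_translate algebra_simps)
      then show "y + (x2 - x1) \<in> C"
        using y agree_trans[OF agree_sym] unfolding C_def by blast
      have "\<bar>real_of_int m\<bar> * D \<le> M * D"
        using m D by (rule mult_right_mono)
      then have "agree (W + \<bar>real_of_int m\<bar> * D + Rf) (translate x1 T) (translate x2 T)"
        by (intro agree_mono[OF ag]) (simp add: K_def)
      then show "it m (y + (x2 - x1)) = it m y + (x2 - x1)"
        using d by (rule it_loc)
      have "agree (R + \<bar>y - x1\<bar>) (translate x1 T) (translate x2 T)"
        by (rule agree_mono[OF ag]) (use d MD in \<open>simp add: K_def\<close>)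
      from S_loc[OF this] show "S (y + (x2 - x1)) - S x2 = S y - S x1"
        by (simp add: algebra_simps)
    qed
    have "\<bar>(h x1 - S x1) - (h x2 - S x2)\<bar> \<le> e" if ag: "agree K (translate x1 T) (translate x2 T)" for x1 x2
    proof -
      obtain m y where y: "\<bar>real_of_int m\<bar> \<le> M" "y \<in> C" "h x1 - e < S y + real_of_int m" "S y + real_of_int m < h x1"
        using M by blast
      obtain m' y' where y': "\<bar>real_of_int m'\<bar> \<le> M" "y' \<in> C" "h x1 + e - e < S y' + real_of_int m'" "S y' + real_of_int m' < h x1 + e"
        using M by blast
      have d: "\<bar>y - x1\<bar> \<le> W" "\<bar>y' - x1\<bar> \<le> W"
        using near[OF y(1), of y x1] near[OF y'(1), of y' x1] y y' by linarith+
      note t = transfer[OF ag y(1,2) d(1)] and t' = transfer[OF ag y'(1,2) d(2)]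
      have "it m y < x1"
        using less_h[OF y(2,4)] .
      then have 1: "S (y + (x2 - x1)) + real_of_int m \<le> h x2"
        using t by (intro h_lower) simp_all
      have "x1 < it m' y'"
        using h_less[OF y'(2), of x1 m'] y'(3) by simp
      then have 2: "h x2 \<le> S (y' + (x2 - x1)) + real_of_int m'"
        using t' by (intro h_upper) simp_all
      from 1 2 y y' t t' show ?thesis
        by linarith
    qed
    then show "\<exists>K. \<forall>x y. agree K (translate x T) (translate y T) \<longrightarrow> \<bar>(h x - S x) - (h y - S y)\<bar> \<le> e"
      by blast
  qed
  moreover have "continuous_on UNIV h"
    using h_cont by (simp add: continuous_on_eq_continuous_at)
  ultimately show ?thesis
    using h_it by (intro exI[of _ h]) simp
qed

section \<open>Shape changes\<close>

text \<open>A single primitive on the whole line evaluates every integral, also with reversed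
  limits, so \<open>form_integral\<close> can be handled as a difference of values from here
  on.\<close>

lemma form_integral_antiderivative:
  assumes "continuous_on UNIV \<nu>"
  shows "(form_integral \<nu> 0 has_real_derivative \<nu> x) (at x)"
    and "form_integral \<nu> x y = form_integral \<nu> 0 y - form_integral \<nu> 0 x"
proof -
  have "isCont \<nu> x" for x
    using assms by (simp add: continuous_on_eq_continuous_at)
  then obtain F where F: "\<And>x. (F has_vector_derivative \<nu> x) (at x)"
    using einterval_antiderivative[of "-\<infinity>" \<infinity> \<nu>] by auto
  have int: "form_integral \<nu> a b = F b - F a" for a b
    unfolding form_integral_def
    by (rule interval_integral_FTC_finite)
      (auto intro: continuous_on_subset[OF assms] has_vector_derivative_at_within[OF F])
  have eq: "form_integral \<nu> 0 = (\<lambda>b. F b - F 0)"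
    using int by blast
  have "(F has_real_derivative \<nu> x) (at x)"
    using F by (simp add: has_real_derivative_iff_has_vector_derivative)
  then show "(form_integral \<nu> 0 has_real_derivative \<nu> x) (at x)"
    unfolding eq by (auto intro!: derivative_eq_intros)
  show "form_integral \<nu> x y = form_integral \<nu> 0 y - form_integral \<nu> 0 x"
    by (simp add: int)
qed

text \<open>Both signs are carried along because an irrational class may be represented by a
  negative form, in which case \<open>S\<close> reverses orientation. The radius is a parameter
  because the collars of the shape change depend on it.\<close>

locale pe_form =
  fixes T :: "'a tiling" and \<nu> :: "real \<Rightarrow> real" and R :: real
  assumes T: "tiling T"
    and R: "0 < R" "pe_radius T R \<nu>"
    and cont: "continuous_on UNIV \<nu>"
    and sign: "(\<forall>x. 0 < \<nu> x) \<or> (\<forall>x. \<nu> x < 0)"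
begin

abbreviation S :: "real \<Rightarrow> real" where "S \<equiv> form_integral \<nu> 0"

definition Q :: "real \<Rightarrow> real" where "Q = inv S"

lemma spe_form: "spe T \<nu>"
  unfolding spe_def using R cont by blast

lemma nonzero: "\<nu> x \<noteq> 0"
  using sign by (metis less_irrefl)

lemmas S_deriv = form_integral_antiderivative(1)[OF cont]
  and S_diff = form_integral_antiderivative(2)[OF cont]

lemma S_0 [simp]: "S 0 = 0"
  using S_diff[of 0 0] by simp

lemma S_cont: "continuous_on X S"
  by (rule DERIV_continuous_on) (rule has_field_derivative_at_within[OF S_deriv])

lemma pe_eq: "agree R (translate x T) (translate y T) \<Longrightarrow> \<nu> x = \<nu> y"
  using R(2) unfolding pe_radius_def by blast

text \<open>The difference of the two increments has vanishing derivative between 0 and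
  \<open>u\<close>. The condition \<open>0 \<le> s * u\<close> restricts the comparison to that
  segment, so that equality of the form on a single tile, to one side of its endpoint, is
  enough.\<close>

lemma S_increment_eq:
  assumes eq: "\<And>s. \<bar>s\<bar> \<le> \<bar>u\<bar> \<Longrightarrow> 0 \<le> s * u \<Longrightarrow> \<nu> (x + s) = \<nu> (y + s)"
  shows "S (y + u) - S y = S (x + u) - S x"
proof -
  define d where "d s = S (y + s) - S (x + s)" for s
  have deriv: "(d has_real_derivative \<nu> (y + s) - \<nu> (x + s)) (at s)" for s
    unfolding d_def
    by (auto intro!: derivative_eq_intros DERIV_chain'[OF _ S_deriv])
  have "d u = d 0"
  proof (cases "u = 0")
    case False
    have "\<exists>z. \<nu> (y + z) - \<nu> (x + z) = 0 \<and> d u - d 0 = u * (\<nu> (y + z) - \<nu> (x + z))"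
    proof (cases "0 < u")
      case True
      obtain z where "0 < z" "z < u" "d u - d 0 = (u - 0) * (\<nu> (y + z) - \<nu> (x + z))"
        using MVT2[of 0 u d, OF True deriv] by metis
      moreover from this have "\<nu> (x + z) = \<nu> (y + z)"
        by (intro eq) auto
      ultimately show ?thesis by (intro exI[of _ z]) simp
    next
      case neg: False
      with False have u: "u < 0" by simp
      obtain z where "u < z" "z < 0" "d 0 - d u = (0 - u) * (\<nu> (y + z) - \<nu> (x + z))"
        using MVT2[of u 0 d, OF u deriv] by metis
      moreover from this have "\<nu> (x + z) = \<nu> (y + z)"
        by (intro eq) (auto simp: mult_nonpos_nonpos)
      ultimately show ?thesis by (intro exI[of _ z]) simp
    qed
    then show ?thesis by auto
  qed simp
  then show ?thesis by (simp add: d_def)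
qed

lemma S_loc:
  assumes "agree (R + \<bar>u\<bar>) (translate x T) (translate y T)"
  shows "S (y + u) - S y = S (x + u) - S x"
proof (rule S_increment_eq)
  fix s assume s: "\<bar>s\<bar> \<le> \<bar>u\<bar>"
  have "agree R (translate s (translate x T)) (translate s (translate y T))"
    by (rule agree_translate[OF assms]) (use s in simp)
  then show "\<nu> (x + s) = \<nu> (y + s)"
    by (intro pe_eq) (simp add: translate_translate add.commute)
qed

lemma S_mean_value: "\<exists>z. S y - S x = (y - x) * \<nu> z"
proof (cases x y rule: linorder_cases)
  case less
  then show ?thesis using MVT2[of x y S, OF less S_deriv] by blast
next
  case greater
  then obtain z where "S x - S y = (x - y) * \<nu> z" using MVT2[of y x S, OF greater S_deriv] by blast
  then have "S y - S x = (y - x) * \<nu> z" by (simp add: algebra_simps)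
  then show ?thesis ..
qed simp

lemma S_lower: "\<exists>c>0. \<forall>x y. c * \<bar>x - y\<bar> \<le> \<bar>S x - S y\<bar>"
proof -
  obtain c where c: "c > 0" "\<And>x. c \<le> \<bar>\<nu> x\<bar>"
    using spe_bounded_below[OF T spe_form nonzero] by blast
  have "c * \<bar>x - y\<bar> \<le> \<bar>S x - S y\<bar>" for x y
  proof -
    obtain z where "S x - S y = (x - y) * \<nu> z"
      using S_mean_value by blast
    then show ?thesis
      using mult_right_mono[OF c(2)[of z], of "\<bar>x - y\<bar>"] by (simp add: abs_mult mult.commute)
  qed
  with c(1) show ?thesis by blast
qed

lemma S_upper: "\<exists>A>0. \<forall>x y. \<bar>S x - S y\<bar> \<le> A * \<bar>x - y\<bar>"
proof -
  obtain A where A: "A > 0" "\<And>x. \<bar>\<nu> x\<bar> \<le> A"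
    using spe_bounded[OF T spe_form] by blast
  have "\<bar>S x - S y\<bar> \<le> A * \<bar>x - y\<bar>" for x y
  proof -
    obtain z where "S x - S y = (x - y) * \<nu> z"
      using S_mean_value by blast
    then show ?thesis
      using mult_right_mono[OF A(2)[of z], of "\<bar>x - y\<bar>"] by (simp add: abs_mult mult.commute)
  qed
  with A(1) show ?thesis by blast
qed

lemma S_mono_or_antimono: "(\<forall>x y. x < y \<longrightarrow> S x < S y) \<or> (\<forall>x y. x < y \<longrightarrow> S y < S x)"
proof -
  have "S x < S y" if "\<forall>x. 0 < \<nu> x" "x < y" for x y
  proof -
    obtain z where "S y - S x = (y - x) * \<nu> z" using S_mean_value by blast
    moreover have "0 < (y - x) * \<nu> z" using that by simp
    ultimately show ?thesis by linarith
  qed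
  moreover have "S y < S x" if "\<forall>x. \<nu> x < 0" "x < y" for x y
  proof -
    obtain z where "S y - S x = (y - x) * \<nu> z" using S_mean_value by blast
    moreover have "(y - x) * \<nu> z < 0" using that by (simp add: mult_pos_neg)
    ultimately show ?thesis by linarith
  qed
  ultimately show ?thesis using sign by blast
qed

lemma S_inj: "S x = S y \<longleftrightarrow> x = y"
  using S_mono_or_antimono by (metis less_irrefl linorder_less_linear)

lemma S_surj: "\<exists>x. S x = t"
proof -
  obtain c where c: "c > 0" "\<And>x y. c * \<bar>x - y\<bar> \<le> \<bar>S x - S y\<bar>"
    using S_lower by blast
  \<comment> \<open>At distance \<open>r\<close> from the origin \<open>S\<close> exceeds |t| in
    absolute value, with opposite signs on the two sides.\<close>
  define r where "r = (\<bar>t\<bar> + 1) / c"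
  have r: "r > 0" "c * r = \<bar>t\<bar> + 1"
    using c(1) by (auto simp: r_def)
  have "\<bar>t\<bar> < \<bar>S r\<bar>" "\<bar>t\<bar> < \<bar>S (- r)\<bar>"
    using c(2)[of r 0] c(2)[of "- r" 0] r by auto
  moreover have "S (- r) < 0 \<and> 0 < S r \<or> S r < 0 \<and> 0 < S (- r)"
    using S_mono_or_antimono r(1) by (metis S_0 neg_less_0_iff_less)
  ultimately consider "S (- r) \<le> t" "t \<le> S r" | "S r \<le> t" "t \<le> S (- r)"
    by linarith
  then show ?thesis
  proof cases
    case 1
    then show ?thesis using IVT'[of S "- r" t r] S_cont r(1) by auto
  next
    case 2
    then show ?thesis using IVT2'[of S r t "- r"] S_cont r(1) by auto
  qed
qed

lemma S_Q [simp]: "S (Q t) = t"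
  unfolding Q_def using S_surj by (metis surj_f_inv_f surj_def)

lemma Q_S [simp]: "Q (S x) = x"
  using S_inj S_Q by blast

lemma Q_Lipschitz: "\<exists>C>0. \<forall>s t. \<bar>Q s - Q t\<bar> \<le> C * \<bar>s - t\<bar>"
proof -
  obtain c where c: "c > 0" "\<And>x y. c * \<bar>x - y\<bar> \<le> \<bar>S x - S y\<bar>"
    using S_lower by blast
  have "\<bar>Q s - Q t\<bar> \<le> 1 / c * \<bar>s - t\<bar>" for s t
    using c(2)[of "Q s" "Q t"] c(1) by (simp add: field_simps)
  then show ?thesis
    using c(1) by (intro exI[of _ "1 / c"]) simp
qed

lemma Q_cont: "isCont Q t"
proof -
  obtain C where C: "C > 0" "\<And>s t. \<bar>Q s - Q t\<bar> \<le> C * \<bar>s - t\<bar>"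
    using Q_Lipschitz by blast
  show ?thesis
    unfolding continuous_at_eps_delta
  proof (intro allI impI)
    fix e :: real assume e: "0 < e"
    have "dist (Q s) (Q t) < e" if "dist s t < e / C" for s
      using C(2)[of s t] that C(1) by (simp add: dist_real_def field_simps)
    then show "\<exists>d>0. \<forall>s. dist s t < d \<longrightarrow> dist (Q s) (Q t) < e"
      using e C(1) by (intro exI[of _ "e / C"]) simp
  qed
qed

lemma Q_deriv: "(Q has_real_derivative 1 / \<nu> (Q t)) (at t)"
proof -
  have "(Q has_real_derivative inverse (\<nu> (Q t))) (at t)"
    by (rule DERIV_inverse_function[of S _ _ _ "t - 1" "t + 1"])
      (auto simp: S_deriv nonzero Q_cont)
  then show ?thesis by (simp add: inverse_eq_divide)
qed

lemma S_image: "a \<le> b \<Longrightarrow> S ` {a..b} = {min (S a) (S b)..max (S a) (S b)}"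
proof -
  assume ab: "a \<le> b"
  have le: "(S x \<le> S y \<longleftrightarrow> x \<le> y) \<or> (S x \<le> S y \<longleftrightarrow> y \<le> x)" for x y
    using S_mono_or_antimono by (metis linorder_not_less nle_le order.order_iff_strict)
  from S_mono_or_antimono show ?thesis
  proof
    assume m: "\<forall>x y. x < y \<longrightarrow> S x < S y"
    then have le: "S x \<le> S y \<longleftrightarrow> x \<le> y" for x y
      by (metis linorder_not_less order.order_iff_strict)
    have "t \<in> S ` {a..b}" if "S a \<le> t" "t \<le> S b" for t
    proof (rule image_eqI)
      show "t = S (Q t)" by simp
      show "Q t \<in> {a..b}" using that le[of a "Q t"] le[of "Q t" b] by simp
    qed
    then show ?thesis
      using ab le by (auto simp: min_def max_def)
  next
    assume m: "\<forall>x y. x < y \<longrightarrow> S y < S x"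
    then have le: "S x \<le> S y \<longleftrightarrow> y \<le> x" for x y
      by (metis linorder_not_less order.order_iff_strict)
    have "t \<in> S ` {a..b}" if "S b \<le> t" "t \<le> S a" for t
    proof (rule image_eqI)
      show "t = S (Q t)" by simp
      show "Q t \<in> {a..b}" using that le[of b "Q t"] le[of "Q t" a] by simp
    qed
    then show ?thesis
      using ab le by (auto simp: min_def max_def)
  qed
qed

section \<open>The reshaped tiling and its relation to the original one\<close>

lemma reshape_tileI:
  "({a..b}, l) \<in> T \<Longrightarrow> (S ` {a..b}, (l, collar R T {a..b})) \<in> reshape R \<nu> T"
  unfolding reshape_def by (rule image_eqI[of _ _ "({a..b}, l)"]) simp_all

lemma reshape_tileE:
  assumes "t \<in> reshape R \<nu> T"
  obtains a b l where "({a..b}, l) \<in> T" "a < b" "t = (S ` {a..b}, (l, collar R T {a..b}))"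
proof -
  obtain I l where I: "(I, l) \<in> T" "t = (S ` I, (l, collar R T I))"
    using assms unfolding reshape_def by auto
  obtain a b where "I = {a..b}" "a < b"
    using tile_cases[OF T I(1)] by (metis Pair_inject)
  with I that show ?thesis by metis
qed

text \<open>Equal collars say that the surroundings of the two tiles out to distance
  \<open>R\<close> coincide once the left endpoints are aligned. Hence the form takes the same
  values along both tiles, and their images under \<open>S\<close> have equal length; this is why
  the new labels determine the new lengths.\<close>

lemma collar_eqD:
  assumes t: "({a..b}, l) \<in> T" "({a'..b'}, l) \<in> T" and col: "collar R T {a..b} = collar R T {a'..b'}"
    and s: "0 \<le> s" "s \<le> b - a"
  shows "b' - a' = b - a" "\<nu> (a + s) = \<nu> (a' + s)" "S (a' + s) - S a' = S (a + s) - S a"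
proof -
  obtain len where "\<And>a b l. ({a..b}, l) \<in> T \<Longrightarrow> b - a = len l"
    using tile_lengths[OF T] by blast
  from this[OF t(1)] this[OF t(2)] show len: "b' - a' = b - a" by simp
  have ab: "a < b" "a' < b'"
    by (rule tile_less[OF T t(1)], rule tile_less[OF T t(2)])
  have \<nu>: "\<nu> (a + s) = \<nu> (a' + s)" if s: "0 \<le> s" "s \<le> b - a" for s
  proof (rule pe_eq)
    show "agree R (translate (a + s) T) (translate (a' + s) T)"
    proof (rule agree_if_patch_subset[OF tiling_translate[OF T] tiling_translate[OF T]])
      show "patch R (translate (a + s) T) \<subseteq> translate (a' + s) T"
      proof
        fix t assume t: "t \<in> patch R (translate (a + s) T)"
        then have "t \<in> translate (a + s) T" by (simp add: patch_def)
        then obtain p q k where tt: "t = ({p..q}, k)"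
          using tile_cases[OF tiling_translate[OF T]] by metis
        with t obtain x where x: "({p..q}, k) \<in> translate (a + s) T" "p \<le> x" "x \<le> q" "\<bar>x\<bar> \<le> R"
          by (auto simp only: mem_patch_iff)
        let ?t = "({p + (a + s)..q + (a + s)}, k)"
        have "?t \<in> T"
          using x(1) by (simp add: translate_tile_iff)
        moreover have "\<exists>x\<in>fst ?t. \<exists>y\<in>{a..b}. \<bar>x - y\<bar> \<le> R"
          using x(2-4) s by (intro bexI[of _ "x + (a + s)"] bexI[of _ "a + s"]) auto
        ultimately have "?t \<in> {t \<in> T. \<exists>x\<in>fst t. \<exists>y\<in>{a..b}. \<bar>x - y\<bar> \<le> R}"
          by blast
        then have "({p + s..q + s}, k) \<in> translate a {t \<in> T. \<exists>x\<in>fst t. \<exists>y\<in>{a..b}. \<bar>x - y\<bar> \<le> R}"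
          unfolding translate_tile_iff by (simp add: add.commute add.left_commute)
        then have "({p + s..q + s}, k) \<in> collar R T {a..b}"
          using ab(1) by (simp add: collar_def)
        then have "({p + s..q + s}, k) \<in> collar R T {a'..b'}"
          by (simp only: col)
        then have "({p + s..q + s}, k) \<in> translate a' {t \<in> T. \<exists>x\<in>fst t. \<exists>y\<in>{a'..b'}. \<bar>x - y\<bar> \<le> R}"
          using ab(2) by (simp add: collar_def)
        then have "({p + s + a'..q + s + a'}, k) \<in> T"
          unfolding translate_tile_iff by simp
        then show "t \<in> translate (a' + s) T"
          unfolding tt translate_tile_iff by (simp add: add.commute add.left_commute)
      qed
    qed
  qed
  show "\<nu> (a + s) = \<nu> (a' + s)" by (rule \<nu>[OF s])
  show "S (a' + s) - S a' = S (a + s) - S a"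
  proof (rule S_increment_eq)
    fix u assume u: "\<bar>u\<bar> \<le> \<bar>s\<bar>" "0 \<le> u * s"
    have "0 \<le> u"
    proof (cases "s = 0")
      case True
      then show ?thesis using u by simp
    next
      case False
      then show ?thesis using u(2) s(1) by (simp add: zero_le_mult_iff)
    qed
    then show "\<nu> (a + u) = \<nu> (a' + u)"
      using u s by (intro \<nu>) auto
  qed
qed

text \<open>A tile within \<open>R\<close> of a tile of length at most \<open>D\<close> meets the
  window of radius \<open>R + D\<close> about the left endpoint. All collars are therefore subsets
  of one finite set of tiles.\<close>

lemma finite_reshape_labels: "finite (snd ` reshape R \<nu> T)"
proof -
  obtain d D where d: "0 < d" "\<And>a b l. ({a..b}, l) \<in> T \<Longrightarrow> d \<le> b - a \<and> b - a \<le> D"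
    using tile_length_bounds[OF T] by blast
  let ?U = "\<Union>v\<in>{v. vertex T v}. patch (R + D) (translate v T)"
  have "collar R T {a..b} \<subseteq> ?U" if t: "({a..b}, l) \<in> T" for a b l
  proof
    fix t assume "t \<in> collar R T {a..b}"
    moreover have ab: "a < b" by (rule tile_less[OF T t])
    ultimately have t1: "t \<in> translate a {t \<in> T. \<exists>x\<in>fst t. \<exists>y\<in>{a..b}. \<bar>x - y\<bar> \<le> R}"
      by (simp add: collar_def)
    moreover have "translate a {t \<in> T. \<exists>x\<in>fst t. \<exists>y\<in>{a..b}. \<bar>x - y\<bar> \<le> R} \<subseteq> translate a T"
      by (rule translate_mono) blast
    ultimately have "t \<in> translate a T" by blast
    then obtain p q k where tt: "t = ({p..q}, k)"
      using tile_cases[OF tiling_translate[OF T]] by metis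
    then obtain x y where x: "({p + a..q + a}, k) \<in> T" "x \<in> {p + a..q + a}" "y \<in> {a..b}" "\<bar>x - y\<bar> \<le> R"
      using t1 unfolding tt translate_tile_iff by auto
    have "\<bar>x - a\<bar> \<le> R + D"
      using x d(2)[OF t] by auto
    then have "({p..q}, k) \<in> patch (R + D) (translate a T)"
      unfolding mem_patch_iff translate_tile_iff using x by (intro conjI exI[of _ "x - a"]) auto
    moreover have "vertex T a"
      using t unfolding vertex_def by blast
    ultimately show "t \<in> ?U"
      unfolding tt by blast
  qed note collar = this
  have "snd ` reshape R \<nu> T \<subseteq> snd ` T \<times> Pow ?U"
  proof
    fix L assume "L \<in> snd ` reshape R \<nu> T"
    then obtain t where t: "t \<in> reshape R \<nu> T" "L = snd t" by blast
    from t(1) obtain a b l where "({a..b}, l) \<in> T" "t = (S ` {a..b}, (l, collar R T {a..b}))"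
      by (rule reshape_tileE)
    moreover from this have "l \<in> snd ` T" by force
    ultimately show "L \<in> snd ` T \<times> Pow ?U"
      using collar t(2) by simp
  qed
  moreover have "finite (snd ` T \<times> Pow ?U)"
    using T finite_local_complexity(1)[OF T, of "R + D"]
    by (intro finite_cartesian_product) (auto simp: tiling_def)
  ultimately show ?thesis
    by (rule finite_subset)
qed

lemma tiling_reshape: "tiling (reshape R \<nu> T)"
  unfolding tiling_def
proof (intro conjI ballI impI)
  fix t assume "t \<in> reshape R \<nu> T"
  then obtain a b l where t: "({a..b}, l) \<in> T" "a < b" "t = (S ` {a..b}, (l, collar R T {a..b}))"
    by (rule reshape_tileE)
  have "S a \<noteq> S b" using t(2) S_inj by simp
  then show "\<exists>a b. a < b \<and> fst t = {a..b}"
    using t S_image[of a b] by (intro exI[of _ "min (S a) (S b)"] exI[of _ "max (S a) (S b)"]) auto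
next
  show "finite (snd ` reshape R \<nu> T)" by (rule finite_reshape_labels)
next
  fix t t' assume tt: "t \<in> reshape R \<nu> T" "t' \<in> reshape R \<nu> T" "snd t = snd t'"
  from tt(1) obtain a b l where t: "({a..b}, l) \<in> T" "a < b" "t = (S ` {a..b}, (l, collar R T {a..b}))"
    by (rule reshape_tileE)
  from tt(2) obtain a' b' l' where t': "({a'..b'}, l') \<in> T" "a' < b'" "t' = (S ` {a'..b'}, (l', collar R T {a'..b'}))"
    by (rule reshape_tileE)
  have l: "l' = l" "collar R T {a..b} = collar R T {a'..b'}"
    using tt(3) t(3) t'(3) by simp_all
  note c = collar_eqD[OF t(1) t'(1)[unfolded l(1)] l(2), of "b - a"]
  have "b' - a' = b - a" and S_eq: "S (a' + (b - a)) - S a' = S (a + (b - a)) - S a"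
    using c(1,3) t(2) by simp_all
  then have ends: "a' + (b - a) = b'" "a + (b - a) = b" by simp_all
  have "S b' - S a' = S b - S a" using S_eq unfolding ends .
  moreover have "measure lborel (S ` {p..q}) = \<bar>S q - S p\<bar>" if "p < q" for p q
    using S_image[of p q] that by (auto simp: min_def max_def)
  ultimately show "measure lborel (fst t) = measure lborel (fst t')"
    using t t' by simp
next
  fix t t' assume tt: "t \<in> reshape R \<nu> T" "t' \<in> reshape R \<nu> T" "t \<noteq> t'"
  from tt(1) obtain a b l where t: "({a..b}, l) \<in> T" "a < b" "t = (S ` {a..b}, (l, collar R T {a..b}))"
    by (rule reshape_tileE)
  from tt(2) obtain a' b' l' where t': "({a'..b'}, l') \<in> T" "a' < b'" "t' = (S ` {a'..b'}, (l', collar R T {a'..b'}))"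
    by (rule reshape_tileE)
  have "\<not> (a < b' \<and> a' < b)"
  proof
    assume *: "a < b' \<and> a' < b"
    have "a = a'" "b = b'" "l = l'"
      using * by (intro tiling_overlap[OF T t(1) t'(1)]; simp)+
    then show False using tt(3) t t' by simp
  qed
  then consider "b \<le> a'" | "b' \<le> a" by linarith
  then have "max (min (S a) (S b)) (min (S a') (S b')) \<ge> min (max (S a) (S b)) (max (S a') (S b'))"
  proof cases
    case 1
    from S_mono_or_antimono show ?thesis
    proof
      assume "\<forall>x y. x < y \<longrightarrow> S x < S y"
      then have "S a < S b" "S b \<le> S a'" "S a' < S b'"
        using t t' 1 by (auto simp: order.order_iff_strict)
      then show ?thesis by simp
    next
      assume "\<forall>x y. x < y \<longrightarrow> S y < S x"
      then have "S b < S a" "S a' \<le> S b" "S b' < S a'"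
        using t t' 1 by (auto simp: order.order_iff_strict)
      then show ?thesis by simp
    qed
  next
    case 2
    from S_mono_or_antimono show ?thesis
    proof
      assume "\<forall>x y. x < y \<longrightarrow> S x < S y"
      then have "S a < S b" "S b' \<le> S a" "S a' < S b'"
        using t t' 2 by (auto simp: order.order_iff_strict)
      then show ?thesis by simp
    next
      assume "\<forall>x y. x < y \<longrightarrow> S y < S x"
      then have "S b < S a" "S a \<le> S b'" "S b' < S a'"
        using t t' 2 by (auto simp: order.order_iff_strict)
      then show ?thesis by simp
    qed
  qed
  moreover have "interior (fst t) = {min (S a) (S b)<..<max (S a) (S b)}"
    "interior (fst t') = {min (S a') (S b')<..<max (S a') (S b')}"
    using t t' S_image[of a b] S_image[of a' b'] by simp_all
  ultimately show "interior (fst t) \<inter> interior (fst t') = {}"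
    by simp
next
  show "(\<Union>t\<in>reshape R \<nu> T. fst t) = UNIV"
  proof (intro equalityI subsetI)
    fix y :: real
    obtain a b l where t: "({a..b}, l) \<in> T" "a \<le> Q y" "Q y \<le> b"
      using tiling_cover[OF T, of "Q y"] by metis
    have "y \<in> S ` {a..b}"
      using t by (intro image_eqI[of _ _ "Q y"]) simp_all
    then show "y \<in> (\<Union>t\<in>reshape R \<nu> T. fst t)"
      using reshape_tileI[OF t(1)] by force
  qed simp
qed

text \<open>Minimality will supply matching patches in the reshaped tiling, while return points are
  wanted in \<open>T\<close>. The constant \<open>A\<close> is a Lipschitz constant of
  \<open>S\<close>, so the image of the window of radius \<open>\<rho>\<close> fits into radius
  \<open>A * \<rho>\<close>. On each tile the induced map is a translation by
  \<open>collar_eqD\<close>; its derivative is therefore 1 throughout the window, which makes it one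
  and the same translation on all tiles there.\<close>

lemma agree_if_reshape_agree:
  obtains A where "\<And>\<rho> y1 y2. 0 \<le> \<rho> \<Longrightarrow>
    agree (A * \<rho>) (translate (S y1) (reshape R \<nu> T)) (translate (S y2) (reshape R \<nu> T)) \<Longrightarrow>
    agree \<rho> (translate y1 T) (translate y2 T)"
proof -
  obtain A where A: "A > 0" "\<And>x y. \<bar>S x - S y\<bar> \<le> A * \<bar>x - y\<bar>"
    using S_upper by blast
  have "agree \<rho> (translate y1 T) (translate y2 T)"
    if \<rho>: "0 \<le> \<rho>" and ag: "agree (A * \<rho>) (translate (S y1) (reshape R \<nu> T)) (translate (S y2) (reshape R \<nu> T))"
    for \<rho> y1 y2
  proof -
    \<comment> \<open>The map \<open>g\<close> carries a neighbourhood of \<open>y1\<close> to one of \<open>y2\<close>; equal collars force \<open>g' = 1\<close>.\<close>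
    define g where "g z = Q (S z - S y1 + S y2)" for z
    have tile: "\<exists>a' b'. ({a'..b'}, l) \<in> T \<and> b' - a' = b - a \<and> \<nu> z = \<nu> (g z) \<and> g z = a' + (z - a)"
      if t: "({a..b}, l) \<in> T" "a \<le> z" "z \<le> b" and z: "\<bar>z - y1\<bar> \<le> \<rho>" for a b l z
    proof -
      have ab: "a < b" by (rule tile_less[OF T t(1)])
      let ?L = "(l, collar R T {a..b})"
      have im: "S ` {a..b} = {min (S a) (S b)..max (S a) (S b)}"
        using ab by (simp add: S_image)
      have "({min (S a) (S b) - S y1..max (S a) (S b) - S y1}, ?L) \<in> translate (S y1) (reshape R \<nu> T)"
        unfolding translate_tile_iff using reshape_tileI[OF t(1)] im by simp
      moreover have "S z \<in> S ` {a..b}" using t by simp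
      then have "min (S a) (S b) - S y1 \<le> S z - S y1" "S z - S y1 \<le> max (S a) (S b) - S y1"
        unfolding im by simp_all
      moreover have "\<bar>S z - S y1\<bar> \<le> A * \<rho>"
        using A(2)[of z y1] mult_left_mono[OF z, of A] A(1) by linarith
      ultimately have "({min (S a) (S b) - S y1..max (S a) (S b) - S y1}, ?L) \<in> translate (S y2) (reshape R \<nu> T)"
        by (rule agree_tileD[OF ag])
      then have "({min (S a) (S b) - S y1 + S y2..max (S a) (S b) - S y1 + S y2}, ?L) \<in> reshape R \<nu> T"
        unfolding translate_tile_iff .
      then obtain a' b' l' where t': "({a'..b'}, l') \<in> T" "a' < b'"
        "({min (S a) (S b) - S y1 + S y2..max (S a) (S b) - S y1 + S y2}, ?L) = (S ` {a'..b'}, (l', collar R T {a'..b'}))"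
        by (rule reshape_tileE)
      then have l: "l' = l" "collar R T {a..b} = collar R T {a'..b'}"
        and im': "{min (S a) (S b) - S y1 + S y2..max (S a) (S b) - S y1 + S y2} = S ` {a'..b'}"
        by auto
      have "S ` {a'..b'} = {min (S a') (S b')..max (S a') (S b')}"
        using t'(2) by (simp add: S_image)
      then have eq: "min (S a) (S b) - S y1 + S y2 = min (S a') (S b')" "max (S a) (S b) - S y1 + S y2 = max (S a') (S b')"
      proof -
        have "{min (S a) (S b) - S y1 + S y2..max (S a) (S b) - S y1 + S y2} = {min (S a') (S b')..max (S a') (S b')}"
          using im' \<open>S ` {a'..b'} = {min (S a') (S b')..max (S a') (S b')}\<close> by (rule trans)
        moreover have "min (S a) (S b) - S y1 + S y2 \<le> max (S a) (S b) - S y1 + S y2"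
          by simp
        ultimately show "min (S a) (S b) - S y1 + S y2 = min (S a') (S b')" "max (S a) (S b) - S y1 + S y2 = max (S a') (S b')"
          unfolding Icc_eq_Icc by metis+
      qed
      \<comment> \<open>For a negative form the left endpoint of a tile becomes the right endpoint
        of its image, so the sign decides which of the two equations is the relevant one.\<close>
      have Sa: "S a - S y1 + S y2 = S a'"
        using S_mono_or_antimono
      proof
        assume "\<forall>x y. x < y \<longrightarrow> S x < S y"
        then have "S a < S b" "S a' < S b'" using ab t'(2) by simp_all
        then show ?thesis using eq by simp
      next
        assume "\<forall>x y. x < y \<longrightarrow> S y < S x"
        then have "S b < S a" "S b' < S a'" using ab t'(2) by simp_all
        then show ?thesis using eq by simp
      qed
      note c = collar_eqD[OF t(1) t'(1)[unfolded l(1)] l(2), of "z - a"]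
      have c': "b' - a' = b - a" "\<nu> z = \<nu> (a' + (z - a))" "S (a' + (z - a)) - S a' = S z - S a"
        using c t by simp_all
      have "S (a' + (z - a)) = S z - S y1 + S y2"
        using c'(3) Sa by linarith
      then have "g z = Q (S (a' + (z - a)))"
        unfolding g_def by simp
      then have "g z = a' + (z - a)"
        unfolding Q_S .
      then show ?thesis
        using t'(1) c'(1,2) unfolding l(1) by (intro exI[of _ a'] exI[of _ b']) simp
    qed
    have \<nu>: "\<nu> z = \<nu> (g z)" if z: "\<bar>z - y1\<bar> \<le> \<rho>" for z
    proof -
      obtain a b l where t: "({a..b}, l) \<in> T" "a \<le> z" "z \<le> b"
        using tiling_cover[OF T, of z] by metis
      show ?thesis using tile[OF t z] by blast
    qed
    have deriv: "((\<lambda>z. g z - z) has_real_derivative 0) (at z within {y1 - \<rho>..y1 + \<rho>})"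
      if z: "z \<in> {y1 - \<rho>..y1 + \<rho>}" for z
    proof -
      have "\<bar>z - y1\<bar> \<le> \<rho>" using z by auto
      then have \<nu>z: "\<nu> z = \<nu> (g z)" by (rule \<nu>)
      have 1: "((\<lambda>z. S z - S y1 + S y2) has_real_derivative \<nu> z) (at z)"
        by (auto intro!: derivative_eq_intros S_deriv)
      have 2: "(g has_real_derivative 1 / \<nu> (Q (S z - S y1 + S y2)) * \<nu> z) (at z)"
        unfolding g_def by (rule DERIV_chain2[OF Q_deriv 1])
      have "1 / \<nu> (Q (S z - S y1 + S y2)) * \<nu> z = 1"
        using \<nu>z nonzero[of z] unfolding g_def by simp
      then have "((\<lambda>z. g z - z) has_real_derivative 1 - 1) (at z)"
        using 2 by (intro DERIV_diff DERIV_ident) simp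
      then show ?thesis
        using has_field_derivative_at_within by simp
    qed
    have "\<exists>k. \<forall>z\<in>{y1 - \<rho>..y1 + \<rho>}. g z - z = k"
      by (rule has_field_derivative_zero_constant) (auto intro: deriv)
    then obtain k where k: "\<And>z. z \<in> {y1 - \<rho>..y1 + \<rho>} \<Longrightarrow> g z - z = k"
      by blast
    have "g y1 = y2"
      by (simp add: g_def)
    then have "k = y2 - y1"
      using k[of y1] \<rho> by simp
    with k have g: "g z = z + (y2 - y1)" if "\<bar>z - y1\<bar> \<le> \<rho>" for z
    proof -
      have "z \<in> {y1 - \<rho>..y1 + \<rho>}"
        using that by (auto simp: abs_le_iff)
      from k[OF this] \<open>k = y2 - y1\<close> show ?thesis by simp
    qed
    show ?thesis
    proof (rule agree_if_patch_subset[OF tiling_translate[OF T] tiling_translate[OF T]])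
      show "patch \<rho> (translate y1 T) \<subseteq> translate y2 T"
      proof
        fix t assume t: "t \<in> patch \<rho> (translate y1 T)"
        then have "t \<in> translate y1 T" by (simp add: patch_def)
        then obtain p q k where tt: "t = ({p..q}, k)"
          using tile_cases[OF tiling_translate[OF T]] by metis
        with t obtain x where x: "({p + y1..q + y1}, k) \<in> T" "p \<le> x" "x \<le> q" "\<bar>x\<bar> \<le> \<rho>"
          by (auto simp only: mem_patch_iff translate_tile_iff)
        obtain a' b' where t': "({a'..b'}, k) \<in> T" "b' - a' = (q + y1) - (p + y1)"
          "g (x + y1) = a' + ((x + y1) - (p + y1))"
          using tile[OF x(1), of "x + y1"] x(2-4) by auto
        have "g (x + y1) = (x + y1) + (y2 - y1)"
          using x(4) by (intro g) simp
        then have "a' = p + y2" "b' = q + y2"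
          using t'(2,3) by linarith+
        then show "t \<in> translate y2 T"
          using t'(1) unfolding tt translate_tile_iff by simp
      qed
    qed
  qed
  then show ?thesis by (rule that)
qed

end

section \<open>Minimality of the unit translation and dense returns\<close>

lemma continuous_map_translate_orbit_closure:
  assumes X: "tiling X"
  shows "continuous_map (space_topology (orbit_closure X)) (space_topology (orbit_closure X)) (translate s)"
proof -
  let ?O = "space_topology (orbit_closure X)"
  have "continuous_map ?O (prod_topology ?O euclideanreal) (\<lambda>A. (A, s))"
    by (simp add: continuous_map_paired)
  from continuous_map_compose[OF this continuous_map_translate[OF orbit_closure_subset[OF X]]]
  have "continuous_map ?O tiling_topology (translate s)"
    by (simp add: o_def)
  then show ?thesis
    by (rule continuous_map_into_subtopology)
      (use translate_mem_orbit_closure[OF X] in auto)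
qed

text \<open>The tilings whose two-sided orbit under unit translation avoids the ball around
  \<open>B\<close> form a closed invariant set that misses \<open>B\<close>, hence an empty one.
  Two-sided orbits are taken because \<open>minimal_map\<close> asks for equality of
  \<open>C\<close> with its image.\<close>

lemma minimal_map_visits:
  assumes X: "tiling X" and min: "minimal_map (space_topology (orbit_closure X)) (translate 1)"
    and A: "A \<in> orbit_closure X" and B: "B \<in> orbit_closure X" and r: "0 < r"
  shows "\<exists>m::int. tiling_dist B (translate (of_int m) A) < r"
proof -
  let ?O = "space_topology (orbit_closure X)"
  let ?U = "{A \<in> orbit_closure X. tiling A \<and> tiling_dist B A < r}"
  have til: "tiling A" if "A \<in> orbit_closure X" for A
    using orbit_closure_subset[OF X] that by blast
  have top: "topspace ?O = orbit_closure X"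
    using orbit_closure_subset[OF X] by auto
  have U: "openin ?O ?U"
    by (rule openin_dist_ball[OF til[OF B]])
  define C where "C = {A \<in> orbit_closure X. \<forall>m::int. translate (of_int m) A \<notin> ?U}"
  have "closedin ?O {A \<in> topspace ?O. translate (of_int m) A \<in> topspace ?O - ?U}" for m :: int
    by (rule closedin_continuous_map_preimage[OF continuous_map_translate_orbit_closure[OF X]])
      (use U in blast)
  then have "closedin ?O (\<Inter>m::int. {A \<in> topspace ?O. translate (of_int m) A \<in> topspace ?O - ?U})"
    by (intro closedin_Inter) auto
  moreover have "(\<Inter>m::int. {A \<in> topspace ?O. translate (of_int m) A \<in> topspace ?O - ?U}) = C"
    unfolding top C_def using translate_mem_orbit_closure[OF X] by auto
  ultimately have "closedin ?O C"
    by simp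
  have inv: "translate (of_int k) A \<in> C" if "A \<in> C" for A and k :: int
  proof -
    have "translate (of_int m) (translate (of_int k) A) \<notin> ?U" for m :: int
    proof -
      have "translate (of_int (m + k)) A \<notin> ?U"
        using that unfolding C_def by blast
      then show ?thesis by (simp add: translate_translate)
    qed
    then show ?thesis
      using that translate_mem_orbit_closure[OF X] unfolding C_def by blast
  qed
  have "translate 1 ` C = C"
  proof (intro equalityI subsetI)
    fix A assume "A \<in> translate 1 ` C"
    then show "A \<in> C" using inv[of _ 1] by auto
  next
    fix A assume "A \<in> C"
    then have "translate (- 1) A \<in> C" using inv[of A "- 1"] by simp
    then have "translate 1 (translate (- 1) A) \<in> translate 1 ` C" by (rule imageI)
    then show "A \<in> translate 1 ` C" by (simp add: translate_translate)
  qed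
  with \<open>closedin ?O C\<close> have "C = {} \<or> C = topspace ?O"
    using min unfolding minimal_map_def by blast
  moreover have "B \<notin> C"
  proof
    assume "B \<in> C"
    then have "translate (of_int 0) B \<notin> ?U" unfolding C_def by blast
    then show False using B til[OF B] r tiling_dist_self by simp
  qed
  ultimately have "A \<notin> C"
    using B top by auto
  then show ?thesis
    using A unfolding C_def by blast
qed

text \<open>If no bound worked, positions that are bad for larger and larger bounds would
  subconverge to a tiling \<open>A\<close>. Minimality provides one integer \<open>m\<close> for
  \<open>A\<close>, and agreement of large patches carries that visit back to the bad positions. The
  tolerance is shared between the shift allowed by the metric and the correction in the
  convergence.\<close>

lemma minimal_map_visits_uniformly:
  assumes X: "tiling X" and min: "minimal_map (space_topology (orbit_closure X)) (translate 1)"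
    and \<delta>: "0 < \<delta>"
  shows "\<exists>M. \<forall>t. \<exists>(m::int) s. \<bar>real_of_int m\<bar> \<le> M \<and> \<bar>s\<bar> < \<delta> \<and>
    agree K (translate w X) (translate (t + of_int m + s) X)"
proof (rule ccontr)
  assume "\<not> ?thesis"
  then have "\<forall>n::nat. \<exists>t. \<not> (\<exists>(m::int) s. \<bar>real_of_int m\<bar> \<le> real n \<and> \<bar>s\<bar> < \<delta> \<and>
      agree K (translate w X) (translate (t + of_int m + s) X))"
    by blast
  then obtain t where t: "\<And>n m s. \<bar>real_of_int m\<bar> \<le> real n \<Longrightarrow> \<bar>s\<bar> < \<delta> \<Longrightarrow>
      \<not> agree K (translate w X) (translate (t n + of_int m + s) X)"
    by metis
  obtain q u A where q: "strict_mono q" "u \<longlonglongrightarrow> 0" "tiling A"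
    "\<And>K. \<forall>\<^sub>F n in sequentially. agree K A (translate (t (q n) + u n) X)"
    using translates_convergent[OF X, of t] by blast
  have "\<exists>s. agree K A (translate s X)" for K
    using eventually_happens[OF q(4)[of K]] by auto
  then have A: "A \<in> orbit_closure X"
    unfolding orbit_closure_iff[OF X] using q(3) by blast
  obtain r where r: "0 < r" "\<And>A B :: 'a tiling. tiling_dist A B < r \<Longrightarrow> \<exists>s. \<bar>s\<bar> < \<delta> / 2 \<and> agree \<bar>K\<bar> A (translate s B)"
    using agree_if_dist_less[of "\<delta> / 2" "\<bar>K\<bar>"] \<delta> by auto
  obtain m :: int where "tiling_dist (translate w X) (translate (of_int m) A) < r"
    using minimal_map_visits[OF X min A translate_mem_orbit_closure[OF X self_mem_orbit_closure[OF X]] r(1)] by blast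
  then obtain s where s: "\<bar>s\<bar> < \<delta> / 2" "agree \<bar>K\<bar> (translate w X) (translate s (translate (of_int m) A))"
    using r(2) by blast
  have "\<forall>\<^sub>F n in sequentially. dist (u n) 0 < \<delta> / 2"
    using q(2) \<delta> by (intro tendstoD) auto
  moreover obtain n0 :: nat where "\<bar>real_of_int m\<bar> \<le> real n0"
    using real_arch_simple by blast
  then have "\<forall>\<^sub>F n in sequentially. \<bar>real_of_int m\<bar> \<le> real n"
    by (intro eventually_mono[OF eventually_ge_at_top[of n0]]) linarith
  ultimately have "\<forall>\<^sub>F n in sequentially. False"
    using q(4)[of "\<bar>K\<bar> + \<bar>s + of_int m\<bar>"]
  proof eventually_elim
    case (elim n)
    have "agree K (translate (s + of_int m) A) (translate (s + of_int m) (translate (t (q n) + u n) X))"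
      by (rule agree_translate[OF elim(3)]) simp
    moreover have "agree K (translate w X) (translate (s + of_int m) A)"
      using agree_mono[OF s(2), of K] by (simp add: translate_translate)
    ultimately have "agree K (translate w X) (translate (s + of_int m) (translate (t (q n) + u n) X))"
      using agree_trans by blast
    moreover have "s + of_int m + (t (q n) + u n) = t (q n) + of_int m + (s + u n)"
      by simp
    ultimately have "agree K (translate w X) (translate (t (q n) + of_int m + (s + u n)) X)"
      by (simp only: translate_translate)
    moreover have "\<bar>real_of_int m\<bar> \<le> real (q n)"
      using elim(2) seq_suble[OF q(1), of n] by linarith
    moreover have "\<bar>s + u n\<bar> < \<delta>"
      using s(1) elim(1) unfolding dist_real_def by linarith
    ultimately show False
      using t by blast
  qed
  then show False
    by simp
qed

text \<open>A visit of the reshaped tiling to its patch at \<open>S x0\<close> happens at a position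
  \<open>S y\<close> with \<open>y\<close> a return point, and this position differs from the
  starting one by an integer up to a small error. Starting at \<open>t - e / 2\<close> with error
  below \<open>e / 2\<close> puts the result into the open interval from \<open>t - e\<close> to
  \<open>t\<close>; the integer changes sides, hence the sign.\<close>

lemma (in pe_form) dense_returns:
  assumes min: "minimal_map (space_topology (shape_change R \<nu> T)) (translate 1)" and e: "0 < e"
  shows "\<exists>M. \<forall>t. \<exists>m y. \<bar>real_of_int m\<bar> \<le> M \<and> agree \<rho> (translate y T) (translate x0 T) \<and>
    t - e < S y + real_of_int m \<and> S y + real_of_int m < t"
proof -
  let ?X = "reshape R \<nu> T"
  obtain A where A: "\<And>\<rho> y1 y2. 0 \<le> \<rho> \<Longrightarrow> agree (A * \<rho>) (translate (S y1) ?X) (translate (S y2) ?X) \<Longrightarrow>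
      agree \<rho> (translate y1 T) (translate y2 T)"
    using agree_if_reshape_agree by blast
  have "0 < e / 2" using e by simp
  then obtain M where M: "\<And>t. \<exists>(m::int) s. \<bar>real_of_int m\<bar> \<le> M \<and> \<bar>s\<bar> < e / 2 \<and>
      agree (A * \<bar>\<rho>\<bar>) (translate (S x0) ?X) (translate (t + of_int m + s) ?X)"
    using minimal_map_visits_uniformly[OF tiling_reshape min[unfolded shape_change_def], of "e / 2" "A * \<bar>\<rho>\<bar>" "S x0"]
    by blast
  have "\<exists>m y. \<bar>real_of_int m\<bar> \<le> M \<and> agree \<rho> (translate y T) (translate x0 T) \<and>
    t - e < S y + real_of_int m \<and> S y + real_of_int m < t" for t
  proof -
    obtain m :: int and s where m: "\<bar>real_of_int m\<bar> \<le> M" "\<bar>s\<bar> < e / 2"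
      "agree (A * \<bar>\<rho>\<bar>) (translate (S x0) ?X) (translate ((t - e / 2) + of_int m + s) ?X)"
      using M[of "t - e / 2"] by blast
    define y where "y = Q ((t - e / 2) + of_int m + s)"
    have Sy: "S y = (t - e / 2) + of_int m + s"
      by (simp add: y_def)
    have "agree \<bar>\<rho>\<bar> (translate x0 T) (translate y T)"
      using m(3) by (intro A) (simp_all add: Sy)
    then have "agree \<rho> (translate x0 T) (translate y T)"
      by (rule agree_mono) simp
    then have 1: "agree \<rho> (translate y T) (translate x0 T)"
      by (rule agree_sym)
    have 2: "\<bar>real_of_int (- m)\<bar> \<le> M" using m(1) by simp
    have 3: "t - e < S y + real_of_int (- m)" "S y + real_of_int (- m) < t"
      unfolding Sy of_int_minus using m(2) by linarith+
    show ?thesis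
      by (rule exI[of _ "- m"], rule exI[of _ y]) (intro conjI 1 2 3)
  qed
  then show ?thesis by blast
qed

section \<open>The flow along a nonvanishing form\<close>

context pe_form
begin

definition flow_shift :: "real \<Rightarrow> real \<Rightarrow> real" where
  "flow_shift t x = Q (S x + t) - x"

definition flow_displacement :: "real \<Rightarrow> 'a tiling \<Rightarrow> real" where
  "flow_displacement t = extension T (flow_shift t)"

definition flow :: "'a tiling \<times> real \<Rightarrow> 'a tiling" where
  "flow = (\<lambda>(A, t). translate (flow_displacement t A) A)"

lemma flow_shift_bound:
  assumes C: "\<And>s t. \<bar>Q s - Q t\<bar> \<le> C * \<bar>s - t\<bar>"
  shows "\<bar>flow_shift t x\<bar> \<le> C * \<bar>t\<bar>"
  using C[of "S x + t" "S x"] by (simp add: flow_shift_def)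

text \<open>The point moves by at most \<open>C * \<bar>t\<bar>\<close>, and over that distance a
  patch of the stated radius determines the increments of \<open>S\<close>. The same shift therefore
  solves the defining equation at both points.\<close>

lemma pe_radius_flow_shift:
  assumes C: "\<And>s t. \<bar>Q s - Q t\<bar> \<le> C * \<bar>s - t\<bar>"
  shows "pe_radius T (R + C * \<bar>t\<bar>) (flow_shift t)"
  unfolding pe_radius_def
proof (intro allI impI)
  fix x y assume ag: "agree (R + C * \<bar>t\<bar>) (translate x T) (translate y T)"
  define u where "u = flow_shift t x"
  have "agree (R + \<bar>u\<bar>) (translate x T) (translate y T)"
    using flow_shift_bound[OF C, of t x] by (intro agree_mono[OF ag]) (simp add: u_def)
  then have "S (y + u) - S y = S (x + u) - S x"
    by (rule S_loc)
  moreover have "S (x + u) = S x + t"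
    by (simp add: u_def flow_shift_def)
  ultimately have "S (y + u) = S y + t" by simp
  then have "Q (S y + t) = y + u" by (metis Q_S)
  then show "flow_shift t x = flow_shift t y"
    by (simp add: flow_shift_def[of t y] u_def)
qed

lemma flow_shift_cont: "continuous_on UNIV (flow_shift t)"
proof -
  have "isCont S x" for x
    using S_deriv DERIV_isCont by blast
  then have "isCont (\<lambda>x. S x + t) x" for x
    by (intro continuous_intros)
  then have "isCont (\<lambda>x. Q (S x + t)) x" for x
    using Q_cont by (rule isCont_o2)
  then have "isCont (flow_shift t) x" for x
    unfolding flow_shift_def by (intro continuous_intros)
  then show ?thesis
    by (simp add: continuous_on_eq_continuous_at)
qed

lemma flow_displacement_eq:
  assumes C: "\<And>s t. \<bar>Q s - Q t\<bar> \<le> C * \<bar>s - t\<bar>"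
    and A: "A \<in> orbit_closure T" and z: "agree (R + C * \<bar>t\<bar>) A (translate z T)"
  shows "flow_displacement t A = flow_shift t z"
  unfolding flow_displacement_def by (rule extension_pe[OF T pe_radius_flow_shift[OF C] A z])

lemma flow_translate: "flow (translate x T, t) = translate (Q (S x + t)) T"
proof -
  obtain C where C: "\<And>s t. \<bar>Q s - Q t\<bar> \<le> C * \<bar>s - t\<bar>"
    using Q_Lipschitz by blast
  have "flow_displacement t (translate x T) = flow_shift t x"
    using flow_displacement_eq[OF C translate_mem_orbit_closure[OF T self_mem_orbit_closure[OF T]]] by simp
  then show ?thesis
    by (simp add: flow_def flow_shift_def translate_translate)
qed

text \<open>The pattern radius of the displacement grows with time, so continuity on the tiling
  space is obtained at fixed time. A Lipschitz constant in time that is common to all tilings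
  upgrades it to joint continuity.\<close>

lemma flow_continuous:
  "continuous_map (prod_topology (space_topology (orbit_closure T)) euclideanreal) (space_topology (orbit_closure T)) flow"
proof -
  let ?O = "space_topology (orbit_closure T)"
  obtain C where C: "C > 0" "\<And>s t. \<bar>Q s - Q t\<bar> \<le> C * \<bar>s - t\<bar>"
    using Q_Lipschitz by blast
  have lip: "\<bar>flow_displacement s A - flow_displacement t A\<bar> \<le> C * \<bar>s - t\<bar>" if "A \<in> topspace ?O" for A s t
  proof -
    have A: "A \<in> orbit_closure T" using that by simp
    then obtain z where z: "agree (R + C * max \<bar>s\<bar> \<bar>t\<bar>) A (translate z T)"
      unfolding orbit_closure_iff[OF T] by blast
    have le: "C * \<bar>s\<bar> \<le> C * max \<bar>s\<bar> \<bar>t\<bar>" "C * \<bar>t\<bar> \<le> C * max \<bar>s\<bar> \<bar>t\<bar>"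
      using C(1) by (simp_all add: mult_left_mono)
    have "flow_displacement s A = flow_shift s z" "flow_displacement t A = flow_shift t z"
      using le by (intro flow_displacement_eq[OF C(2) A] agree_mono[OF z]; simp)+
    then show ?thesis
      using C(2)[of "S z + s" "S z + t"] by (simp add: flow_shift_def)
  qed
  have "continuous_map ?O euclideanreal (\<lambda>A. flow_displacement t A)" for t
    unfolding flow_displacement_def
    by (rule extension_continuous[OF T weakly_pe_if_pe_radius[OF pe_radius_flow_shift[OF C(2)]] flow_shift_cont])
  then have "continuous_map (prod_topology ?O euclideanreal) euclideanreal (\<lambda>(A, t). flow_displacement t A)"
    by (rule continuous_map_prod_Lipschitz) (rule lip)
  moreover have "continuous_map (prod_topology ?O euclideanreal) ?O fst"
    by (rule continuous_map_fst)
  ultimately have "continuous_map (prod_topology ?O euclideanreal) (prod_topology ?O euclideanreal)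
      (\<lambda>p. (fst p, (\<lambda>(A, t). flow_displacement t A) p))"
    by (intro continuous_map_pairedI)
  from continuous_map_compose[OF this continuous_map_translate[OF orbit_closure_subset[OF T]]]
  have "continuous_map (prod_topology ?O euclideanreal) tiling_topology flow"
    unfolding flow_def by (simp add: o_def case_prod_unfold)
  then show ?thesis
    by (rule continuous_map_into_subtopology)
      (use translate_mem_orbit_closure[OF T] in \<open>auto simp: flow_def\<close>)
qed

text \<open>For times in a bounded range, the displacement of any \<open>A\<close> equals that of
  one point \<open>z\<close> of the reference orbit whose patch matches \<open>A\<close> far enough.
  The differential equation thus reduces to the derivative of \<open>Q\<close> on the line.\<close>

lemma unidirectional_flow: "unidirectional_spe_flow (orbit_closure T) flow"
proof -
  let ?V = "extension T (\<lambda>x. 1 / \<nu> x)"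
  obtain C where C: "C > 0" "\<And>s t. \<bar>Q s - Q t\<bar> \<le> C * \<bar>s - t\<bar>"
    using Q_Lipschitz by blast
  have spe_V: "spe T (\<lambda>x. 1 / \<nu> x)"
    by (rule spe_inverse[OF spe_form nonzero])
  have pe_V: "pe_radius T R (\<lambda>x. 1 / \<nu> x)"
    unfolding pe_radius_def
  proof (intro allI impI)
    fix x y assume "agree R (translate x T) (translate y T)"
    then have "\<nu> x = \<nu> y" by (rule pe_eq)
    then show "1 / \<nu> x = 1 / \<nu> y" by simp
  qed
  have ode: "((\<lambda>t. flow_displacement t A) has_real_derivative ?V (translate (flow_displacement t A) A)) (at t)"
    and zero: "flow_displacement 0 A = 0"
    if A: "A \<in> orbit_closure T" for A t
  proof -
    \<comment> \<open>The extra 1 keeps one and the same \<open>z\<close> valid for all times in a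
      neighbourhood of \<open>t\<close>, as the derivative requires; time 0 is covered as
      well.\<close>
    define M where "M = \<bar>t\<bar> + 1"
    obtain z where z: "agree (R + C * M) A (translate z T)"
      using A unfolding orbit_closure_iff[OF T] by blast
    have eq: "flow_displacement s A = flow_shift s z" if "\<bar>s\<bar> \<le> M" for s
      using mult_left_mono[OF that, of C] C(1)
      by (intro flow_displacement_eq[OF C(2) A] agree_mono[OF z]) simp
    show "flow_displacement 0 A = 0"
      using eq[of 0] by (simp add: M_def flow_shift_def)
    have t: "\<bar>t\<bar> \<le> M" by (simp add: M_def)
    have "\<bar>flow_shift t z\<bar> \<le> C * M"
      using flow_shift_bound[OF C(2), of t z] mult_left_mono[OF t, of C] C(1) by linarith
    then have "agree (R + \<bar>flow_shift t z\<bar>) A (translate z T)"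
      by (intro agree_mono[OF z]) simp
    then have "?V (translate (flow_shift t z) A) = 1 / \<nu> (z + flow_shift t z)"
      by (rule extension_pe_translate[OF T pe_V A])
    moreover have "z + flow_shift t z = Q (S z + t)"
      by (simp add: flow_shift_def)
    ultimately have V: "?V (translate (flow_displacement t A) A) = 1 / \<nu> (Q (S z + t))"
      unfolding eq[OF t] by simp
    have "((\<lambda>s. S z + s) has_real_derivative 1) (at t)"
      by (auto intro!: derivative_eq_intros)
    from DERIV_chain2[OF Q_deriv this]
    have "((\<lambda>s. Q (S z + s) - z) has_real_derivative 1 / \<nu> (Q (S z + t)) * 1 - 0) (at t)"
      by (intro DERIV_diff DERIV_const)
    then have "((\<lambda>s. flow_shift s z) has_real_derivative 1 / \<nu> (Q (S z + t))) (at t)"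
      by (simp add: flow_shift_def)
    then show "((\<lambda>t. flow_displacement t A) has_real_derivative ?V (translate (flow_displacement t A) A)) (at t)"
      unfolding V
    proof (rule has_field_derivative_transform_within_open[of _ _ _ "ball t 1"])
      fix s assume "s \<in> ball t 1"
      then show "flow_shift s z = flow_displacement s A"
        by (intro eq[symmetric]) (auto simp: M_def dist_real_def)
    qed auto
  qed
  have "?V A \<noteq> 0" if A: "A \<in> orbit_closure T" for A
  proof -
    obtain z where "agree R A (translate z T)"
      using A unfolding orbit_closure_iff[OF T] by blast
    then have "?V A = 1 / \<nu> z"
      by (rule extension_pe[OF T pe_V A])
    then show ?thesis using nonzero by simp
  qed
  moreover have "spe_flow (orbit_closure T) ?V flow"
    unfolding spe_flow_def
  proof (intro conjI ballI spe_on_extension[OF T spe_V] flow_continuous)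
    fix A assume A: "A \<in> orbit_closure T"
    show "\<exists>x. x 0 = 0 \<and> (\<forall>t. (x has_real_derivative ?V (translate (x t) A)) (at t)) \<and>
        (\<forall>t. flow (A, t) = translate (x t) A)"
      using ode[OF A] zero[OF A] by (intro exI[of _ "\<lambda>t. flow_displacement t A"]) (simp add: flow_def)
  qed
  ultimately show ?thesis
    unfolding unidirectional_spe_flow_def by blast
qed

end

section \<open>Iterates of the line map\<close>

lemma int_iterate_0 [simp]: "int_iterate f 0 x = x"
  by (simp add: int_iterate_def)

lemma int_iterate_Suc:
  assumes "bij f"
  shows "int_iterate f (m + 1) x = f (int_iterate f m x)"
proof (cases "0 \<le> m")
  case True
  then show ?thesis by (simp add: int_iterate_def nat_add_distrib)
next
  case False
  define k where "k = nat (- (m + 1))"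
  have k: "nat (- m) = Suc k" using False by (simp add: k_def)
  have "f (int_iterate f m x) = f (inv f ((inv f ^^ k) x))"
    using False k by (simp add: int_iterate_def)
  also have "\<dots> = (inv f ^^ k) x"
    using assms by (simp add: bij_is_surj surj_f_inv_f)
  also have "\<dots> = int_iterate f (m + 1) x"
  proof (cases "m = - 1")
    case True
    then show ?thesis by (simp add: k_def)
  next
    case m: False
    with False have "\<not> 0 \<le> m + 1" by simp
    then show ?thesis by (simp add: int_iterate_def k_def)
  qed
  finally show ?thesis ..
qed

lemma int_iterate_1: "bij f \<Longrightarrow> int_iterate f 1 x = f x"
  using int_iterate_Suc[of f 0 x] by simp

lemma int_iterate_pred: "bij f \<Longrightarrow> f (int_iterate f (m - 1) x) = int_iterate f m x"
  using int_iterate_Suc[of f "m - 1" x] by simp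

lemma int_iterate_add:
  assumes f: "bij f"
  shows "int_iterate f (m + n) x = int_iterate f m (int_iterate f n x)"
proof (induction m rule: int_induct[where k = 0])
  case (step1 i)
  have "int_iterate f (i + 1 + n) x = int_iterate f (i + n + 1) x"
    by (simp add: algebra_simps)
  then show ?case
    using step1 by (simp add: int_iterate_Suc[OF f])
next
  case (step2 i)
  have "f (int_iterate f (i - 1 + n) x) = int_iterate f (i + n) x"
    using int_iterate_pred[OF f, of "i + n" x] by (simp add: algebra_simps)
  also have "\<dots> = f (int_iterate f (i - 1) (int_iterate f n x))"
    using step2 int_iterate_pred[OF f] by simp
  finally show ?case
    using bij_is_inj[OF f] by (simp add: inj_eq)
qed simp

locale pe_displacement =
  fixes T :: "'a tiling" and f \<phi> :: "real \<Rightarrow> real" and Rf D :: real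
  assumes f: "\<And>x. f x = x + \<phi> x"
    and mono: "\<And>x y. x < y \<Longrightarrow> f x < f y"
    and surj: "surj f"
    and bound: "\<And>x. \<bar>\<phi> x\<bar> \<le> D"
    and pe: "pe_radius T Rf \<phi>"
begin

abbreviation it :: "int \<Rightarrow> real \<Rightarrow> real" where "it \<equiv> int_iterate f"

lemma less_iff: "f x < f y \<longleftrightarrow> x < y"
  using mono[of x y] mono[of y x] by (cases x y rule: linorder_cases) auto

lemma bij: "bij f"
proof -
  have "inj f"
    by (rule injI) (metis less_iff less_irrefl linorder_cases)
  with surj show ?thesis by (simp add: bij_def)
qed

lemma it_less_iff: "it m x < it m y \<longleftrightarrow> x < y"
proof (induction m rule: int_induct[where k = 0])
  case (step1 i)
  then show ?case by (simp add: int_iterate_Suc[OF bij] less_iff)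
next
  case (step2 i)
  then show ?case
    using less_iff[of "it (i - 1) x" "it (i - 1) y"] by (simp add: int_iterate_pred[OF bij])
qed simp

lemma it_disp: "\<bar>it m x - x\<bar> \<le> \<bar>real_of_int m\<bar> * D"
proof (induction m rule: int_induct[where k = 0])
  case (step1 i)
  have "it (i + 1) x = it i x + \<phi> (it i x)"
    by (simp add: int_iterate_Suc[OF bij] f)
  moreover have "\<bar>real_of_int (i + 1)\<bar> * D = \<bar>real_of_int i\<bar> * D + D"
    using step1(1) by (simp add: algebra_simps)
  ultimately show ?case
    using step1(2) bound[of "it i x"] by linarith
next
  case (step2 i)
  have "it i x = it (i - 1) x + \<phi> (it (i - 1) x)"
    using int_iterate_pred[OF bij, of i x] by (simp add: f)
  moreover have "\<bar>real_of_int (i - 1)\<bar> * D = \<bar>real_of_int i\<bar> * D + D"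
    using step2(1) by (simp add: algebra_simps)
  ultimately show ?case
    using step2(2) bound[of "it (i - 1) x"] by linarith
qed simp

lemma D_nonneg: "0 \<le> D"
  using bound[of 0] by simp

lemma f_loc:
  assumes "agree (W + Rf) (translate x1 T) (translate x2 T)" "\<bar>y - x1\<bar> \<le> W"
  shows "f (y + (x2 - x1)) = f y + (x2 - x1)"
proof -
  have "agree Rf (translate (y - x1) (translate x1 T)) (translate (y - x1) (translate x2 T))"
    by (rule agree_translate[OF assms(1)]) (use assms(2) in simp)
  then have "agree Rf (translate y T) (translate (y + (x2 - x1)) T)"
    by (simp add: translate_translate algebra_simps)
  then have "\<phi> y = \<phi> (y + (x2 - x1))"
    using pe unfolding pe_radius_def by blast
  then show ?thesis by (simp add: f)
qed

text \<open>Each iterate moves by at most \<open>D\<close>, so the window grows by \<open>D\<close>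
  per step, and \<open>Rf\<close> is needed for the last one. For negative \<open>m\<close> locality
  of the inverse is deduced from that of \<open>f\<close>: the two candidates have the same image
  and \<open>f\<close> is injective.\<close>

lemma it_loc:
  "agree (W + \<bar>real_of_int m\<bar> * D + Rf) (translate x1 T) (translate x2 T) \<Longrightarrow> \<bar>y - x1\<bar> \<le> W \<Longrightarrow>
    it m (y + (x2 - x1)) = it m y + (x2 - x1)"
proof (induction m rule: int_induct[where k = 0])
  case (step1 i)
  have le: "\<bar>real_of_int i\<bar> * D \<le> \<bar>real_of_int (i + 1)\<bar> * D"
    using step1(1) D_nonneg by (intro mult_right_mono) auto
  have "agree (W + \<bar>real_of_int i\<bar> * D + Rf) (translate x1 T) (translate x2 T)"
    by (rule agree_mono[OF step1(3)]) (use le in simp)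
  moreover from this have "it i (y + (x2 - x1)) = it i y + (x2 - x1)"
    by (rule step1(2)[OF _ step1(4)])
  moreover have "\<bar>it i y - x1\<bar> \<le> W + \<bar>real_of_int i\<bar> * D"
    using it_disp[of i y] step1(4) by linarith
  ultimately show ?case
    using f_loc[of "W + \<bar>real_of_int i\<bar> * D" x1 x2 "it i y"] by (simp add: int_iterate_Suc[OF bij])
next
  case (step2 i)
  have le: "\<bar>real_of_int i\<bar> * D \<le> \<bar>real_of_int (i - 1)\<bar> * D"
    using step2(1) D_nonneg by (intro mult_right_mono) auto
  have "agree (W + \<bar>real_of_int i\<bar> * D + Rf) (translate x1 T) (translate x2 T)"
    by (rule agree_mono[OF step2(3)]) (use le in simp)
  then have IH: "it i (y + (x2 - x1)) = it i y + (x2 - x1)"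
    by (rule step2(2)[OF _ step2(4)])
  have "\<bar>it (i - 1) y - x1\<bar> \<le> W + \<bar>real_of_int (i - 1)\<bar> * D"
    using it_disp[of "i - 1" y] step2(4) by linarith
  with step2(3) have "f (it (i - 1) y + (x2 - x1)) = f (it (i - 1) y) + (x2 - x1)"
    by (intro f_loc[of "W + \<bar>real_of_int (i - 1)\<bar> * D"])
  also have "\<dots> = f (it (i - 1) (y + (x2 - x1)))"
    by (simp add: int_iterate_pred[OF bij] IH)
  finally show ?case
    using bij_is_inj[OF bij] by (simp add: inj_eq)
qed simp

lemma it_lower:
  assumes "\<And>x. \<delta> \<le> \<phi> x"
  shows "x + real n * \<delta> \<le> it (int n) x"
proof (induction n)
  case (Suc n)
  have "it (int (Suc n)) x = it (int n) x + \<phi> (it (int n) x)"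
    using int_iterate_Suc[OF bij, of "int n" x] by (simp add: f add.commute)
  then show ?case
    using Suc assms[of "it (int n) x"] by (simp add: algebra_simps)
qed simp

lemma it_upper:
  assumes "\<And>x. \<phi> x \<le> - \<delta>"
  shows "it (int n) x \<le> x - real n * \<delta>"
proof (induction n)
  case (Suc n)
  have "it (int (Suc n)) x = it (int n) x + \<phi> (it (int n) x)"
    using int_iterate_Suc[OF bij, of "int n" x] by (simp add: f add.commute)
  then show ?case
    using Suc assms[of "it (int n) x"] by (simp add: algebra_simps)
qed simp

end

text \<open>Betweenness does not tell which of the two iterates lies on the left; the sign of the
  displacement does. If points move to the right, \<open>rotation_lift\<close> applies directly;
  otherwise it is applied to the inverse iterates and -S, and the resulting function is
  negated.\<close>

lemma rotation_lift_line_map: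
  assumes "pe_form T \<nu> R" and "pe_displacement T f \<phi> Rf D"
    and \<delta>: "0 < \<delta>" and sgn: "(\<forall>x. \<delta> \<le> \<phi> x) \<or> (\<forall>x. \<phi> x \<le> - \<delta>)"
    and rot: "\<And>x1 x2 m n. agree Rr (translate x1 T) (translate x2 T) \<Longrightarrow>
        of_int m < form_integral \<nu> x1 x2 \<Longrightarrow> form_integral \<nu> x1 x2 < of_int n \<Longrightarrow>
        strictly_between x2 (int_iterate f m x1) (int_iterate f n x1)"
    and return: "\<And>x. \<exists>y. \<bar>y - x\<bar> \<le> L \<and> agree Rr (translate y T) (translate 0 T)"
    and min: "minimal_map (space_topology (shape_change R \<nu> T)) (translate 1)"
  shows "\<exists>h. continuous_on UNIV h \<and> (\<forall>x. h (f x) = h x + 1) \<and> weakly_pe T (\<lambda>x. h x - form_integral \<nu> 0 x)"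
proof -
  interpret pe_form T \<nu> R by fact
  interpret pe_displacement T f \<phi> Rf D by fact
  obtain c where c: "0 < c" "\<And>x y. c * \<bar>x - y\<bar> \<le> \<bar>S x - S y\<bar>"
    using S_lower by blast
  obtain A where A: "\<And>x y. \<bar>S x - S y\<bar> \<le> A * \<bar>x - y\<bar>"
    using S_upper by blast
  define C where "C = {y. agree Rr (translate y T) (translate 0 T)}"
  have C_dense: "\<exists>y. \<bar>y - x\<bar> \<le> L \<and> y \<in> C" for x
    using return[of x] by (simp add: C_def)
  have between: "strictly_between y2 (it m y1) (it n y1)"
    if "y1 \<in> C" "y2 \<in> C" "of_int m < S y2 - S y1" "S y2 - S y1 < of_int n" for y1 y2 m n
  proof (rule rot)
    show "agree Rr (translate y1 T) (translate y2 T)"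
      using that(1,2) agree_trans agree_sym unfolding C_def by blast
    show "of_int m < form_integral \<nu> y1 y2" "form_integral \<nu> y1 y2 < of_int n"
      using that(3,4) unfolding S_diff[of y1 y2] .
  qed
  have dense: "\<exists>M. \<forall>t. \<exists>m y. \<bar>real_of_int m\<bar> \<le> M \<and> y \<in> C \<and> t - e < S y + real_of_int m \<and> S y + real_of_int m < t"
    if "0 < e" for e
    using dense_returns[OF min that, of Rr 0] by (simp add: C_def)
  have it_add: "it (m + n) x = it m (it n x)" for m n x
    by (rule int_iterate_add[OF bij])
  have J: "\<exists>n. l \<le> real n * \<delta>" for l
    using reals_Archimedean3[OF \<delta>] less_imp_le by blast
  from sgn show ?thesis
  proof
    assume up: "\<forall>x. \<delta> \<le> \<phi> x"
    have pos: "it m x < it n x" if "m < n" for m n x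
    proof -
      have "it m x < it (int (nat (n - m))) (it m x)"
        using it_lower[of \<delta> "it m x" "nat (n - m)"] up \<delta> that
        by (smt (verit) mult_pos_pos of_nat_0_less_iff zero_less_nat_eq)
      then show ?thesis
        using it_add[of "n - m" m x] that by simp
    qed
    have "\<exists>h. continuous_on UNIV h \<and> (\<forall>x. h (it 1 x) = h x + 1) \<and> weakly_pe T (\<lambda>x. h x - S x)"
    proof (rule rotation_lift[where T=T and L=L and Rc=Rr and ?x0.0=0 and c=c and A=A and D=D and Rf=Rf and R=R and it=it and S=S, folded C_def])
      show "it 0 x = x" for x by simp
      show "it (m + n) x = it m (it n x)" for m n x by (rule it_add)
      show "it m x < it m y" if "x < y" for m x y using that by (simp add: it_less_iff)
      show "\<exists>J. \<forall>x. x + l \<le> it J x" for l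
      proof -
        obtain n where "l \<le> real n * \<delta>" using J by blast
        then have "x + l \<le> it (int n) x" for x
          using it_lower[of \<delta> x n] up by fastforce
        then show ?thesis by blast
      qed
      show "y2 < it n y1" if y: "y1 \<in> C" "y2 \<in> C" "S y2 - S y1 < of_int n" for y1 y2 n
      proof -
        \<comment> \<open>Any integer strictly below the integral will do; the 1 is subtracted
          because the integral may itself be an integer.\<close>
        define m where "m = \<lfloor>S y2 - S y1\<rfloor> - 1"
        have m: "of_int m < S y2 - S y1" unfolding m_def by linarith
        then have "m < n" using y(3) by linarith
        then show ?thesis
          using between[OF y(1,2) m y(3)] pos[of m n y1] unfolding strictly_between_def by auto
      qed
    qed (fact it_disp it_loc dense C_dense c A S_loc)+
    then show ?thesis by (simp add: int_iterate_1[OF bij])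
  next
    assume down: "\<forall>x. \<phi> x \<le> - \<delta>"
    have neg: "it n x < it m x" if "m < n" for m n x
    proof -
      have "it (int (nat (n - m))) (it m x) < it m x"
        using it_upper[of \<delta> "nat (n - m)" "it m x"] down \<delta> that
        by (smt (verit) mult_pos_pos of_nat_0_less_iff zero_less_nat_eq)
      then show ?thesis
        using it_add[of "n - m" m x] that by simp
    qed
    have "\<exists>h. continuous_on UNIV h \<and> (\<forall>x. h (it (- 1) x) = h x + 1) \<and> weakly_pe T (\<lambda>x. h x - (- S x))"
    proof (rule rotation_lift[where T=T and L=L and Rc=Rr and ?x0.0=0 and c=c and A=A and D=D and Rf=Rf and R=R and it="\<lambda>m. it (- m)" and S="\<lambda>x. - S x", folded C_def])
      show "it (- 0) x = x" for x by simp
      show "it (- (m + n)) x = it (- m) (it (- n) x)" for m n x using it_add[of "- m" "- n" x] by simp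
      show "it (- m) x < it (- m) y" if "x < y" for m x y using that by (simp add: it_less_iff)
      show "\<bar>it (- m) x - x\<bar> \<le> \<bar>real_of_int m\<bar> * D" for m x
        using it_disp[of "- m" x] by simp
      show "it (- m) (y + (x2 - x1)) = it (- m) y + (x2 - x1)"
        if "agree (W + \<bar>real_of_int m\<bar> * D + Rf) (translate x1 T) (translate x2 T)" "\<bar>y - x1\<bar> \<le> W" for W m x1 x2 y
        using it_loc[of W "- m" x1 x2 y] that by simp
      show "\<exists>J. \<forall>x. x + l \<le> it (- J) x" for l
      proof -
        obtain n where n: "l \<le> real n * \<delta>" using J by blast
        have "x + l \<le> it (- int n) x" for x
        proof -
          have "it (int n) (it (- int n) x) \<le> it (- int n) x - real n * \<delta>"
            using it_upper[of \<delta> n "it (- int n) x"] down by blast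
          moreover have "it (int n) (it (- int n) x) = x"
            using it_add[of "int n" "- int n" x] by simp
          ultimately show ?thesis using n by linarith
        qed
        then show ?thesis by blast
      qed
      show "y2 < it (- n) y1" if y: "y1 \<in> C" "y2 \<in> C" "- S y2 - (- S y1) < of_int n" for y1 y2 n
      proof -
        \<comment> \<open>Here the free integer is the upper one, again chosen to give a strict
          inequality.\<close>
        define m where "m = \<lfloor>S y2 - S y1\<rfloor> + 1"
        have m: "S y2 - S y1 < of_int m" unfolding m_def by linarith
        have n: "of_int (- n) < S y2 - S y1" using y(3) by simp
        then have "- n < m" using m by linarith
        then show ?thesis
          using between[OF y(1,2) n m] neg[of "- n" m y1] unfolding strictly_between_def by auto
      qed
      show "\<exists>M. \<forall>t. \<exists>m y. \<bar>real_of_int m\<bar> \<le> M \<and> y \<in> C \<and> t - e < - S y + real_of_int m \<and> - S y + real_of_int m < t"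
        if e: "0 < e" for e
      proof -
        obtain M where M: "\<forall>t. \<exists>m y. \<bar>real_of_int m\<bar> \<le> M \<and> y \<in> C \<and> t - e < S y + real_of_int m \<and> S y + real_of_int m < t"
          using dense[OF e] by blast
        have "\<exists>m y. \<bar>real_of_int m\<bar> \<le> M \<and> y \<in> C \<and> t - e < - S y + real_of_int m \<and> - S y + real_of_int m < t" for t
        proof -
          \<comment> \<open>The target interval is reflected: \<open>S y + m\<close> is placed
            between \<open>- t\<close> and \<open>e - t\<close>, so that its negative falls between
            \<open>t - e\<close> and \<open>t\<close>.\<close>
          obtain m y where y: "\<bar>real_of_int m\<bar> \<le> M" "y \<in> C" "(e - t) - e < S y + real_of_int m" "S y + real_of_int m < e - t"
            using M by blast
          then show ?thesis
            by (intro exI[of _ "- m"] exI[of _ y]) simp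
        qed
        then show ?thesis by blast
      qed
      show "c * \<bar>x - y\<bar> \<le> \<bar>- S x - - S y\<bar>" for x y
        using c(2)[of x y] by simp
      show "\<bar>- S x - - S y\<bar> \<le> A * \<bar>x - y\<bar>" for x y
        using A[of x y] by simp
      show "- S (y + u) - - S y = - S (x + u) - - S x"
        if "agree (R + \<bar>u\<bar>) (translate x T) (translate y T)" for u x y
        using S_loc[OF that] by simp
    qed (fact C_dense c(1))+
    then obtain h where h: "continuous_on UNIV h" "\<And>x. h (it (- 1) x) = h x + 1" "weakly_pe T (\<lambda>x. h x + S x)"
      by auto
    \<comment> \<open>Since \<open>h\<close> grows by 1 under the inverse of \<open>f\<close>, its
      negative grows by 1 under \<open>f\<close>; likewise the closeness of \<open>h\<close> to -S
      becomes closeness of \<open>- h\<close> to \<open>S\<close>.\<close>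
    show ?thesis
    proof (intro exI[of _ "\<lambda>x. - h x"] conjI allI)
      show "continuous_on UNIV (\<lambda>x. - h x)"
        using h(1) by (intro continuous_intros)
      show "- h (f x) = - h x + 1" for x
      proof -
        have "it (- 1) (f x) = x"
          using it_add[of "- 1" 1 x] by (simp add: int_iterate_1[OF bij])
        then show ?thesis using h(2)[of "f x"] by simp
      qed
      show "weakly_pe T (\<lambda>x. - h x - S x)"
        using h(3) unfolding weakly_pe_def by (simp add: abs_minus_commute add.commute algebra_simps)
    qed
  qed
qed

section \<open>From the tiling map to the semi-conjugacy\<close>

lemma nonvanishing_sign:
  fixes \<phi> :: "real \<Rightarrow> real"
  assumes "continuous_on UNIV \<phi>" "\<And>x. \<phi> x \<noteq> 0"
  shows "(\<forall>x. 0 < \<phi> x) \<or> (\<forall>x. \<phi> x < 0)"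
proof (rule ccontr)
  assume "\<not> ?thesis"
  then obtain x y where "\<phi> x \<le> 0" "0 \<le> \<phi> y"
    by (auto simp: not_less)
  moreover have "connected (range \<phi>)"
    using assms(1) by (rule connected_continuous_image) simp
  ultimately have "0 \<in> range \<phi>"
    by (metis connectedD_interval rangeI)
  then show False
    using assms(2) by (metis rangeE)
qed

text \<open>A continuous injection of the line is strictly monotone, and a map at bounded distance
  from the identity cannot be decreasing.\<close>

lemma continuous_bounded_displacement:
  fixes \<phi> :: "real \<Rightarrow> real"
  assumes cont: "continuous_on UNIV \<phi>" and bound: "\<And>x. \<bar>\<phi> x\<bar> \<le> D"
  shows "surj (\<lambda>x. x + \<phi> x)"
    and "inj (\<lambda>x. x + \<phi> x) \<Longrightarrow> x < y \<Longrightarrow> x + \<phi> x < y + \<phi> y"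
proof -
  let ?f = "\<lambda>x. x + \<phi> x"
  have f_cont: "continuous_on X ?f" for X
    by (intro continuous_intros continuous_on_subset[OF cont]) simp
  show "surj ?f"
    unfolding surj_def
  proof
    fix t
    have "?f (t - D) \<le> t" "t \<le> ?f (t + D)" "t - D \<le> t + D"
      using bound[of "t - D"] bound[of "t + D"] by linarith+
    then obtain z where "?f z = t"
      using IVT'[of ?f "t - D" t "t + D"] f_cont by blast
    then show "\<exists>z. t = ?f z" by blast
  qed
  assume inj: "inj ?f" and xy: "x < y"
  show "x + \<phi> x < y + \<phi> y"
  proof (rule ccontr)
    assume "\<not> ?thesis"
    then have 1: "?f y \<le> ?f x" by simp
    \<comment> \<open>A point to the right of \<open>y\<close>, so far out that its image exceeds
      that of \<open>x\<close> in spite of the displacement. On the interval from \<open>x\<close>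
      to \<open>z\<close> the injection must therefore increase.\<close>
    define z where "z = max y (?f x) + D + 1"
    have "0 \<le> D" using bound[of 0] by simp
    then have z: "y < z" "?f x < ?f z"
      using bound[of z] unfolding z_def by linarith+
    have "inj_on ?f {x..z}"
      using inj by (rule inj_on_subset) simp
    then have "(?f x < ?f y \<and> ?f y < ?f z) \<or> (?f z < ?f y \<and> ?f y < ?f x)"
      using continuous_inj_imp_mono[of x y z ?f] xy z(1) f_cont by blast
    then show False using 1 z(2) by linarith
  qed
qed

text \<open>The rotation property is given for \<open>\<mu>\<close>, minimality for another
  representative \<open>\<nu>\<close> of the class. Their primitives differ by \<open>g\<close> and
  a constant, and \<open>g\<close> has equal values at points whose patches match, so the two
  integrals between such points are equal.\<close>

lemma rotation_form_cohomologous: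
  assumes rot: "rotation_form F T \<mu>" and \<nu>: "spe T \<nu>" and co: "cohomologous T \<mu> \<nu>"
  shows "rotation_form F T \<nu>"
proof -
  obtain Rr where Rr: "Rr > 0"
    "\<And>x1 x2 m n. agree Rr (translate x1 T) (translate x2 T) \<Longrightarrow>
       of_int m < form_integral \<mu> x1 x2 \<Longrightarrow> form_integral \<mu> x1 x2 < of_int n \<Longrightarrow>
       strictly_between x2 (int_iterate (line_map F T) m x1) (int_iterate (line_map F T) n x1)"
    using rot unfolding rotation_form_def by metis
  obtain g where g: "spe T g" "\<And>x. (g has_real_derivative (\<nu> x - \<mu> x)) (at x)"
    using co unfolding cohomologous_def by metis
  obtain Rg where Rg: "pe_radius T Rg g"
    using g(1) unfolding spe_def by blast
  have cont: "continuous_on UNIV \<mu>" "continuous_on UNIV \<nu>"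
    using rot \<nu> unfolding rotation_form_def spe_def by blast+
  let ?d = "\<lambda>x. form_integral \<nu> 0 x - form_integral \<mu> 0 x - g x"
  have "(?d has_real_derivative \<nu> x - \<mu> x - (\<nu> x - \<mu> x)) (at x)" for x
    by (intro DERIV_diff form_integral_antiderivative cont g(2))
  then have "(?d has_real_derivative 0) (at x)" for x
    by simp
  then have d: "?d x = ?d y" for x y
    using DERIV_isconst_all[of ?d] by blast
  have eq: "form_integral \<nu> x1 x2 = form_integral \<mu> x1 x2"
    if "agree (max Rr Rg) (translate x1 T) (translate x2 T)" for x1 x2
  proof -
    have "agree Rg (translate x1 T) (translate x2 T)"
      by (rule agree_mono[OF that]) simp
    then have "g x1 = g x2"
      using Rg unfolding pe_radius_def by blast
    then show ?thesis
      using d[of x1 x2] form_integral_antiderivative(2)[OF cont(1), of x1 x2]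
        form_integral_antiderivative(2)[OF cont(2), of x1 x2] by linarith
  qed
  show ?thesis
    unfolding rotation_form_def
  proof (intro conjI \<nu> exI[of _ "max Rr Rg"] allI impI)
    show "0 < max Rr Rg" using Rr(1) by simp
    fix x1 x2 and m n :: int
    assume ag: "agree (max Rr Rg) (translate x1 T) (translate x2 T)"
      and mn: "of_int m < form_integral \<nu> x1 x2 \<and> form_integral \<nu> x1 x2 < of_int n"
    have "agree Rr (translate x1 T) (translate x2 T)"
      by (rule agree_mono[OF ag]) simp
    then show "strictly_between x2 (int_iterate (line_map F T) m x1) (int_iterate (line_map F T) n x1)"
      using mn unfolding eq[OF ag] by (intro Rr(2)) blast+
  qed
qed

theorem theorem3:
  fixes \<Omega> :: "'a tiling set" and F :: "'a tiling \<Rightarrow> 'a tiling"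
    and T :: "'a tiling" and \<mu> :: "real \<Rightarrow> real"
  assumes "tiling_space \<Omega>"
    and "uniquely_ergodic \<Omega>"
    and "F \<in> tiling_maps \<Omega>"
    and "T \<in> \<Omega>"
    and "rotation_form F T \<mu>"
    and "irrational_class T (cohomology_class T \<mu>)"
  shows "\<exists>\<Psi>. unidirectional_spe_flow \<Omega> \<Psi> \<and>
           semiconjugate (space_topology \<Omega>) F (space_topology \<Omega>) (\<lambda>S. \<Psi> (S, 1))"
proof -
  let ?O = "space_topology \<Omega>"
  note T = tiling_space_reference(1)[OF assms(1,4)]
    and \<Omega> = tiling_space_reference(2)[OF assms(1,4)]
    and nonper = tiling_space_reference(3)[OF assms(1,4)]
    and returns = tiling_space_reference(4)[OF assms(1,4)]
  obtain \<nu> R where \<nu>: "\<nu> \<in> cohomology_class T \<mu>" "R > 0" "pe_radius T R \<nu>" "(\<forall>x. 0 < \<nu> x) \<or> (\<forall>x. \<nu> x < 0)"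
    and min: "minimal_map (space_topology (shape_change R \<nu> T)) (translate 1)"
    using assms(6) unfolding irrational_class_def by blast
  have \<nu>': "spe T \<nu>" "cohomologous T \<mu> \<nu>"
    using \<nu>(1) unfolding cohomology_class_def by blast+
  interpret pe_form T \<nu> R
    by unfold_locales (use T \<nu> \<nu>'(1) in \<open>auto simp: spe_def\<close>)
  have rot: "rotation_form F T \<nu>"
    by (rule rotation_form_cohomologous[OF assms(5) \<nu>'])
  have orbit: "translate x T \<in> \<Omega>" for x
    unfolding \<Omega> by (rule translate_mem_orbit_closure[OF T self_mem_orbit_closure[OF T]])
  have top: "topspace ?O = \<Omega>"
    unfolding \<Omega> using orbit_closure_subset[OF T] by auto
  have translate_inj: "x = y" if "translate x T = translate y T" for x y
  proof (rule ccontr)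
    assume "x \<noteq> y"
    have "translate (- y) (translate x T) = translate (- y) (translate y T)"
      using that by simp
    then have "translate (x - y) T = T"
      by (simp add: translate_translate)
    then show False
      using nonper \<open>x \<noteq> y\<close> unfolding nonperiodic_def by simp
  qed
  have F_homeo: "homeomorphic_map ?O ?O F"
    using assms(3) unfolding tiling_maps_def by blast
  obtain \<Phi> where \<Phi>: "spe_on \<Omega> \<Phi>" "\<And>A. A \<in> \<Omega> \<Longrightarrow> F A = translate (\<Phi> A) A"
    using assms(3) unfolding tiling_maps_def by blast
  define \<phi> where "\<phi> x = \<Phi> (translate x T)" for x
  have spe_\<phi>: "spe T \<phi>"
    using \<Phi>(1) assms(4) unfolding spe_on_def \<phi>_def by blast
  define f where "f x = x + \<phi> x" for x
  have F_f: "F (translate x T) = translate (f x) T" for x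
    using \<Phi>(2)[OF orbit] by (simp add: translate_translate f_def \<phi>_def add.commute)
  \<comment> \<open>The definite description is resolved by nonperiodicity: a position on the orbit
    is determined by its translate.\<close>
  have line: "line_map F T = f"
    unfolding line_map_def F_f by (intro ext the_equality) (auto dest: translate_inj)
  have F_inj: "inj_on F \<Omega>"
    using homeomorphic_imp_injective_map[OF F_homeo] unfolding top .
  have "inj f"
  proof (rule injI)
    fix x y assume "f x = f y"
    then have "F (translate x T) = F (translate y T)"
      by (simp add: F_f)
    then have "translate x T = translate y T"
      using F_inj orbit by (auto dest: inj_onD)
    then show "x = y"
      by (rule translate_inj)
  qed
  obtain D where D: "\<And>x. \<bar>\<phi> x\<bar> \<le> D"
    using spe_bounded[OF T spe_\<phi>] by blast
  obtain Rf where Rf: "pe_radius T Rf \<phi>" and \<phi>_cont: "continuous_on UNIV \<phi>"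
    using spe_\<phi> unfolding spe_def by blast
  have displacement: "pe_displacement T f \<phi> Rf D"
  proof
    show "f x < f y" if "x < y" for x y
      using continuous_bounded_displacement(2)[OF \<phi>_cont D _ that] \<open>inj f\<close> unfolding f_def by blast
    show "surj f"
      using continuous_bounded_displacement(1)[OF \<phi>_cont D] unfolding f_def .
  qed (use f_def D Rf in auto)
  interpret pe_displacement T f \<phi> Rf D
    by (rule displacement)
  obtain Rr where Rr: "Rr > 0"
    "\<And>x1 x2 m n. agree Rr (translate x1 T) (translate x2 T) \<Longrightarrow>
       of_int m < form_integral \<nu> x1 x2 \<Longrightarrow> form_integral \<nu> x1 x2 < of_int n \<Longrightarrow>
       strictly_between x2 (it m x1) (it n x1)"
    using rot unfolding rotation_form_def line by metis
  \<comment> \<open>The rotation property is used on the diagonal: the integral from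
    \<open>x\<close> to \<open>x\<close> is 0, which lies between -1 and 1, so \<open>x\<close> is
    strictly between its preimage and its image and cannot be fixed.\<close>
  have \<phi>_nz: "\<phi> x \<noteq> 0" for x
  proof
    assume "\<phi> x = 0"
    then have fx: "f x = x" by (simp add: f_def)
    moreover have "it (- 1) (f x) = x"
      using int_iterate_add[OF bij, of "- 1" 1 x] by (simp add: int_iterate_1[OF bij])
    ultimately have "it (- 1) x = x" "it 1 x = x"
      by (simp_all add: int_iterate_1[OF bij])
    moreover have "strictly_between x (it (- 1) x) (it 1 x)"
      using S_diff[of x x] by (intro Rr(2)) auto
    ultimately show False
      by (simp add: strictly_between_def)
  qed
  obtain \<delta> where \<delta>: "\<delta> > 0" "\<And>x. \<delta> \<le> \<bar>\<phi> x\<bar>"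
    using spe_bounded_below[OF T spe_\<phi> \<phi>_nz] by blast
  have sgn: "(\<forall>x. \<delta> \<le> \<phi> x) \<or> (\<forall>x. \<phi> x \<le> - \<delta>)"
    using nonvanishing_sign[OF \<phi>_cont \<phi>_nz]
  proof
    assume "\<forall>x. 0 < \<phi> x"
    then have "\<delta> \<le> \<phi> x" for x using \<delta>(2)[of x] by (metis abs_of_pos)
    then show ?thesis by blast
  next
    assume neg: "\<forall>x. \<phi> x < 0"
    have "\<phi> x \<le> - \<delta>" for x using \<delta>(2)[of x] neg[rule_format, of x] by linarith
    then show ?thesis by blast
  qed
  obtain L where L: "\<And>x. \<exists>y. \<bar>y - x\<bar> \<le> L \<and> agree Rr (translate y T) (translate 0 T)"
    using returns[of Rr 0] by blast
  obtain h where h: "continuous_on UNIV h" "\<And>x. h (f x) = h x + 1" "weakly_pe T (\<lambda>x. h x - S x)"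
    using rotation_lift_line_map[OF pe_form_axioms displacement \<delta>(1) sgn Rr(2) L min] by blast
  \<comment> \<open>Flowing for time h - S from \<open>x\<close> leads to the point whose
    \<open>S\<close>-value is \<open>h x\<close>. As a flow time on tilings this makes sense off the
    reference orbit too, where \<open>h\<close> and \<open>S\<close> separately do not.\<close>
  define G where "G = extension T (\<lambda>x. h x - S x)"
  have G_cont: "continuous_map ?O euclideanreal G"
    unfolding G_def \<Omega> by (rule extension_continuous[OF T h(3)]) (intro continuous_intros h(1) S_cont)
  define H where "H A = flow (A, G A)" for A
  have flow_cont: "continuous_map (prod_topology ?O euclideanreal) ?O flow"
    unfolding \<Omega> by (rule flow_continuous)
  have H_cont: "continuous_map ?O ?O H"
    using continuous_map_compose[OF continuous_map_pairedI[OF continuous_map_id G_cont] flow_cont]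
    by (simp add: o_def H_def[abs_def] id_def)
  have sample_cont: "continuous_map ?O ?O (\<lambda>A. flow (A, 1))"
    using continuous_map_compose[OF _ flow_cont, of ?O "\<lambda>A. (A, 1)"]
    by (simp add: o_def continuous_map_paired)
  have H_orbit: "H (translate x T) = translate (Q (h x)) T" for x
    unfolding H_def G_def extension_orbit[OF T h(3)] flow_translate by simp
  have conj_orbit: "flow (H (translate x T), 1) = H (F (translate x T))" for x
    by (simp only: F_f H_orbit flow_translate S_Q h(2))
  \<comment> \<open>Both sides are continuous with values in a Hausdorff space, so the identity
    passes from the dense orbit of \<open>T\<close> to the whole space.\<close>
  have "flow (H A, 1) = H (F A)" if A: "A \<in> \<Omega>" for A
  proof (rule forall_in_closure_of_eq[where X = ?O and Y = ?O and S = "range (\<lambda>s. translate s T)"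
        and f = "\<lambda>A. flow (H A, 1)" and g = "\<lambda>A. H (F A)" and x = A])
    show "Hausdorff_space ?O"
      by (rule Hausdorff_space_subtopology[OF Hausdorff_tiling_topology])
    show "continuous_map ?O ?O (\<lambda>A. flow (H A, 1))"
      using continuous_map_compose[OF H_cont sample_cont] by (simp add: o_def)
    show "continuous_map ?O ?O (\<lambda>A. H (F A))"
      using continuous_map_compose[OF homeomorphic_imp_continuous_map[OF F_homeo] H_cont] by (simp add: o_def)
    have "\<Omega> \<inter> range (\<lambda>s. translate s T) = range (\<lambda>s. translate s T)"
      using orbit by blast
    then show "A \<in> ?O closure_of (range (\<lambda>s. translate s T))"
      using A unfolding closure_of_subtopology by (simp add: \<Omega> orbit_closure_def)
    show "flow (H B, 1) = H (F B)" if "B \<in> range (\<lambda>s. translate s T)" for B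
      using that conj_orbit by blast
  qed
  then have "semiconjugate ?O F ?O (\<lambda>A. flow (A, 1))"
    unfolding semiconjugate_def using H_cont top by blast
  moreover have "unidirectional_spe_flow \<Omega> flow"
    unfolding \<Omega> by (rule unidirectional_flow)
  ultimately show ?thesis
    by blast
qed

end
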